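(* Let $n\in\mathbb N$, let $\Omega\subset\mathbb R^n$ be a bounded domain with boundary of class $C^2$, let $0<\alpha\le 1$ and $T>0$. Let $\mathcal A=(a_{ij})_{1\le i,j\le n}$ with $a_{ij}=a_{ji}\in C^1(\overline\Omega)$ be uniformly elliptic, i.e. there is a constant $\kappa_0>0$ with $\sum_{i,j=1}^n a_{ij}(x)\xi_i\xi_j\ge\kappa_0\sum_{j=1}^n\xi_j^2$ for all $x\in\overline\Omega$ and $\xi\in\mathbb R^n$; let $\mathcal B=(b_1,\dots,b_n)$ with $b_j\in W^{1,\infty}(\Omega)$, and let $p\in L^\infty(\Omega)$ (all coefficients real-valued). Assume that there exists a function $b\in W^{2,\infty}(\Omega)$ such that $\mathcal B=\mathcal A\nabla b$. Let $L$ be the operator on $L^2(\Omega)$ with domain $D(L)=H^2(\Omega)\cap H^1_0(\Omega)$ given by $$Lu=\mathrm{div}(\mathcal A\nabla u)+\mathcal B\cdot\nabla u+pu .$$ Let $u_T\in L^2(\Omega)$ and let $u\in C([0,T];L^2(\Omega))$ be a solution of $$\partial_t^\alpha u=Lu \ \text{ in }(0,T)\times\Omega,\qquad u|_{\partial\Omega}=0\ \text{ on }(0,T)\times\partial\Omega,\qquad u(T,\cdot)=u_T\ \text{ in }\Omega.$$ If $u(T,\cdot)=0$, then $u(t,\cdot)=0$ for all $t\in[0,T]$.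
   Context: $\partial_t^\alpha$ is the Caputo derivative in time: $\partial_t^\alpha u(t)=\frac{1}{\Gamma(1-\alpha)}\int_0^t(t-s)^{-\alpha}\frac{d}{ds}u(s)\,ds$ for $0<\alpha<1$, and $\partial_t^1u=\frac{d}{dt}u$, whenever the right-hand side is defined; $\Gamma$ is the Euler gamma function. Notion of solution: $L$ with domain $H^2(\Omega)\cap H^1_0(\Omega)$ generates a $C_0$-semigroup $(S(t))_{t\ge0}$ on $L^2(\Omega)$. The solution of $\partial_t^\alpha u=Lu$ with Dirichlet boundary condition and initial value $u(0,\cdot)=u_0\in L^2(\Omega)$ is $u(t)=S_\alpha(t)u_0$, where $S_1(t)=S(t)$ and, for $0<\alpha<1$, $$S_\alpha(t)v=\int_0^\infty\Phi_\alpha(s)\,S(st^\alpha)v\,ds,\qquad v\in L^2(\Omega),\qquad \Phi_\alpha(z)=\sum_{m=0}^\infty\frac{(-z)^m}{m!\,\Gamma(-\alpha m+1-\alpha)},$$ where $1/\Gamma$ is taken to be $0$ at the poles of $\Gamma$ ($\Phi_\alpha$ is the Wright function, a probability density on $(0,\infty)$). A solution of the backward problem with final datum $u_T$ is such a function $u$, with $u_0=u(0,\cdot)\in L^2(\Omega)$, satisfying $u(T)=u_T$. *)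

theory Defs
  imports "HOL-Analysis.Analysis"
begin

section \<open>The Hilbert space of square-integrable functions\<close>

definition square_integrable :: "'a measure \<Rightarrow> ('a \<Rightarrow> 'b::euclidean_space) \<Rightarrow> bool" where
  "square_integrable M f \<longleftrightarrow> f \<in> borel_measurable M \<and> integrable M (\<lambda>x. (norm (f x))\<^sup>2)"

lemma square_integrable_inner:
  assumes "square_integrable M f" "square_integrable M g"
  shows "integrable M (\<lambda>x. f x \<bullet> g x)"
proof (rule Bochner_Integration.integrable_bound)
  show "integrable M (\<lambda>x. (norm (f x))\<^sup>2 + (norm (g x))\<^sup>2)"
    using assms by (auto simp: square_integrable_def)
  show "(\<lambda>x. f x \<bullet> g x) \<in> borel_measurable M"
    using assms by (auto simp: square_integrable_def)
  show "AE x in M. norm (f x \<bullet> g x) \<le> norm ((norm (f x))\<^sup>2 + (norm (g x))\<^sup>2)"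
  proof (rule AE_I2)
    fix x
    have "2 * (norm (f x) * norm (g x)) \<le> (norm (f x))\<^sup>2 + (norm (g x))\<^sup>2"
      using sum_squares_bound[of "norm (f x)" "norm (g x)"] by (simp add: mult.assoc)
    moreover have "0 \<le> norm (f x) * norm (g x)" by simp
    ultimately show "norm (f x \<bullet> g x) \<le> norm ((norm (f x))\<^sup>2 + (norm (g x))\<^sup>2)"
      using Cauchy_Schwarz_ineq2[of "f x" "g x"] by simp
  qed
qed

lemma square_integrable_zero: "square_integrable M (\<lambda>x. 0)"
  by (simp add: square_integrable_def)

lemma square_integrable_scaleR:
  "square_integrable M f \<Longrightarrow> square_integrable M (\<lambda>x. c *\<^sub>R f x)"
  by (auto simp: square_integrable_def power_mult_distrib)

lemma square_integrable_add:
  assumes "square_integrable M f" "square_integrable M g"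
  shows "square_integrable M (\<lambda>x. f x + g x)"
proof -
  have eq: "(\<lambda>x. (norm (f x + g x))\<^sup>2) =
      (\<lambda>x. (norm (f x))\<^sup>2 + 2 * (f x \<bullet> g x) + (norm (g x))\<^sup>2)"
    by (simp add: power2_norm_eq_inner inner_add_left inner_add_right inner_commute algebra_simps)
  show ?thesis
    using assms square_integrable_inner[OF assms]
    by (auto simp: square_integrable_def eq)
qed

lemma square_integrable_uminus:
  "square_integrable M f \<Longrightarrow> square_integrable M (\<lambda>x. - f x)"
  by (auto simp: square_integrable_def)

lemma square_integrable_diff:
  "square_integrable M f \<Longrightarrow> square_integrable M g \<Longrightarrow> square_integrable M (\<lambda>x. f x - g x)"
  using square_integrable_add[of M f "\<lambda>x. - g x"] by (simp add: square_integrable_uminus)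

quotient_type (overloaded) ('a, 'b) l2 = "'a::euclidean_space \<Rightarrow> 'b::euclidean_space" / partial:
  "\<lambda>f g. square_integrable lebesgue f \<and> square_integrable lebesgue g \<and>
    (AE x in lebesgue. f x = g x)"
proof (rule part_equivpI)
  show "\<exists>f::'a \<Rightarrow> 'b. square_integrable lebesgue f \<and> square_integrable lebesgue f \<and>
      (AE x in lebesgue. f x = f x)"
    by (intro exI[of _ "\<lambda>x. 0"]) (simp add: square_integrable_zero)
  show "symp (\<lambda>f g::'a \<Rightarrow> 'b. square_integrable lebesgue f \<and> square_integrable lebesgue g \<and>
      (AE x in lebesgue. f x = g x))"
    by (auto intro!: sympI elim: eventually_mono)
  show "transp (\<lambda>f g::'a \<Rightarrow> 'b. square_integrable lebesgue f \<and> square_integrable lebesgue g \<and>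
      (AE x in lebesgue. f x = g x))"
    by (rule transpI) (auto elim: eventually_elim2)
qed

instantiation l2 :: (euclidean_space, euclidean_space) real_inner
begin

lift_definition zero_l2 :: "('a, 'b) l2" is "\<lambda>x. 0"
  by (simp add: square_integrable_zero)

lift_definition plus_l2 :: "('a, 'b) l2 \<Rightarrow> ('a, 'b) l2 \<Rightarrow> ('a, 'b) l2" is "\<lambda>f g x. f x + g x"
  by (auto simp: square_integrable_add elim: eventually_elim2)

lift_definition minus_l2 :: "('a, 'b) l2 \<Rightarrow> ('a, 'b) l2 \<Rightarrow> ('a, 'b) l2" is "\<lambda>f g x. f x - g x"
  by (auto simp: square_integrable_diff elim: eventually_elim2)

lift_definition uminus_l2 :: "('a, 'b) l2 \<Rightarrow> ('a, 'b) l2" is "\<lambda>f x. - f x"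
  by (auto simp: square_integrable_uminus)

lift_definition scaleR_l2 :: "real \<Rightarrow> ('a, 'b) l2 \<Rightarrow> ('a, 'b) l2" is "\<lambda>c f x. c *\<^sub>R f x"
  by (auto simp: square_integrable_scaleR elim: eventually_mono)

lift_definition inner_l2 :: "('a, 'b) l2 \<Rightarrow> ('a, 'b) l2 \<Rightarrow> real"
  is "\<lambda>f g. LINT x|lebesgue. f x \<bullet> g x"
proof -
  fix f f' g g' :: "'a \<Rightarrow> 'b"
  assume "square_integrable lebesgue f \<and> square_integrable lebesgue f' \<and> (AE x in lebesgue. f x = f' x)"
    and "square_integrable lebesgue g \<and> square_integrable lebesgue g' \<and> (AE x in lebesgue. g x = g' x)"
  then have *: "square_integrable lebesgue f" "square_integrable lebesgue f'"
      "square_integrable lebesgue g" "square_integrable lebesgue g'"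
      "AE x in lebesgue. f x = f' x" "AE x in lebesgue. g x = g' x"
    by auto
  show "(LINT x|lebesgue. f x \<bullet> g x) = (LINT x|lebesgue. f' x \<bullet> g' x)"
  proof (rule integral_cong_AE)
    show "(\<lambda>x. f x \<bullet> g x) \<in> borel_measurable lebesgue" "(\<lambda>x. f' x \<bullet> g' x) \<in> borel_measurable lebesgue"
      using * square_integrable_inner by (blast intro: borel_measurable_integrable)+
    show "AE x in lebesgue. f x \<bullet> g x = f' x \<bullet> g' x"
      using *(5,6) by eventually_elim simp
  qed
qed

definition norm_l2 :: "('a, 'b) l2 \<Rightarrow> real" where
  "norm_l2 f = sqrt (f \<bullet> f)"

definition sgn_l2 :: "('a, 'b) l2 \<Rightarrow> ('a, 'b) l2" where
  "sgn_l2 f = inverse (norm f) *\<^sub>R f"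

definition dist_l2 :: "('a, 'b) l2 \<Rightarrow> ('a, 'b) l2 \<Rightarrow> real" where
  "dist_l2 f g = norm (f - g)"

definition uniformity_l2 :: "(('a, 'b) l2 \<times> ('a, 'b) l2) filter" where
  "uniformity_l2 = (INF e\<in>{0 <..}. principal {(x, y). dist x y < e})"

definition open_l2 :: "('a, 'b) l2 set \<Rightarrow> bool" where
  "open_l2 U = (\<forall>x\<in>U. \<forall>\<^sub>F (x', y) in uniformity. x' = x \<longrightarrow> y \<in> U)"

instance
proof
  fix f g h :: "('a, 'b) l2" and c d :: real and U :: "('a, 'b) l2 set"
  show "f + g + h = f + (g + h)"
    by transfer (auto intro!: square_integrable_add simp: add.assoc)
  show "f + g = g + f"
    by transfer (auto intro!: square_integrable_add simp: add.commute)
  show "0 + f = f"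
    by transfer (auto simp: square_integrable_zero)
  show "- f + f = 0"
    by transfer (auto simp: square_integrable_zero)
  show "f - g = f + - g"
    by transfer (auto intro!: square_integrable_diff)
  show "c *\<^sub>R (f + g) = c *\<^sub>R f + c *\<^sub>R g"
    by transfer (auto intro!: square_integrable_add square_integrable_scaleR simp: scaleR_add_right)
  show "(c + d) *\<^sub>R f = c *\<^sub>R f + d *\<^sub>R f"
    by transfer (auto intro!: square_integrable_add square_integrable_scaleR simp: scaleR_add_left)
  show "c *\<^sub>R d *\<^sub>R f = (c * d) *\<^sub>R f"
    by transfer (auto intro!: square_integrable_scaleR)
  show "1 *\<^sub>R f = f"
    by transfer auto
  show "dist f g = norm (f - g)" "sgn f = inverse (norm f) *\<^sub>R f"
    "(uniformity :: (('a, 'b) l2 \<times> ('a, 'b) l2) filter) = (INF e\<in>{0 <..}. principal {(x, y). dist x y < e})"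
    "open U = (\<forall>x\<in>U. \<forall>\<^sub>F (x', y) in uniformity. x' = x \<longrightarrow> y \<in> U)"
    "norm f = sqrt (f \<bullet> f)"
    by (fact dist_l2_def sgn_l2_def uniformity_l2_def open_l2_def norm_l2_def)+
  show "f \<bullet> g = g \<bullet> f"
    by transfer (simp add: inner_commute)
  show "(f + g) \<bullet> h = f \<bullet> h + g \<bullet> h"
    by transfer (auto simp: inner_add_left square_integrable_inner)
  show "c *\<^sub>R f \<bullet> g = c * (f \<bullet> g)"
    by transfer (auto simp: square_integrable_inner)
  show "0 \<le> f \<bullet> f"
    by transfer simp
  show "f \<bullet> f = 0 \<longleftrightarrow> f = 0"
  proof transfer
    fix f :: "'a \<Rightarrow> 'b"
    assume "square_integrable lebesgue f \<and> square_integrable lebesgue f \<and> (AE x in lebesgue. f x = f x)"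
    then have f: "square_integrable lebesgue f" by simp
    have "(LINT x|lebesgue. f x \<bullet> f x) = 0 \<longleftrightarrow> (AE x in lebesgue. f x \<bullet> f x = 0)"
      by (intro integral_nonneg_eq_0_iff_AE square_integrable_inner f) simp
    then show "(LINT x|lebesgue. f x \<bullet> f x) = 0 \<longleftrightarrow>
      square_integrable lebesgue f \<and> square_integrable lebesgue (\<lambda>x. 0::'b) \<and> (AE x in lebesgue. f x = 0)"
      using f by (simp add: square_integrable_zero)
  qed
qed

end

lemma square_integrable_rep_l2: "square_integrable lebesgue (rep_l2 f)"
  using Quotient_rep_reflp[OF Quotient_l2] by blast

lemma rep_abs_l2_AE:
  assumes "square_integrable lebesgue f"
  shows "AE x in lebesgue. rep_l2 (abs_l2 f) x = f x"
  using Quotient_rep_abs[OF Quotient_l2, of f] assms by simp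

text \<open>\<open>L\<^sup>2(\<Omega>)\<close>, realised through extension by zero as a closed subspace of \<open>L\<^sup>2\<close> of the whole space.\<close>

definition L2_on :: "'a::euclidean_space set \<Rightarrow> ('a, 'b::euclidean_space) l2 set" where
  "L2_on \<Omega> = {u. AE x in lebesgue. x \<notin> \<Omega> \<longrightarrow> rep_l2 u x = 0}"


section \<open>Classical derivatives and domains of class \<open>C\<^sup>2\<close>\<close>

definition partial_deriv :: "'n::finite \<Rightarrow> (real^'n \<Rightarrow> 'b::real_normed_vector) \<Rightarrow> real^'n \<Rightarrow> 'b" where
  "partial_deriv i f x = frechet_derivative f (at x) (axis i 1)"

primrec Ck_on :: "nat \<Rightarrow> (real^'n) set \<Rightarrow> (real^'n \<Rightarrow> 'b::real_normed_vector) \<Rightarrow> bool" where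
  "Ck_on 0 U f \<longleftrightarrow> continuous_on U f"
| "Ck_on (Suc k) U f \<longleftrightarrow>
    (\<forall>x\<in>U. f differentiable (at x)) \<and> (\<forall>i. Ck_on k U (partial_deriv i f))"

text \<open>\<open>C\<^sup>1\<close> on the closure of an open set: the function and its first derivatives in the open set
  extend continuously to the closure.\<close>

definition C1_closure :: "(real^'n) set \<Rightarrow> (real^'n \<Rightarrow> real) \<Rightarrow> bool" where
  "C1_closure \<Omega> f \<longleftrightarrow>
    continuous_on (closure \<Omega>) f \<and> (\<forall>x\<in>\<Omega>. f differentiable (at x)) \<and>
    (\<forall>i. \<exists>g. continuous_on (closure \<Omega>) g \<and> (\<forall>x\<in>\<Omega>. g x = partial_deriv i f x))"

text \<open>Near each boundary point the set lies strictly on one side of the graph of a \<open>C\<^sup>2\<close> function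
  \<open>\<gamma>\<close>, after relabelling (choice of \<open>k\<close>) and reorienting (choice of \<open>\<sigma>\<close>) the coordinate axes.
  A function of the remaining \<open>n - 1\<close> coordinates is encoded as a function on \<open>\<real>\<^sup>n\<close> that does
  not depend on the \<open>k\<close>-th coordinate.\<close>

definition C2_boundary :: "(real^'n) set \<Rightarrow> bool" where
  "C2_boundary \<Omega> \<longleftrightarrow>
    (\<forall>x0\<in>frontier \<Omega>. \<exists>r>0. \<exists>k. \<exists>\<sigma>\<in>{1, -1}. \<exists>\<gamma> :: real^'n \<Rightarrow> real.
      Ck_on 2 UNIV \<gamma> \<and> (\<forall>x y. (\<forall>j. j \<noteq> k \<longrightarrow> x $ j = y $ j) \<longrightarrow> \<gamma> x = \<gamma> y) \<and>
      \<Omega> \<inter> ball x0 r = {x \<in> ball x0 r. \<sigma> * x $ k > \<gamma> x})"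


section \<open>Weak derivatives and Sobolev spaces\<close>

definition test_functions :: "(real^'n) set \<Rightarrow> (real^'n \<Rightarrow> 'b::real_normed_vector) set" where
  "test_functions \<Omega> = {\<phi>. (\<forall>k. Ck_on k UNIV \<phi>) \<and>
    (\<exists>K. compact K \<and> K \<subseteq> \<Omega> \<and> (\<forall>x. x \<notin> K \<longrightarrow> \<phi> x = 0))}"

definition locally_integrable :: "(real^'n) set \<Rightarrow> (real^'n \<Rightarrow> 'b::euclidean_space) \<Rightarrow> bool" where
  "locally_integrable \<Omega> f \<longleftrightarrow> (\<forall>K. compact K \<longrightarrow> K \<subseteq> \<Omega> \<longrightarrow> integrable (lebesgue_on K) f)"

definition weak_partial ::
  "(real^'n) set \<Rightarrow> 'n \<Rightarrow> (real^'n \<Rightarrow> 'b::euclidean_space) \<Rightarrow> (real^'n \<Rightarrow> 'b) \<Rightarrow> bool" where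
  "weak_partial \<Omega> i f g \<longleftrightarrow> locally_integrable \<Omega> f \<and> locally_integrable \<Omega> g \<and>
    (\<forall>\<phi> :: real^'n \<Rightarrow> real. \<phi> \<in> test_functions \<Omega> \<longrightarrow>
      (LINT x|lebesgue_on \<Omega>. partial_deriv i \<phi> x *\<^sub>R f x) =
      - (LINT x|lebesgue_on \<Omega>. \<phi> x *\<^sub>R g x))"

definition L2_functions :: "(real^'n) set \<Rightarrow> (real^'n \<Rightarrow> 'b::euclidean_space) set" where
  "L2_functions \<Omega> = {f. square_integrable (lebesgue_on \<Omega>) f}"

definition Linf_functions :: "(real^'n) set \<Rightarrow> (real^'n \<Rightarrow> 'b::euclidean_space) set" where
  "Linf_functions \<Omega> = {f. f \<in> borel_measurable (lebesgue_on \<Omega>) \<and>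
    (\<exists>C. AE x in lebesgue_on \<Omega>. norm (f x) \<le> C)}"

text \<open>Functions all of whose weak derivatives of order at most \<open>k\<close> exist and lie in \<open>X\<close>.\<close>

primrec sobolev ::
  "(real^'n \<Rightarrow> 'b::euclidean_space) set \<Rightarrow> (real^'n) set \<Rightarrow> nat \<Rightarrow> (real^'n \<Rightarrow> 'b) set" where
  "sobolev X \<Omega> 0 = X"
| "sobolev X \<Omega> (Suc k) = {f \<in> X. \<forall>i. \<exists>g \<in> sobolev X \<Omega> k. weak_partial \<Omega> i f g}"

definition W_inf :: "nat \<Rightarrow> (real^'n) set \<Rightarrow> (real^'n \<Rightarrow> real) set" where
  "W_inf k \<Omega> = sobolev (Linf_functions \<Omega>) \<Omega> k"

definition H_sob :: "nat \<Rightarrow> (real^'n) set \<Rightarrow> (real^'n \<Rightarrow> 'b::euclidean_space) set" where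
  "H_sob k \<Omega> = sobolev (L2_functions \<Omega>) \<Omega> k"

text \<open>The closure of the test functions in \<open>H\<^sup>1(\<Omega>)\<close>.\<close>

definition H1_0 :: "(real^'n) set \<Rightarrow> (real^'n \<Rightarrow> 'b::euclidean_space) set" where
  "H1_0 \<Omega> = {u \<in> H_sob 1 \<Omega>. \<exists>g \<phi>.
    (\<forall>i. weak_partial \<Omega> i u (g i)) \<and>
    (\<forall>m::nat. \<phi> m \<in> test_functions \<Omega>) \<and>
    (\<lambda>m. LINT x|lebesgue_on \<Omega>. (norm (\<phi> m x - u x))\<^sup>2) \<longlonglongrightarrow> 0 \<and>
    (\<forall>i. (\<lambda>m. LINT x|lebesgue_on \<Omega>. (norm (partial_deriv i (\<phi> m) x - g i x))\<^sup>2) \<longlonglongrightarrow> 0)}"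


section \<open>The elliptic operator\<close>

definition symmetric_on :: "(real^'n) set \<Rightarrow> (real^'n \<Rightarrow> real^'n^'n) \<Rightarrow> bool" where
  "symmetric_on X A \<longleftrightarrow> (\<forall>x\<in>X. \<forall>i j. A x $ i $ j = A x $ j $ i)"

definition uniformly_elliptic_on :: "(real^'n) set \<Rightarrow> (real^'n \<Rightarrow> real^'n^'n) \<Rightarrow> bool" where
  "uniformly_elliptic_on X A \<longleftrightarrow> (\<exists>\<kappa>>0. \<forall>x\<in>X. \<forall>\<xi>::real^'n.
    (\<Sum>i\<in>UNIV. \<Sum>j\<in>UNIV. A x $ i $ j * \<xi> $ i * \<xi> $ j) \<ge> \<kappa> * (\<Sum>j\<in>UNIV. (\<xi> $ j)\<^sup>2))"

text \<open>\<open>w = div (A \<nabla>u) + B \<cdot> \<nabla>u + p u\<close> almost everywhere in \<open>\<Omega>\<close>; here \<open>g\<close> is the weak gradient of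
  \<open>u\<close>, and \<open>h i\<close> is the weak derivative in direction \<open>i\<close> of the \<open>i\<close>-th component of \<open>A \<nabla>u\<close>.\<close>

definition elliptic_eq ::
  "(real^'n) set \<Rightarrow> (real^'n \<Rightarrow> real^'n^'n) \<Rightarrow> (real^'n \<Rightarrow> real^'n) \<Rightarrow> (real^'n \<Rightarrow> real) \<Rightarrow>
    (real^'n \<Rightarrow> 'b::euclidean_space) \<Rightarrow> (real^'n \<Rightarrow> 'b) \<Rightarrow> bool" where
  "elliptic_eq \<Omega> A B p u w \<longleftrightarrow> (\<exists>g h.
    (\<forall>i. weak_partial \<Omega> i u (g i)) \<and>
    (\<forall>i. weak_partial \<Omega> i (\<lambda>x. \<Sum>j\<in>UNIV. A x $ i $ j *\<^sub>R g j x) (h i)) \<and>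
    (AE x in lebesgue_on \<Omega>.
      w x = (\<Sum>i\<in>UNIV. h i x) + (\<Sum>j\<in>UNIV. B x $ j *\<^sub>R g j x) + p x *\<^sub>R u x))"

text \<open>The graph of the operator \<open>L\<close> with domain \<open>H\<^sup>2(\<Omega>) \<inter> H\<^sup>1\<^sub>0(\<Omega>)\<close> in \<open>L\<^sup>2(\<Omega>)\<close>.\<close>

definition elliptic_graph ::
  "(real^'n) set \<Rightarrow> (real^'n \<Rightarrow> real^'n^'n) \<Rightarrow> (real^'n \<Rightarrow> real^'n) \<Rightarrow> (real^'n \<Rightarrow> real) \<Rightarrow>
    ((real^'n, 'b::euclidean_space) l2 \<times> (real^'n, 'b) l2) set" where
  "elliptic_graph \<Omega> A B p = {(u, w). u \<in> L2_on \<Omega> \<and> w \<in> L2_on \<Omega> \<and>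
    rep_l2 u \<in> H_sob 2 \<Omega> \<inter> H1_0 \<Omega> \<and> elliptic_eq \<Omega> A B p (rep_l2 u) (rep_l2 w)}"


section \<open>Semigroups and solutions\<close>

text \<open>Semigroups act on a subspace \<open>X\<close>. Linearity is over the reals; if the generator is complex
  linear then so is the semigroup, since it is determined by its generator.\<close>

definition C0_semigroup_on :: "'v::real_normed_vector set \<Rightarrow> (real \<Rightarrow> 'v \<Rightarrow> 'v) \<Rightarrow> bool" where
  "C0_semigroup_on X S \<longleftrightarrow>
    (\<forall>t\<ge>0. (\<forall>v\<in>X. S t v \<in> X) \<and>
      (\<forall>v\<in>X. \<forall>w\<in>X. S t (v + w) = S t v + S t w) \<and>
      (\<forall>c. \<forall>v\<in>X. S t (c *\<^sub>R v) = c *\<^sub>R S t v) \<and>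
      (\<exists>C. \<forall>v\<in>X. norm (S t v) \<le> C * norm v)) \<and>
    (\<forall>v\<in>X. S 0 v = v) \<and>
    (\<forall>s\<ge>0. \<forall>t\<ge>0. \<forall>v\<in>X. S (s + t) v = S s (S t v)) \<and>
    (\<forall>v\<in>X. ((\<lambda>t. S t v) \<longlongrightarrow> v) (at_right 0))"

definition generator_graph :: "'v::real_normed_vector set \<Rightarrow> (real \<Rightarrow> 'v \<Rightarrow> 'v) \<Rightarrow> ('v \<times> 'v) set" where
  "generator_graph X S = {(v, w). v \<in> X \<and> w \<in> X \<and>
    ((\<lambda>h. (S h v - v) /\<^sub>R h) \<longlongrightarrow> w) (at_right 0)}"

text \<open>The library function \<^const>\<open>rGamma\<close> is the entire function \<open>1 / \<Gamma>\<close>.\<close>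

definition wright :: "real \<Rightarrow> real \<Rightarrow> real" where
  "wright \<alpha> z = (\<Sum>m. (- z) ^ m / fact m * rGamma (- \<alpha> * real m + 1 - \<alpha>))"

text \<open>\<open>w = S\<^sub>\<alpha>(t) v\<close>. The vector-valued integral is the gauge integral, which for this norm-continuous,
  absolutely integrable integrand is the Bochner integral.\<close>

definition frac_evolution ::
  "real \<Rightarrow> (real \<Rightarrow> 'v \<Rightarrow> 'v) \<Rightarrow> real \<Rightarrow> 'v \<Rightarrow> 'v::real_normed_vector \<Rightarrow> bool" where
  "frac_evolution \<alpha> S t v w \<longleftrightarrow>
    (if \<alpha> = 1 then w = S t v
     else ((\<lambda>s. wright \<alpha> s *\<^sub>R S (s * t powr \<alpha>) v) has_integral w) {0<..})"

definition solution ::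
  "(real^'n) set \<Rightarrow> real \<Rightarrow> (real^'n \<Rightarrow> real^'n^'n) \<Rightarrow> (real^'n \<Rightarrow> real^'n) \<Rightarrow> (real^'n \<Rightarrow> real) \<Rightarrow>
    real \<Rightarrow> (real \<Rightarrow> (real^'n, 'b::euclidean_space) l2) \<Rightarrow> bool" where
  "solution \<Omega> \<alpha> A B p T u \<longleftrightarrow>
    (\<exists>S. C0_semigroup_on (L2_on \<Omega>) S \<and> generator_graph (L2_on \<Omega>) S = elliptic_graph \<Omega> A B p \<and>
      u 0 \<in> L2_on \<Omega> \<and> (\<forall>t\<in>{0..T}. frac_evolution \<alpha> S t (u 0) (u t)))"

definition backward_solution ::
  "(real^'n) set \<Rightarrow> real \<Rightarrow> (real^'n \<Rightarrow> real^'n^'n) \<Rightarrow> (real^'n \<Rightarrow> real^'n) \<Rightarrow> (real^'n \<Rightarrow> real) \<Rightarrow>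
    real \<Rightarrow> (real^'n, 'b::euclidean_space) l2 \<Rightarrow> (real \<Rightarrow> (real^'n, 'b) l2) \<Rightarrow> bool" where
  "backward_solution \<Omega> \<alpha> A B p T u_T u \<longleftrightarrow> solution \<Omega> \<alpha> A B p T u \<and> u T = u_T"

end

theory Submission
  imports Defs "HOL-Real_Asymp.Real_Asymp"
begin

text \<open>The drift is a gradient, \<open>B = A \<nabla>b\<close>, so \<open>e^b L u = div (e^b A \<nabla>u) + e^b p u\<close>: the operator \<open>L\<close> is
symmetric for the weighted inner product \<open>\<beta>(f, g) = \<integral> e^b f \<cdot> g\<close> over \<open>\<Omega>\<close>. Every \<open>S(t)\<close> is then
\<open>\<beta>\<close>-symmetric, and \<open>\<beta>(S(t) v, v) = \<beta>(S(t/2) v, S(t/2) v) \<ge> 0\<close>. If \<open>S(t) v = 0\<close> for one \<open>t > 0\<close>, this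
identity gives \<open>S(t/2) v = 0\<close>, then \<open>S(t/4) v = 0\<close> and so on, and strong continuity at \<open>0\<close> gives \<open>v = 0\<close>
(\<open>orbit_injective\<close>). That is the case \<open>\<alpha> = 1\<close>.

For \<open>\<alpha> < 1\<close>, pair the equation \<open>S\<^sub>\<alpha>(T) u\<^sub>0 = 0\<close> with \<open>u\<^sub>0\<close>: the integral of
\<open>\<Phi>\<^sub>\<alpha>(s) \<beta>(S(s T\<^sup>\<alpha>) u\<^sub>0, u\<^sub>0)\<close> over \<open>s > 0\<close> is zero. The Wright function \<open>\<Phi>\<^sub>\<alpha>\<close> is nonnegative, so the
continuous integrand vanishes identically; \<open>\<Phi>\<^sub>\<alpha>\<close> is positive near \<open>0\<close>, so \<open>S(t) u\<^sub>0 = 0\<close> for some \<open>t > 0\<close>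
and the previous argument applies (\<open>weighted_average_injective\<close>).

Three facts carry this argument.

\<^item> \<open>wright_nonneg\<close>: the number \<open>\<alpha> x \<Phi>\<^sub>\<alpha>(x)\<close> is the limit of \<open>k\<close> times the coefficient of \<open>z^k\<close> in
  \<open>(1 - (1 - z)^\<alpha>)^n\<close>, where \<open>n = \<lfloor>x k^\<alpha>\<rfloor>\<close> and \<open>k\<close> tends to infinity. These coefficients are nonnegative.

\<^item> \<open>symmetric\<close>: symmetry passes from the generator to the semigroup. This needs a dense domain, which is
  obtained by averaging orbits; the averages are integrals in \<open>L\<^sup>2\<close>, hence \<open>l2_complete\<close>.

\<^item> \<open>graph_symmetric\<close>: Green's formula for \<open>L\<close> with the weight \<open>e^b\<close>. The weight is not smooth, so the weak
  derivative of \<open>A \<nabla>u\<close> is tested against \<open>\<phi> e^c\<close> with \<open>\<phi>\<close> a test function and \<open>c\<close> a mollification of \<open>b\<close>,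
  and \<open>c\<close> then tends to \<open>b\<close>.\<close>

section \<open>Nonnegativity of the Wright function\<close>

text \<open>The power series \<open>(1 - z)^c\<close>.\<close>

definition alt_binom :: "real \<Rightarrow> real fps" where
  "alt_binom c = Abs_fps (\<lambda>k. (-1) ^ k * (c gchoose k))"

lemma alt_binom_mult: "alt_binom c * alt_binom d = alt_binom (c + d)"
proof (rule fps_ext)
  fix n
  have "fps_nth (alt_binom c * alt_binom d) n =
      (\<Sum>k=0..n. ((-1) ^ k * (-1) ^ (n - k)) * ((c gchoose k) * (d gchoose (n - k))))"
    by (simp add: fps_mult_nth alt_binom_def mult_ac)
  also have "\<dots> = (\<Sum>k=0..n. (-1) ^ n * ((c gchoose k) * (d gchoose (n - k))))"
    by (intro sum.cong refl) (simp flip: power_add)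
  also have "\<dots> = (-1) ^ n * ((c + d) gchoose n)"
    by (simp add: gbinomial_Vandermonde sum_distrib_left atMost_atLeast0 flip: gbinomial_Vandermonde)
  finally show "fps_nth (alt_binom c * alt_binom d) n = fps_nth (alt_binom (c + d)) n"
    by (simp add: alt_binom_def)
qed

lemma alt_binom_power: "alt_binom c ^ j = alt_binom (c * real j)"
proof (induction j)
  case 0
  show ?case by (rule fps_ext) (simp add: alt_binom_def gbinomial_0_left)
next
  case (Suc j)
  then show ?case by (simp add: alt_binom_mult algebra_simps)
qed

lemma gbinomial_Suc_step: "(a gchoose Suc k) = (a gchoose k) * (a - real k) / real (Suc k)"
  for a :: real
  by (simp add: gbinomial_prod_rev divide_simps)

lemma alt_binom_nonpos:
  assumes "0 < \<alpha>" "\<alpha> < 1"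
  shows "fps_nth (alt_binom \<alpha>) (Suc k) \<le> 0"
proof (induction k)
  case 0
  then show ?case using assms by (simp add: alt_binom_def)
next
  case (Suc k)
  have "fps_nth (alt_binom \<alpha>) (Suc (Suc k)) =
      fps_nth (alt_binom \<alpha>) (Suc k) * ((real (Suc k) - \<alpha>) / real (Suc (Suc k)))"
    unfolding alt_binom_def by (subst fps_nth_Abs_fps, subst gbinomial_Suc_step) (simp add: field_simps)
  also have "\<dots> \<le> 0"
    using Suc assms by (intro mult_nonpos_nonneg) auto
  finally show ?case .
qed

text \<open>The sum is the coefficient of \<open>z^k\<close> in \<open>(1 - (1 - z)^\<alpha>)^n\<close>, and all coefficients of \<open>1 - (1 - z)^\<alpha>\<close> are
nonnegative.\<close>

lemma alternating_binomial_sum_nonneg: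
  assumes "0 < \<alpha>" "\<alpha> < 1"
  shows "0 \<le> (\<Sum>j\<le>n. real (n choose j) * (-1) ^ j * ((-1) ^ k * ((\<alpha> * real j) gchoose k)))"
proof -
  have base: "0 \<le> fps_nth (1 - alt_binom \<alpha>) i" for i
    using alt_binom_nonpos[OF assms] by (cases i) (auto simp: alt_binom_def)
  have "0 \<le> fps_nth ((1 - alt_binom \<alpha>) ^ n) i" for i
  proof (induction n arbitrary: i)
    case (Suc n)
    then show ?case
      unfolding power_Suc fps_mult_nth by (intro sum_nonneg mult_nonneg_nonneg base)
  qed simp
  then have "0 \<le> fps_nth ((1 - alt_binom \<alpha>) ^ n) k" .
  also have "(1 - alt_binom \<alpha>) ^ n = (\<Sum>j\<le>n. of_nat (n choose j) * (- alt_binom \<alpha>) ^ j * 1 ^ (n - j))"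
    using binomial_ring[of "- alt_binom \<alpha>" 1 n] by simp
  also have "fps_nth \<dots> k = (\<Sum>j\<le>n. fps_nth (of_nat (n choose j) * (- alt_binom \<alpha>) ^ j * 1 ^ (n - j)) k)"
    by (rule fps_sum_nth)
  also have "\<dots> = (\<Sum>j\<le>n. real (n choose j) * (-1) ^ j * ((-1) ^ k * ((\<alpha> * real j) gchoose k)))"
  proof (intro sum.cong refl)
    fix j
    show "fps_nth (of_nat (n choose j) * (- alt_binom \<alpha>) ^ j * 1 ^ (n - j)) k =
      real (n choose j) * (-1) ^ j * ((-1) ^ k * ((\<alpha> * real j) gchoose k))"
    proof -
    have "of_nat (n choose j) * (- alt_binom \<alpha>) ^ j * 1 ^ (n - j) =
        fps_const (real (n choose j) * (-1) ^ j) * alt_binom (\<alpha> * real j)"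
      by (simp add: power_minus[of "alt_binom \<alpha>"] alt_binom_power fps_of_nat
          flip: fps_const_mult fps_const_power fps_const_neg)
    then show "fps_nth (of_nat (n choose j) * (- alt_binom \<alpha>) ^ j * 1 ^ (n - j)) k =
      real (n choose j) * (-1) ^ j * ((-1) ^ k * ((\<alpha> * real j) gchoose k))"
      by (simp add: alt_binom_def)
    qed
  qed
  finally show ?thesis .
qed

lemma Bernoulli_inequality_powr:
  fixes x p :: real
  assumes "1 \<le> p" "0 < x"
  shows "1 + p * (x - 1) \<le> x powr p"
proof -
  have "x powr p - 1 powr p \<ge> (p * 1 powr (p - 1)) * (x - 1)"
  proof (rule convex_on_imp_above_tangent[OF powr_convex[OF assms(1)]])
    show "((\<lambda>x. x powr p) has_field_derivative p * 1 powr (p - 1)) (at 1 within {0<..})"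
      by (rule has_field_derivative_at_within[OF has_real_derivative_powr]) simp
  qed (use assms in \<open>auto simp: interior_open\<close>)
  then show ?thesis by simp
qed

text \<open>The quotient of the two sides is \<open>(k - a) / (k + 1) \<cdot> ((k + 1) / k)^(a + 1)\<close>, which Bernoulli's inequality
bounds by \<open>1\<close>.\<close>

lemma gbinomial_decay_step:
  assumes "0 \<le> a" "a \<le> real k" "0 < k"
  shows "\<bar>a gchoose Suc k\<bar> * real (Suc k) powr (a + 1) \<le> \<bar>a gchoose k\<bar> * real k powr (a + 1)"
proof -
  have "1 + (a + 1) * (real k / real (Suc k) - 1) \<le> (real k / real (Suc k)) powr (a + 1)"
    by (rule Bernoulli_inequality_powr) (use assms in auto)
  then have "(real k - a) / real (Suc k) \<le> real k powr (a + 1) / real (Suc k) powr (a + 1)"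
    by (simp add: powr_divide field_simps)
  then have B: "(real k - a) / real (Suc k) * real (Suc k) powr (a + 1) \<le> real k powr (a + 1)"
    by (simp add: pos_le_divide_eq)
  have "\<bar>a gchoose Suc k\<bar> = \<bar>a gchoose k\<bar> * ((real k - a) / real (Suc k))"
    using assms by (simp add: gbinomial_Suc_step abs_mult)
  then show ?thesis
    using mult_left_mono[OF B, of "\<bar>a gchoose k\<bar>"] by (simp add: mult.assoc)
qed

lemma gbinomial_abs_le_one:
  assumes "a \<le> real k" "real k \<le> a + 1"
  shows "\<bar>a gchoose k\<bar> \<le> 1"
proof -
  have "\<bar>a gchoose k\<bar> = (\<Prod>i<k. \<bar>a - real i\<bar>) / fact k"
    by (simp add: gbinomial_prod_rev abs_prod atLeast0LessThan)
  also have "(\<Prod>i<k. \<bar>a - real i\<bar>) \<le> (\<Prod>i<k. real k - real i)"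
    by (rule prod_mono) (use assms in \<open>auto simp: abs_le_iff\<close>)
  also have "(\<Prod>i<k. real k - real i) = fact k"
    by (simp add: fact_prod_rev of_nat_diff atLeast0LessThan)
  finally show ?thesis by (simp add: divide_right_mono)
qed

text \<open>By the monotonicity just shown it suffices to look at \<open>k = \<lceil>a\<rceil>\<close>, where the binomial coefficient is at most
\<open>1\<close>. What matters is that the bound does not depend on \<open>k\<close>.\<close>

lemma gbinomial_decay:
  assumes a: "0 \<le> a" "a \<le> real k" "0 < k"
  shows "\<bar>a gchoose k\<bar> * real k powr (a + 1) \<le> (a + 2) powr (a + 1)"
proof -
  define m where "m = nat \<lceil>a\<rceil>"
  have m: "a \<le> real m" "real m \<le> a + 1" "m \<le> k"
    using a unfolding m_def by linarith+
  show ?thesis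
  proof (cases "m = 0")
    case True
    then have "a = 0" using m a by simp
    then show ?thesis using a by (cases k) auto
  next
    case False
    have "m \<le> k \<Longrightarrow> \<bar>a gchoose k\<bar> * real k powr (a + 1) \<le> \<bar>a gchoose m\<bar> * real m powr (a + 1)"
    proof (induction k rule: dec_induct)
      case (step n)
      then show ?case
        using gbinomial_decay_step[of a n] False m(1) a(1) by fastforce
    qed simp
    also have "\<bar>a gchoose m\<bar> * real m powr (a + 1) \<le> 1 * (a + 2) powr (a + 1)"
      by (intro mult_mono gbinomial_abs_le_one powr_mono2) (use m a in auto)
    finally show ?thesis using m by simp
  qed
qed

lemma binomial_scaling_limit:
  fixes y :: "nat \<Rightarrow> real" and n :: "nat \<Rightarrow> nat"
  assumes y: "filterlim y at_top sequentially"
    and n: "(\<lambda>k. real (n k) / y k) \<longlonglongrightarrow> x"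
  shows "(\<lambda>k. real (n k choose j) / y k ^ j) \<longlonglongrightarrow> x ^ j / fact j"
proof -
  have "(\<lambda>k. (\<Prod>i<j. real (n k) / y k - real i / y k) / fact j) \<longlonglongrightarrow> (\<Prod>i<j. x - 0) / fact j"
    by (intro tendsto_intros n tendsto_divide_0[OF tendsto_const] filterlim_at_top_imp_at_infinity y) auto
  moreover have "(\<Prod>i<j. real (n k) / y k - real i / y k) / fact j = real (n k choose j) / y k ^ j" for k
    by (simp add: binomial_gbinomial gbinomial_prod_rev atLeast0LessThan prod_dividef
        flip: diff_divide_distrib)
  ultimately show ?thesis by simp
qed

lemma binomial_le_pow_fact: "real (n choose j) \<le> real n ^ j / fact j"
proof -
  have "real (n choose j) * fact j \<le> real n ^ j"
    using binomial_fact_pow[of n j] by (metis of_nat_fact of_nat_le_iff of_nat_mult of_nat_power)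
  then show ?thesis by (simp add: pos_le_divide_eq)
qed

lemma power_div_fact_le_exp:
  fixes t :: real
  assumes "0 \<le> t"
  shows "t ^ j / fact j \<le> exp t"
proof -
  have "(\<Sum>n\<in>{j}. t ^ n /\<^sub>R fact n) \<le> (\<Sum>n. t ^ n /\<^sub>R fact n)"
    by (rule sum_le_suminf[OF summable_exp_generic]) (use assms in auto)
  then show ?thesis
    by (simp add: exp_def field_simps)
qed

text \<open>Since \<open>(j + 2)^j \<le> e^(j + 2) j!\<close>, the terms are at most \<open>j + 2\<close> times a geometric sequence times
\<open>j!^(\<alpha> - 1)\<close>, and the negative power of the factorial wins.\<close>

lemma summable_majorant:
  assumes "0 < \<alpha>" "\<alpha> < 1" "0 \<le> x"
  shows "summable (\<lambda>j. x ^ j / fact j * (\<alpha> * real j + 2) powr (\<alpha> * real j + 1))"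
proof (rule summable_comparison_test')
  define M where "M j = x ^ j * (real (j + 2) * exp (real (j + 2))) * fact j powr (\<alpha> - 1)" for j
  show "norm (x ^ j / fact j * (\<alpha> * real j + 2) powr (\<alpha> * real j + 1)) \<le> M j" for j
  proof -
    have "\<alpha> * real j \<le> real j"
      using assms by (simp add: mult_left_le_one_le)
    then have "(\<alpha> * real j + 2) powr (\<alpha> * real j + 1) \<le> real (j + 2) powr (\<alpha> * real j + 1)"
      using assms by (intro powr_mono2) auto
    also have "\<dots> = (real (j + 2) ^ j) powr \<alpha> * real (j + 2)"
      by (simp add: powr_add powr_powr mult.commute flip: powr_realpow)
    also have "(real (j + 2) ^ j) powr \<alpha> \<le> (exp (real (j + 2)) * fact j) powr \<alpha>"
      using power_div_fact_le_exp[of "real (j + 2)" j] assms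
      by (intro powr_mono2) (auto simp: pos_divide_le_eq)
    also have "\<dots> = exp (real (j + 2)) powr \<alpha> * fact j powr \<alpha>"
      by (simp add: powr_mult)
    also have "exp (real (j + 2)) powr \<alpha> \<le> exp (real (j + 2)) powr 1"
      using assms by (intro powr_mono) auto
    finally have "(\<alpha> * real j + 2) powr (\<alpha> * real j + 1) \<le>
        real (j + 2) * exp (real (j + 2)) * fact j powr \<alpha>"
      by (simp add: mult_ac)
    from mult_left_mono[OF this, of "x ^ j / fact j"] show ?thesis
      using assms by (simp add: M_def powr_diff mult_ac)
  qed
  have "(\<lambda>j. 2 * x * exp 1 * real (Suc j) powr (\<alpha> - 1)) \<longlonglongrightarrow> 0"
    using assms by real_asymp
  then have "\<forall>\<^sub>F j in sequentially. 2 * x * exp 1 * real (Suc j) powr (\<alpha> - 1) < 1 / 2"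
    by (rule order_tendstoD) simp
  then obtain N where N: "\<And>j. N \<le> j \<Longrightarrow> 2 * x * exp 1 * real (Suc j) powr (\<alpha> - 1) < 1 / 2"
    by (auto simp: eventually_sequentially)
  show "summable M"
  proof (rule summable_ratio_test[where c = "1/2" and N = N])
    fix j assume "N \<le> j"
    have nonneg: "0 \<le> M i" for i using assms by (simp add: M_def)
    have "M (Suc j) = M j * (x * exp 1 * (real (j + 3) / real (j + 2)) * real (Suc j) powr (\<alpha> - 1))"
    proof -
      have "exp (real (Suc j + 2)) = exp (real (j + 2)) * exp 1"
        by (simp flip: exp_add)
      moreover have "fact (Suc j) powr (\<alpha> - 1) = real (Suc j) powr (\<alpha> - 1) * fact j powr (\<alpha> - 1)"
        by (simp add: powr_mult del: of_nat_Suc)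
      ultimately show ?thesis
        unfolding M_def by (simp add: divide_simps del: of_nat_Suc of_nat_add)
    qed
    also have "\<dots> \<le> M j * (x * exp 1 * 2 * real (Suc j) powr (\<alpha> - 1))"
      using assms nonneg by (intro mult_mono mult_left_mono mult_right_mono) (auto simp: divide_le_eq)
    also have "\<dots> \<le> M j * (1 / 2)"
      using N[OF \<open>N \<le> j\<close>] nonneg by (intro mult_left_mono) (auto simp: mult_ac)
    finally show "norm (M (Suc j)) \<le> 1 / 2 * norm (M j)"
      using nonneg by simp
  qed simp
qed

text \<open>Term by term, \<open>n choose j\<close> behaves like \<open>(x k^\<alpha>)^j / j!\<close> and \<open>(-1)^k (\<alpha> j gchoose k)\<close> like
\<open>k^(- \<alpha> j - 1) / \<Gamma>(- \<alpha> j)\<close>, so the powers of \<open>k\<close> cancel; this is where the scaling \<open>n \<approx> x k^\<alpha>\<close> and the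
factor \<open>k\<close> come from. Tannery's theorem justifies the exchange of limit and sum.\<close>

lemma alternating_binomial_sum_tendsto:
  assumes \<alpha>: "0 < \<alpha>" "\<alpha> < 1" and x: "0 < x"
  defines "n \<equiv> \<lambda>k. nat \<lfloor>x * real k powr \<alpha>\<rfloor>"
    and "b \<equiv> \<lambda>j. (- x) ^ j / fact j * rGamma (- (\<alpha> * real j))"
  shows "summable b"
    and "(\<lambda>k. real k * (\<Sum>j\<le>n k. real (n k choose j) * (-1) ^ j * ((-1) ^ k * ((\<alpha> * real j) gchoose k))))
      \<longlonglongrightarrow> suminf b"
proof -
  define y where "y k = real k powr \<alpha>" for k :: nat
  define a where "a j k = (if j \<le> n k \<and> 0 < k then
      real (n k choose j) / y k ^ j * (-1) ^ j * ((-1) ^ k * ((\<alpha> * real j) gchoose k) * real k powr (\<alpha> * real j + 1))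
      else 0)" for j k
  have y_power: "y k ^ j = real k powr (\<alpha> * real j)" if "0 < k" for k j
    using that by (simp add: y_def powr_powr flip: powr_realpow)
  have y_top: "filterlim y at_top sequentially"
    unfolding y_def using \<alpha>(1) by real_asymp
  have n_le: "real (n k) \<le> x * y k" for k
    using x unfolding n_def y_def by simp
  have n_lim: "(\<lambda>k. real (n k) / y k) \<longlonglongrightarrow> x"
  proof (rule tendsto_sandwich)
    show "\<forall>\<^sub>F k in sequentially. x - 1 / y k \<le> real (n k) / y k"
      using eventually_gt_at_top[of 0]
    proof eventually_elim
      case (elim k)
      then have "0 < y k" by (simp add: y_def)
      moreover have "x * y k - 1 \<le> real (n k)" unfolding n_def y_def by linarith
      ultimately have "(x * y k - 1) / y k \<le> real (n k) / y k"
        by (intro divide_right_mono) auto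
      then show ?case using \<open>0 < y k\<close> by (simp add: diff_divide_distrib)
    qed
    show "\<forall>\<^sub>F k in sequentially. real (n k) / y k \<le> x"
      using eventually_gt_at_top[of 0]
    proof eventually_elim
      case (elim k)
      then have "0 < y k" by (simp add: y_def)
      then show ?case using n_le[of k] by (simp add: field_simps)
    qed
    have "(\<lambda>k. x - 1 / y k) \<longlonglongrightarrow> x - 0"
      by (intro tendsto_intros tendsto_divide_0[OF tendsto_const] filterlim_at_top_imp_at_infinity y_top)
    then show "(\<lambda>k. x - 1 / y k) \<longlonglongrightarrow> x" by simp
  qed simp
  have n_top: "filterlim n at_top sequentially"
  proof -
    have "filterlim (\<lambda>k. x * y k) at_top sequentially"
      by (rule filterlim_tendsto_pos_mult_at_top[OF tendsto_const x y_top])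
    then show ?thesis
      unfolding n_def y_def
      by (intro filterlim_compose[OF filterlim_nat_sequentially] filterlim_compose[OF filterlim_floor_sequentially])
  qed
  have lim: "a j \<longlonglongrightarrow> b j" for j
  proof (rule Lim_transform_eventually)
    have "(\<lambda>k. real (n k choose j) / y k ^ j * (-1) ^ j *
        (((\<alpha> * real j) gchoose k) / ((-1) ^ k / exp ((\<alpha> * real j + 1) * of_real (ln (real k))))))
        \<longlonglongrightarrow> x ^ j / fact j * (-1) ^ j * inverse (Gamma (- (\<alpha> * real j)))"
      by (intro tendsto_mult binomial_scaling_limit y_top n_lim gbinomial_asymptotic tendsto_const)
    also have "x ^ j / fact j * (-1) ^ j * inverse (Gamma (- (\<alpha> * real j))) = b j"
      by (simp add: b_def rGamma_inverse_Gamma power_minus[of x])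
    finally show "(\<lambda>k. real (n k choose j) / y k ^ j * (-1) ^ j *
        (((\<alpha> * real j) gchoose k) / ((-1) ^ k / exp ((\<alpha> * real j + 1) * of_real (ln (real k))))))
        \<longlonglongrightarrow> b j" .
    show "\<forall>\<^sub>F k in sequentially. real (n k choose j) / y k ^ j * (-1) ^ j *
        (((\<alpha> * real j) gchoose k) / ((-1) ^ k / exp ((\<alpha> * real j + 1) * of_real (ln (real k))))) = a j k"
      using eventually_gt_at_top[of 0] filterlim_at_top[THEN iffD1, rule_format, OF n_top, of j]
    proof eventually_elim
      case (elim k)
      have "1 / (-1) ^ k = ((-1) ^ k :: real)"
        by (cases "even k") auto
      then show ?case
        using elim by (simp add: a_def powr_def divide_simps mult_ac)
    qed
  qed
  \<comment> \<open>For \<open>j > n k\<close> there is nothing to bound, and \<open>j \<le> n k\<close> forces \<open>\<alpha> j \<le> k\<close> once \<open>k\<close> is large, because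
    \<open>n k\<close> grows like \<open>k^\<alpha>\<close> only; this is the range of \<open>gbinomial_decay\<close>.\<close>
  have bound: "\<forall>\<^sub>F k in sequentially. \<forall>j. norm (a j k) \<le>
      x ^ j / fact j * (\<alpha> * real j + 2) powr (\<alpha> * real j + 1)"
  proof -
    have "\<forall>\<^sub>F k in sequentially. \<alpha> * (x * real k powr \<alpha>) \<le> real k"
      using \<alpha> x by real_asymp
    then show ?thesis
      using eventually_gt_at_top[of 0]
    proof eventually_elim
      case (elim k)
      show ?case
      proof
        fix j
        show "norm (a j k) \<le> x ^ j / fact j * (\<alpha> * real j + 2) powr (\<alpha> * real j + 1)"
        proof (cases "j \<le> n k")
          case True
          have ypos: "0 < y k" using elim by (simp add: y_def)
          have "\<alpha> * real j \<le> \<alpha> * real (n k)" using True \<alpha> by simp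
          also have "\<dots> \<le> \<alpha> * (x * y k)" using n_le \<alpha> by simp
          also have "\<dots> \<le> real k" using elim by (simp add: y_def)
          finally have jk: "\<alpha> * real j \<le> real k" .
          have "real (n k choose j) \<le> real (n k) ^ j / fact j" by (rule binomial_le_pow_fact)
          also have "\<dots> \<le> (x * y k) ^ j / fact j"
            by (intro divide_right_mono power_mono n_le) auto
          finally have 1: "real (n k choose j) / y k ^ j \<le> x ^ j / fact j"
            using ypos by (simp add: power_mult_distrib field_simps)
          have 2: "\<bar>(\<alpha> * real j) gchoose k\<bar> * real k powr (\<alpha> * real j + 1) \<le>
              (\<alpha> * real j + 2) powr (\<alpha> * real j + 1)"
            using gbinomial_decay[of "\<alpha> * real j" k] jk elim \<alpha> by simp
          have "norm (a j k) = real (n k choose j) / y k ^ j *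
              (\<bar>(\<alpha> * real j) gchoose k\<bar> * real k powr (\<alpha> * real j + 1))"
            using True elim ypos by (simp add: a_def abs_mult)
          also have "\<dots> \<le> x ^ j / fact j * (\<alpha> * real j + 2) powr (\<alpha> * real j + 1)"
            by (intro mult_mono 1 2) (use x in auto)
          finally show ?thesis .
        qed (use x in \<open>auto simp: a_def\<close>)
      qed
    qed
  qed
  have "\<forall>\<^sub>F (j, k) in at_top \<times>\<^sub>F sequentially. norm (a j k) \<le>
      x ^ j / fact j * (\<alpha> * real j + 2) powr (\<alpha> * real j + 1)"
    unfolding eventually_prod_filter
    by (intro exI[of _ "\<lambda>_. True"] exI conjI, simp, rule bound) auto
  from tannerys_theorem[OF lim this summable_majorant[OF \<alpha>]] x
  have T: "summable (\<lambda>j. norm (b j))" "(\<lambda>k. \<Sum>j. a j k) \<longlonglongrightarrow> suminf b" by auto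
  then show "summable b" by (blast intro: summable_norm_cancel)
  have "real k * (\<Sum>j\<le>n k. real (n k choose j) * (-1) ^ j * ((-1) ^ k * ((\<alpha> * real j) gchoose k))) =
      (\<Sum>j. a j k)" for k
  proof (cases "k = 0")
    case False
    have "(\<Sum>j. a j k) = (\<Sum>j\<le>n k. a j k)"
      by (rule suminf_finite) (auto simp: a_def)
    also have "\<dots> = (\<Sum>j\<le>n k. real k * (real (n k choose j) * (-1) ^ j * ((-1) ^ k * ((\<alpha> * real j) gchoose k))))"
      by (intro sum.cong refl) (use False in \<open>simp add: a_def y_power powr_add\<close>)
    finally show ?thesis by (simp add: sum_distrib_left)
  qed (simp add: a_def)
  then show "(\<lambda>k. real k * (\<Sum>j\<le>n k. real (n k choose j) * (-1) ^ j * ((-1) ^ k * ((\<alpha> * real j) gchoose k))))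
      \<longlonglongrightarrow> suminf b"
    using T(2) by simp
qed

text \<open>The term with \<open>j = 0\<close> vanishes because \<open>1 / \<Gamma>\<close> is zero at \<open>0\<close>; in the term with \<open>j = m + 1\<close> the functional
equation of \<open>\<Gamma>\<close> produces the factor \<open>\<alpha> (m + 1)\<close>, which turns \<open>j!\<close> into \<open>m!\<close>.\<close>

lemma wright_series_shift:
  assumes "summable (\<lambda>j. (- x) ^ j / fact j * rGamma (- (\<alpha> * real j)))" (is "summable ?b") and "\<alpha> \<noteq> 0" "x \<noteq> 0"
  shows "summable (\<lambda>m. (- x) ^ m / fact m * rGamma (- \<alpha> * real m + 1 - \<alpha>))"
    and "suminf ?b = \<alpha> * x * wright \<alpha> x"
proof -
  have eq: "?b (Suc m) = \<alpha> * x * ((- x) ^ m / fact m * rGamma (- \<alpha> * real m + 1 - \<alpha>))" for m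
  proof -
    have "rGamma (- (\<alpha> * real (Suc m))) = - (\<alpha> * real (Suc m)) * rGamma (- \<alpha> * real m + 1 - \<alpha>)"
      using rGamma_plus1[of "- (\<alpha> * real (Suc m))"] by (simp add: algebra_simps)
    then show ?thesis by (simp add: divide_simps)
  qed
  have sm: "summable (\<lambda>m. ?b (Suc m))" by (rule summable_Suc_iff[THEN iffD2, OF assms(1)])
  then show s: "summable (\<lambda>m. (- x) ^ m / fact m * rGamma (- \<alpha> * real m + 1 - \<alpha>))"
    unfolding eq by (rule summable_mult_D) (use assms in simp)
  have "suminf ?b = (\<Sum>m. ?b (Suc m)) + ?b 0"
    using suminf_split_head[OF assms(1)] by simp
  also have "?b 0 = 0" by simp
  also have "(\<Sum>m. ?b (Suc m)) = \<alpha> * x * wright \<alpha> x"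
    unfolding eq wright_def by (rule suminf_mult[OF s])
  finally show "suminf ?b = \<alpha> * x * wright \<alpha> x" by simp
qed

lemma wright_nonneg:
  assumes "0 < \<alpha>" "\<alpha> < 1" "0 < x"
  shows "0 \<le> wright \<alpha> x"
proof -
  note T = alternating_binomial_sum_tendsto[OF assms]
  have "0 \<le> (\<Sum>j. (- x) ^ j / fact j * rGamma (- (\<alpha> * real j)))"
    by (rule LIMSEQ_le_const[OF T(2)])
      (use alternating_binomial_sum_nonneg[OF assms(1,2)] in \<open>auto intro!: mult_nonneg_nonneg\<close>)
  then have "0 \<le> \<alpha> * x * wright \<alpha> x"
    using wright_series_shift(2)[OF T(1)] assms by simp
  then show ?thesis
    using mult_pos_pos[OF assms(1,3)] zero_le_mult_iff[of "\<alpha> * x" "wright \<alpha> x"] by linarith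
qed

lemma wright_continuous:
  assumes "0 < \<alpha>" "\<alpha> < 1"
  shows "isCont (wright \<alpha>) x"
proof -
  define c where "c m = (-1) ^ m / fact m * rGamma (- \<alpha> * real m + 1 - \<alpha>)" for m
  have eq: "(- z) ^ m / fact m * rGamma (- \<alpha> * real m + 1 - \<alpha>) = c m * z ^ m" for z m
    by (simp add: c_def power_minus[of z])
  have "summable (\<lambda>m. c m * (\<bar>x\<bar> + 1) ^ m)"
    unfolding eq[symmetric]
    by (rule wright_series_shift(1)[OF alternating_binomial_sum_tendsto(1)]) (use assms in auto)
  then have "isCont (\<lambda>z. \<Sum>m. c m * z ^ m) x"
    by (rule isCont_powser) simp
  then show ?thesis
    unfolding wright_def eq .
qed

lemma wright_0_pos:
  assumes "0 < \<alpha>" "\<alpha> < 1"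
  shows "0 < wright \<alpha> 0"
proof -
  have "wright \<alpha> 0 = (\<Sum>m\<in>{0}. (- 0) ^ m / fact m * rGamma (- \<alpha> * real m + 1 - \<alpha>))"
    unfolding wright_def by (rule suminf_finite) auto
  then show ?thesis
    using assms by (simp add: rGamma_inverse_Gamma Gamma_real_pos)
qed

section \<open>Semigroups that are symmetric for a bilinear form\<close>

text \<open>A uniform boundedness principle. The vectors whose orbit stays below \<open>n + 1\<close> on \<open>(0, 1 / (n + 1)]\<close> form a
closed set, and these sets cover the space because orbits converge at \<open>0\<close>. By Baire's theorem one of them
contains a ball, and linearity turns a bound on a ball into a bound on the operators.\<close>

lemma pointwise_limit_imp_locally_bounded:
  fixes U :: "real \<Rightarrow> 'v::banach \<Rightarrow> 'v"
  assumes lin: "\<And>t. 0 \<le> t \<Longrightarrow> bounded_linear (U t)"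
    and lim: "\<And>v. ((\<lambda>t. U t v) \<longlongrightarrow> Q v) (at_right 0)"
  obtains \<delta> M where "0 < \<delta>" "\<And>t v. 0 < t \<Longrightarrow> t \<le> \<delta> \<Longrightarrow> norm (U t v) \<le> M * norm v"
proof -
  define F where "F n = {v. \<forall>t. 0 < t \<and> t \<le> 1 / real (Suc n) \<longrightarrow> norm (U t v) \<le> real (Suc n)}" for n
  have closed_F: "closed (F n)" for n
  proof -
    have "F n = (\<Inter>t\<in>{0<..1 / real (Suc n)}. {v. norm (U t v) \<le> real (Suc n)})"
      unfolding F_def by auto
    moreover have "closed {v. norm (U t v) \<le> real (Suc n)}" if "0 < t" for t
      using lin[of t] that
      by (intro closed_Collect_le continuous_intros linear_continuous_on) auto
    ultimately show ?thesis by auto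
  qed
  have cover: "(\<Union>n. F n) = UNIV"
  proof (intro equalityI subsetI UNIV_I)
    fix v :: 'v
    have "\<forall>\<^sub>F t in at_right 0. dist (U t v) (Q v) < 1"
      using lim[of v] by (rule tendstoD) simp
    then obtain b where b: "0 < b" "\<And>t. 0 < t \<Longrightarrow> t < b \<Longrightarrow> dist (U t v) (Q v) < 1"
      unfolding eventually_at_right_field by auto
    obtain m where m: "1 / real (Suc m) < b"
      using b(1) reals_Archimedean by (auto simp: inverse_eq_divide)
    obtain k where k: "norm (Q v) + 1 \<le> real k" using real_arch_simple by blast
    have "v \<in> F (m + k)"
      unfolding F_def
    proof (intro CollectI allI impI)
      fix t :: real assume t: "0 < t \<and> t \<le> 1 / real (Suc (m + k))"
      have "1 / real (Suc (m + k)) \<le> 1 / real (Suc m)"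
        by (intro divide_left_mono) auto
      then have "dist (U t v) (Q v) < 1" using t m b(2)[of t] by linarith
      moreover have "norm (U t v) \<le> norm (Q v) + dist (U t v) (Q v)"
        by (metis dist_norm norm_triangle_sub)
      ultimately show "norm (U t v) \<le> real (Suc (m + k))" using k by simp
    qed
    then show "v \<in> (\<Union>n. F n)" by blast
  qed
  have "\<exists>n. interior (F n) \<noteq> {}"
  proof (rule ccontr)
    assume "\<not> ?thesis"
    then have "euclidean interior_of \<Union>(range F) = {}"
      using closed_F
      by (intro Baire_category_alt disjI1 completely_metrizable_space_euclidean) auto
    then show False using cover by simp
  qed
  then obtain n v0 where "v0 \<in> interior (F n)" by blast
  then obtain r where r: "0 < r" "ball v0 r \<subseteq> F n"
    by (meson interior_subset open_contains_ball open_interior subset_trans)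
  show ?thesis
  proof (rule that[of "1 / real (Suc n)" "4 * real (Suc n) / r"])
    fix t v assume t: "0 < t" "t \<le> 1 / real (Suc n)"
    interpret bounded_linear "U t" using lin t by simp
    show "norm (U t v) \<le> 4 * real (Suc n) / r * norm v"
    proof (cases "v = 0")
      case False
      define w where "w = (r / (2 * norm v)) *\<^sub>R v"
      have "norm w = r / 2" using False r by (simp add: w_def)
      then have "v0 + w \<in> F n" "v0 \<in> F n" using r by (auto simp: dist_norm intro!: subsetD[OF r(2)])
      then have "norm (U t (v0 + w)) \<le> real (Suc n)" "norm (U t v0) \<le> real (Suc n)"
        using t unfolding F_def by blast+
      moreover have "U t w = U t (v0 + w) - U t v0" by (simp add: add)
      ultimately have "norm (U t w) \<le> 2 * real (Suc n)"
        using norm_triangle_ineq4[of "U t (v0 + w)" "U t v0"] by simp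
      moreover have "norm (U t w) = r / (2 * norm v) * norm (U t v)"
        using r by (simp add: w_def scaleR)
      ultimately show ?thesis using False r by (simp add: field_simps)
    qed (simp add: zero)
  qed simp
qed

text \<open>The semigroup acts on the subspace \<open>X\<close> only. A bounded projection \<open>P\<close> onto \<open>X\<close> turns each \<open>S t\<close> into the
operator \<open>S t \<circ> P\<close> on the whole Banach space, to which Baire's theorem and the calculus of vector-valued
integrals apply.\<close>

locale projected_semigroup = P: bounded_linear P
  for P :: "'v::banach \<Rightarrow> 'v" +
  fixes X :: "'v set" and S :: "real \<Rightarrow> 'v \<Rightarrow> 'v"
  assumes semigroup: "C0_semigroup_on X S"
    and P_in: "P v \<in> X"
    and P_id: "v \<in> X \<Longrightarrow> P v = v"
begin

lemma in_X: "0 \<le> t \<Longrightarrow> v \<in> X \<Longrightarrow> S t v \<in> X"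
  and S_add: "0 \<le> t \<Longrightarrow> v \<in> X \<Longrightarrow> w \<in> X \<Longrightarrow> S t (v + w) = S t v + S t w"
  and S_scaleR: "0 \<le> t \<Longrightarrow> v \<in> X \<Longrightarrow> S t (c *\<^sub>R v) = c *\<^sub>R S t v"
  and S_bounded: "0 \<le> t \<Longrightarrow> \<exists>C. \<forall>v\<in>X. norm (S t v) \<le> C * norm v"
  and S_0: "v \<in> X \<Longrightarrow> S 0 v = v"
  and S_plus: "0 \<le> s \<Longrightarrow> 0 \<le> t \<Longrightarrow> v \<in> X \<Longrightarrow> S (s + t) v = S s (S t v)"
  and S_tendsto: "v \<in> X \<Longrightarrow> ((\<lambda>t. S t v) \<longlongrightarrow> v) (at_right 0)"
  using semigroup unfolding C0_semigroup_on_def by blast+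

lemma scaleR_in: "v \<in> X \<Longrightarrow> c *\<^sub>R v \<in> X"
  using P_in[of "c *\<^sub>R v"] by (simp add: P.scaleR P_id)

lemma diff_in: "v \<in> X \<Longrightarrow> w \<in> X \<Longrightarrow> v - w \<in> X"
  using P_in[of "v - w"] by (simp add: P.diff P_id)

lemma zero_in: "0 \<in> X"
  using P_in[of 0] by (simp add: P.zero)

lemma S_diff: "0 \<le> t \<Longrightarrow> v \<in> X \<Longrightarrow> w \<in> X \<Longrightarrow> S t (v - w) = S t v - S t w"
  using S_add[of t "v - w" w] by (simp add: diff_in)

lemma S_zero: "0 \<le> t \<Longrightarrow> S t 0 = 0"
  using S_scaleR[of t 0 0] zero_in by simp

lemma SP_bounded_linear:
  assumes t: "0 \<le> t"
  shows "bounded_linear (\<lambda>v. S t (P v))"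
proof -
  obtain C where C: "\<And>v. v \<in> X \<Longrightarrow> norm (S t v) \<le> C * norm v"
    using S_bounded[OF t] by blast
  obtain K where K: "0 < K" "\<And>v. norm (P v) \<le> norm v * K" using P.pos_bounded by blast
  show ?thesis
  proof (rule bounded_linear_intro)
    fix v w c
    show "S t (P (v + w)) = S t (P v) + S t (P w)" "S t (P (c *\<^sub>R v)) = c *\<^sub>R S t (P v)"
      using t by (simp_all add: P.add P.scaleR S_add S_scaleR P_in)
    have "norm (S t (P v)) \<le> C * norm (P v)" by (rule C[OF P_in])
    also have "\<dots> \<le> \<bar>C\<bar> * norm (P v)" by (simp add: mult_right_mono)
    also have "\<dots> \<le> \<bar>C\<bar> * (norm v * K)" by (intro mult_left_mono K) auto
    finally show "norm (S t (P v)) \<le> norm v * (\<bar>C\<bar> * K)" by (simp add: mult_ac)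
  qed
qed

text \<open>A bound \<open>M\<close> on \<open>[0, \<delta>]\<close> becomes \<open>M^n\<close> on \<open>[0, n \<delta>]\<close> by the semigroup law.\<close>

lemma locally_bounded:
  obtains M where "1 \<le> M" "\<And>t v. 0 \<le> t \<Longrightarrow> t \<le> T \<Longrightarrow> v \<in> X \<Longrightarrow> norm (S t v) \<le> M * norm v"
proof -
  obtain \<delta> M0 where \<delta>: "0 < \<delta>"
    and M0: "\<And>t v. 0 < t \<Longrightarrow> t \<le> \<delta> \<Longrightarrow> norm (S t (P v)) \<le> M0 * norm v"
    by (rule pointwise_limit_imp_locally_bounded[of "\<lambda>t v. S t (P v)" P])
      (use SP_bounded_linear S_tendsto P_in in auto)
  define M where "M = max 1 M0"
  have M: "1 \<le> M" "norm (S t v) \<le> M * norm v" if "0 \<le> t" "t \<le> \<delta>" "v \<in> X" for t v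
  proof -
    show "1 \<le> M" by (simp add: M_def)
    show "norm (S t v) \<le> M * norm v"
    proof (cases "t = 0")
      case False
      then have "norm (S t v) \<le> M0 * norm v" using M0[of t v] that by (simp add: P_id)
      also have "\<dots> \<le> M * norm v" by (intro mult_right_mono) (auto simp: M_def)
      finally show ?thesis .
    qed (use that S_0 in \<open>auto simp: M_def mult_le_cancel_right1\<close>)
  qed
  have M1: "1 \<le> M" by (simp add: M_def)
  have step: "\<forall>t v. 0 \<le> t \<longrightarrow> t \<le> real n * \<delta> \<longrightarrow> v \<in> X \<longrightarrow> norm (S t v) \<le> M ^ n * norm v" for n
  proof (induction n)
    case 0
    then show ?case using S_0 by auto
  next
    case (Suc n)
    show ?case
    proof (intro allI impI)
      fix t v assume t: "0 \<le> t" "t \<le> real (Suc n) * \<delta>" and v: "v \<in> X"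
      show "norm (S t v) \<le> M ^ Suc n * norm v"
      proof (cases "t \<le> \<delta>")
        case True
        have "norm (S t v) \<le> M ^ 1 * norm v" using M(2)[OF t(1) True v] by simp
        also have "\<dots> \<le> M ^ Suc n * norm v" using M1 by (intro mult_right_mono power_increasing) auto
        finally show ?thesis .
      next
        case False
        have "S t v = S \<delta> (S (t - \<delta>) v)"
          using S_plus[of \<delta> "t - \<delta>" v] False \<delta> v by simp
        also have "norm \<dots> \<le> M * norm (S (t - \<delta>) v)"
          using False \<delta> v by (intro M in_X) auto
        also have "\<dots> \<le> M * (M ^ n * norm v)"
          using Suc.IH t v False M1 by (intro mult_left_mono) (auto simp: algebra_simps)
        finally show ?thesis by (simp add: mult_ac)
      qed
    qed
  qed
  obtain n where n: "T \<le> real n * \<delta>"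
    using \<delta> ex_less_of_nat_mult less_imp_le by blast
  show ?thesis
  proof (rule that[of "M ^ n"])
    show "1 \<le> M ^ n" using M1 by (rule one_le_power)
    show "\<And>t v. 0 \<le> t \<Longrightarrow> t \<le> T \<Longrightarrow> v \<in> X \<Longrightarrow> norm (S t v) \<le> M ^ n * norm v"
      using step n by (meson order_trans)
  qed
qed

lemma orbit_continuous:
  assumes v: "v \<in> X"
  shows "continuous_on {0..} (\<lambda>t. S t v)"
proof -
  have "continuous_on {0..T} (\<lambda>t. S t v)" for T
  proof (rule uniformly_continuous_imp_continuous, unfold uniformly_continuous_on_def, intro allI impI)
    fix e :: real assume e: "0 < e"
    obtain M where M: "1 \<le> M" "\<And>t v. 0 \<le> t \<Longrightarrow> t \<le> T \<Longrightarrow> v \<in> X \<Longrightarrow> norm (S t v) \<le> M * norm v"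
      using locally_bounded by blast
    have "\<forall>\<^sub>F t in at_right 0. dist (S t v) v < e / M"
      using S_tendsto[OF v] by (rule tendstoD) (use e M in auto)
    then obtain b where b: "0 < b" "\<And>t. 0 < t \<Longrightarrow> t < b \<Longrightarrow> dist (S t v) v < e / M"
      unfolding eventually_at_right_field by auto
    have *: "dist (S t v) (S s v) < e" if "0 \<le> s" "s < t" "t \<le> T" "t - s < b" for s t
    proof -
      have "S t v - S s v = S s (S (t - s) v - v)"
        using S_plus[of s "t - s" v] that v by (simp add: S_diff in_X)
      then have "dist (S t v) (S s v) \<le> M * norm (S (t - s) v - v)"
        using M(2)[of s "S (t - s) v - v"] that v by (simp add: dist_norm diff_in in_X)
      also have "\<dots> < M * (e / M)"
        using b(2)[of "t - s"] that M(1) by (intro mult_strict_left_mono) (auto simp: dist_norm)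
      finally show ?thesis using M(1) by simp
    qed
    show "\<exists>d>0. \<forall>t\<in>{0..T}. \<forall>s\<in>{0..T}. dist s t < d \<longrightarrow> dist (S s v) (S t v) < e"
    proof (intro exI[of _ b] conjI ballI impI b)
      fix t s assume "t \<in> {0..T}" "s \<in> {0..T}" "dist s t < b"
      then show "dist (S s v) (S t v) < e"
        using *[of s t] *[of t s] e by (cases s t rule: linorder_cases) (auto simp: dist_real_def dist_commute)
    qed
  qed
  note * = this
  show ?thesis
    unfolding continuous_on_eq_continuous_within
  proof
    fix x :: real assume x: "x \<in> {0..}"
    have "at x within {0..} = at x within {0..x + 1}"
      by (rule at_within_nhd[of _ "{x - 1<..<x + 1}"]) auto
    moreover have "continuous (at x within {0..x + 1}) (\<lambda>t. S t v)"
      using *[of "x + 1"] x by (simp add: continuous_on_eq_continuous_within)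
    ultimately show "continuous (at x within {0..}) (\<lambda>t. S t v)" by simp
  qed
qed

abbreviation gen :: "('v \<times> 'v) set" where "gen \<equiv> generator_graph X S"

lemma genD: "(v, w) \<in> gen \<Longrightarrow> v \<in> X" "(v, w) \<in> gen \<Longrightarrow> w \<in> X"
  "(v, w) \<in> gen \<Longrightarrow> ((\<lambda>h. (S h v - v) /\<^sub>R h) \<longlongrightarrow> w) (at_right 0)"
  unfolding generator_graph_def by auto

lemma gen_scaleR: "(v, w) \<in> gen \<Longrightarrow> (c *\<^sub>R v, c *\<^sub>R w) \<in> gen"
proof -
  assume vw: "(v, w) \<in> gen"
  have "((\<lambda>h. c *\<^sub>R ((S h v - v) /\<^sub>R h)) \<longlongrightarrow> c *\<^sub>R w) (at_right 0)"
    by (intro tendsto_intros genD(3)[OF vw])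
  moreover have "\<forall>\<^sub>F h in at_right 0. c *\<^sub>R ((S h v - v) /\<^sub>R h) = (S h (c *\<^sub>R v) - c *\<^sub>R v) /\<^sub>R h"
    using eventually_at_right_less[of "0::real"]
    by eventually_elim (simp add: S_scaleR genD(1)[OF vw] scaleR_right_diff_distrib mult.commute)
  ultimately have "((\<lambda>h. (S h (c *\<^sub>R v) - c *\<^sub>R v) /\<^sub>R h) \<longlongrightarrow> c *\<^sub>R w) (at_right 0)"
    by (rule Lim_transform_eventually)
  then show ?thesis using genD[OF vw] by (simp add: generator_graph_def scaleR_in)
qed

lemma gen_orbit: "(v, w) \<in> gen \<Longrightarrow> 0 \<le> t \<Longrightarrow> (S t v, S t w) \<in> gen"
proof -
  assume vw: "(v, w) \<in> gen" and t: "0 \<le> t"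
  have "((\<lambda>h. S t (P ((S h v - v) /\<^sub>R h))) \<longlongrightarrow> S t (P w)) (at_right 0)"
    by (rule bounded_linear.tendsto[OF SP_bounded_linear[OF t] genD(3)[OF vw]])
  moreover have "\<forall>\<^sub>F h in at_right 0. S t (P ((S h v - v) /\<^sub>R h)) = (S h (S t v) - S t v) /\<^sub>R h"
    using eventually_at_right_less[of "0::real"]
  proof eventually_elim
    case (elim h)
    then show ?case
      using genD(1)[OF vw] t S_plus[of h t v] S_plus[of t h v]
      by (simp add: P_id in_X diff_in scaleR_in S_scaleR S_diff add.commute)
  qed
  ultimately have "((\<lambda>h. (S h (S t v) - S t v) /\<^sub>R h) \<longlongrightarrow> S t (P w)) (at_right 0)"
    by (rule Lim_transform_eventually)
  then show ?thesis using genD[OF vw] t by (simp add: generator_graph_def in_X P_id)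
qed

lemma orbit_integrable: "v \<in> X \<Longrightarrow> 0 \<le> a \<Longrightarrow> (\<lambda>s. S s v) integrable_on {a..b}"
  by (intro integrable_continuous_real continuous_on_subset[OF orbit_continuous]) auto

lemma orbit_integral_deriv:
  assumes v: "v \<in> X" and a: "0 \<le> a"
  shows "((\<lambda>h. (integral {0..a + h} (\<lambda>s. S s v) - integral {0..a} (\<lambda>s. S s v)) /\<^sub>R h) \<longlongrightarrow> S a v) (at_right 0)"
proof -
  let ?G = "\<lambda>u. integral {0..u} (\<lambda>s. S s v)"
  have "(?G has_vector_derivative S a v) (at a within {0..a + 1})"
    using a v by (intro integral_has_vector_derivative continuous_on_subset[OF orbit_continuous]) auto
  then have "(?G has_vector_derivative S a v) (at a within {a..a + 1})"
    by (rule has_vector_derivative_within_subset) (use a in auto)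
  then have "((\<lambda>y. (1 / norm (y - a)) *\<^sub>R (?G y - (?G a + (y - a) *\<^sub>R S a v))) \<longlongrightarrow> 0) (at_right a)"
    by (simp add: has_vector_derivative_def has_derivative_within at_within_Icc_at_right)
  moreover have "\<forall>\<^sub>F y in at_right a. (1 / norm (y - a)) *\<^sub>R (?G y - (?G a + (y - a) *\<^sub>R S a v)) =
      (?G y - ?G a) /\<^sub>R (y - a) - S a v"
    using eventually_at_right_less[of a]
  proof eventually_elim
    case (elim y)
    then have "norm (y - a) = y - a" "y - a \<noteq> 0" by auto
    then show ?case
      by (simp only: diff_diff_eq[symmetric] scaleR_right_diff_distrib[of _ "_ - _" "_ *\<^sub>R _"]
          scaleR_scaleR inverse_eq_divide) simp
  qed
  ultimately have "((\<lambda>y. (?G y - ?G a) /\<^sub>R (y - a) - S a v) \<longlongrightarrow> 0) (at_right a)"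
    by (rule Lim_transform_eventually)
  then have "((\<lambda>y. (?G y - ?G a) /\<^sub>R (y - a)) \<longlongrightarrow> S a v) (at_right a)"
    by (rule LIM_zero_cancel)
  then show ?thesis
    by (subst (asm) filterlim_at_right_to_0) (simp add: add.commute)
qed

text \<open>Applying \<open>S k\<close> shifts the orbit, so \<open>S k G - G\<close> for \<open>G = \<integral>\<^sub>0\<^sup>h S s v ds\<close> is the integral over \<open>[h, h + k]\<close> minus
the integral over \<open>[0, k]\<close>; divided by \<open>k\<close>, these tend to the values of the orbit at \<open>h\<close> and \<open>0\<close>.\<close>

lemma orbit_integral_in_gen:
  assumes v: "v \<in> X" and h: "0 < h"
  shows "(integral {0..h} (\<lambda>s. S s v), S h v - v) \<in> gen"
proof -
  let ?G = "\<lambda>u. integral {0..u} (\<lambda>s. S s v)"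
  have G_in: "?G h \<in> X"
  proof -
    have "P (?G h) = integral {0..h} (P \<circ> (\<lambda>s. S s v))"
      using integral_linear[OF orbit_integrable[OF v, of 0 h] P.bounded_linear_axioms] by simp
    also have "\<dots> = ?G h"
      by (intro integral_cong) (simp add: P_id in_X v)
    finally show ?thesis by (metis P_in)
  qed
  have eq: "S k (?G h) = ?G (h + k) - ?G k" if k: "0 < k" for k
  proof -
    have "S k (?G h) = S k (P (?G h))" by (simp add: P_id G_in)
    also have "\<dots> = integral {0..h} ((\<lambda>w. S k (P w)) \<circ> (\<lambda>s. S s v))"
      by (rule integral_linear[OF orbit_integrable[OF v] SP_bounded_linear, symmetric]) (use k in auto)
    also have "\<dots> = integral {0..h} ((\<lambda>s. S s v) \<circ> (+) k)"
      by (intro integral_cong) (use k v in \<open>simp add: P_id in_X S_plus\<close>)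
    also have "\<dots> = integral {k..h + k} (\<lambda>s. S s v)"
      by (simp add: integral_shift_Icc_real)
    also have "\<dots> = ?G (h + k) - ?G k"
      using Henstock_Kurzweil_Integration.integral_combine[of 0 k "h + k" "\<lambda>s. S s v"] orbit_integrable[OF v, of 0 "h + k"] k h
      by (simp add: algebra_simps)
    finally show ?thesis .
  qed
  have "((\<lambda>k. (?G (h + k) - ?G h) /\<^sub>R k - (?G (0 + k) - ?G 0) /\<^sub>R k) \<longlongrightarrow> S h v - S 0 v) (at_right 0)"
    by (intro tendsto_diff orbit_integral_deriv v) (use h in auto)
  moreover have "\<forall>\<^sub>F k in at_right 0. (?G (h + k) - ?G h) /\<^sub>R k - (?G (0 + k) - ?G 0) /\<^sub>R k = (S k (?G h) - ?G h) /\<^sub>R k"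
    using eventually_at_right_less[of "0::real"]
    by eventually_elim (simp add: eq algebra_simps)
  ultimately have "((\<lambda>k. (S k (?G h) - ?G h) /\<^sub>R k) \<longlongrightarrow> S h v - S 0 v) (at_right 0)"
    by (rule Lim_transform_eventually)
  then show ?thesis
    using v h G_in by (simp add: generator_graph_def S_0 in_X diff_in)
qed

lemma gen_dense:
  assumes "v \<in> X"
  obtains V W where "\<And>h. 0 < h \<Longrightarrow> (V h, W h) \<in> gen" "(V \<longlongrightarrow> v) (at_right (0::real))"
proof (rule that)
  show "((1 / h) *\<^sub>R integral {0..h} (\<lambda>s. S s v), (1 / h) *\<^sub>R (S h v - v)) \<in> gen" if "0 < h" for h :: real
    by (intro gen_scaleR orbit_integral_in_gen assms that)
  show "((\<lambda>h. (1 / h) *\<^sub>R integral {0..h} (\<lambda>s. S s v)) \<longlongrightarrow> v) (at_right 0)"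
    using orbit_integral_deriv[OF assms, of 0] assms by (simp add: S_0 inverse_eq_divide)
qed

end

locale symmetric_semigroup = projected_semigroup P X S + \<beta>: bounded_bilinear \<beta>
  for P :: "'v::banach \<Rightarrow> 'v" and X S and \<beta> :: "'v \<Rightarrow> 'v \<Rightarrow> real" +
  assumes gen_symmetric: "(u, a) \<in> generator_graph X S \<Longrightarrow> (v, b) \<in> generator_graph X S \<Longrightarrow> \<beta> a v = \<beta> u b"
    and form_nonneg: "v \<in> X \<Longrightarrow> 0 \<le> \<beta> v v"
    and form_definite: "v \<in> X \<Longrightarrow> \<beta> v v = 0 \<Longrightarrow> v = 0"
begin

text \<open>Cut \<open>[0, t]\<close> into pieces of length \<open>h\<close>. The quantity \<open>\<beta> (S (k h) u) (S (t - k h) v)\<close> starts at \<open>\<beta> u (S t v)\<close>,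
ends at \<open>\<beta> (S t u) v\<close>, and changes in each step by \<open>h\<close> times a difference of two difference quotients of
orbits. The limits of these quotients cancel because the generator is symmetric, so one step costs \<open>o(h)\<close>,
uniformly in \<open>k\<close> by the local bound on the semigroup, and all steps together cost \<open>o(1)\<close>.\<close>

lemma symmetric_on_domain:
  assumes u: "(u, a) \<in> gen" and v: "(v, b) \<in> gen" and t: "0 < t"
  shows "\<beta> (S t u) v = \<beta> u (S t v)"
proof -
  obtain M where M: "1 \<le> M" "\<And>s v. 0 \<le> s \<Longrightarrow> s \<le> t \<Longrightarrow> v \<in> X \<Longrightarrow> norm (S s v) \<le> M * norm v"
    using locally_bounded by blast
  obtain K where K: "0 < K" "\<And>x y. norm (\<beta> x y) \<le> norm x * norm y * K" using \<beta>.pos_bounded by blast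
  note X = genD(1)[OF u] genD(2)[OF u] genD(1)[OF v] genD(2)[OF v]
  \<comment> \<open>The error bound for the whole telescoping sum; a single step contributes the fraction \<open>h / t\<close> of it.\<close>
  define E where "E h = t * K * M\<^sup>2 * (norm ((S h u - u) /\<^sub>R h - a) * norm v + norm u * norm ((S h v - v) /\<^sub>R h - b))" for h
  have step: "\<bar>\<beta> (S (real (Suc k) * h) u) (S (t - real (Suc k) * h) v) - \<beta> (S (real k * h) u) (S (t - real k * h) v)\<bar> \<le> h / t * E h"
    if h: "0 < h" "real (Suc k) * h \<le> t" for k h
  proof -
    define x where "x = S (real k * h) u"
    define y where "y = S (t - real (Suc k) * h) v"
    define Au where "Au = (S h u - u) /\<^sub>R h"
    define Av where "Av = (S h v - v) /\<^sub>R h"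
    have pos: "0 \<le> real k * h" "real k * h \<le> t" "0 \<le> t - real (Suc k) * h" "t - real (Suc k) * h \<le> t"
      using h by (auto simp: algebra_simps)
    have A_in: "Au \<in> X" "Av \<in> X" using X h by (auto simp: Au_def Av_def scaleR_in diff_in in_X)
    have SA: "S (real k * h) Au = (S (real k * h) (S h u) - S (real k * h) u) /\<^sub>R h"
      "S (t - real (Suc k) * h) Av = (S (t - real (Suc k) * h) (S h v) - S (t - real (Suc k) * h) v) /\<^sub>R h"
      unfolding Au_def Av_def using X h pos by (simp_all add: S_scaleR S_diff in_X diff_in)
    have xu: "S (real (Suc k) * h) u = x + h *\<^sub>R S (real k * h) Au"
      using S_plus[of "real k * h" h u] X h pos by (simp add: SA x_def distrib_right add.commute)
    have yv: "S (t - real k * h) v = y + h *\<^sub>R S (t - real (Suc k) * h) Av"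
    proof -
      have "t - real k * h = (t - real (Suc k) * h) + h" by (simp add: algebra_simps)
      moreover have "S (t - real (Suc k) * h + h) v = S (t - real (Suc k) * h) (S h v)"
        using X h pos by (intro S_plus) auto
      ultimately have "S (t - real k * h) v = S (t - real (Suc k) * h) (S h v)"
        by (simp only:)
      then show ?thesis using h by (simp only: SA y_def) simp
    qed
    have sym: "\<beta> (S (real k * h) a) y = \<beta> x (S (t - real (Suc k) * h) b)"
      unfolding x_def y_def by (intro gen_symmetric gen_orbit u v pos)
    have "\<beta> (S (real (Suc k) * h) u) (S (t - real (Suc k) * h) v) - \<beta> (S (real k * h) u) (S (t - real k * h) v)
        = \<beta> (x + h *\<^sub>R S (real k * h) Au) y - \<beta> x (y + h *\<^sub>R S (t - real (Suc k) * h) Av)"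
      by (simp only: xu yv x_def[symmetric] y_def[symmetric])
    also have "\<dots> = h * (\<beta> (S (real k * h) Au) y - \<beta> x (S (t - real (Suc k) * h) Av))"
      by (simp add: \<beta>.add_left \<beta>.add_right \<beta>.scaleR_left \<beta>.scaleR_right algebra_simps)
    also have "\<dots> = h * (\<beta> (S (real k * h) (Au - a)) y - \<beta> x (S (t - real (Suc k) * h) (Av - b)))"
      using sym X A_in pos by (simp add: S_diff \<beta>.diff_left \<beta>.diff_right)
    finally have eq: "\<bar>\<beta> (S (real (Suc k) * h) u) (S (t - real (Suc k) * h) v) - \<beta> (S (real k * h) u) (S (t - real k * h) v)\<bar>
        = h * \<bar>\<beta> (S (real k * h) (Au - a)) y - \<beta> x (S (t - real (Suc k) * h) (Av - b))\<bar>"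
      using h by (simp add: abs_mult)
    have n1: "norm (S (real k * h) (Au - a)) \<le> M * norm (Au - a)" "norm y \<le> M * norm v"
      "norm x \<le> M * norm u" "norm (S (t - real (Suc k) * h) (Av - b)) \<le> M * norm (Av - b)"
      unfolding x_def y_def using pos X A_in by (intro M diff_in; simp)+
    have "norm (\<beta> (S (real k * h) (Au - a)) y) \<le> (M * norm (Au - a)) * (M * norm v) * K"
      using M(1) K(1) by (intro order_trans[OF K(2)] mult_mono n1) auto
    moreover have "norm (\<beta> x (S (t - real (Suc k) * h) (Av - b))) \<le> (M * norm u) * (M * norm (Av - b)) * K"
      using M(1) K(1) by (intro order_trans[OF K(2)] mult_mono n1) auto
    ultimately have "\<bar>\<beta> (S (real k * h) (Au - a)) y - \<beta> x (S (t - real (Suc k) * h) (Av - b))\<bar>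
        \<le> K * M\<^sup>2 * (norm (Au - a) * norm v + norm u * norm (Av - b))"
      by (simp add: power2_eq_square algebra_simps)
    then show ?thesis
      unfolding eq using h t by (simp add: E_def Au_def Av_def)
  qed
  have bound: "\<bar>\<beta> (S t u) v - \<beta> u (S t v)\<bar> \<le> E (t / real (Suc N))" for N
  proof -
    define h where "h = t / real (Suc N)"
    have h: "0 < h" "real (Suc N) * h = t" using t by (simp_all add: h_def)
    let ?d = "\<lambda>k. \<beta> (S (real k * h) u) (S (t - real k * h) v)"
    have "\<beta> (S t u) v - \<beta> u (S t v) = ?d (Suc N) - ?d 0"
      using h X by (simp only: h(2)) (simp add: S_0)
    also have "\<dots> = (\<Sum>k<Suc N. ?d (Suc k) - ?d k)"
      by (rule sum_lessThan_telescope[symmetric])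
    also have "\<bar>\<dots>\<bar> \<le> (\<Sum>k<Suc N. h / t * E h)"
    proof (rule order_trans[OF sum_abs], rule sum_mono, rule step)
      fix k assume "k \<in> {..<Suc N}"
      then have "real (Suc k) * h \<le> real (Suc N) * h"
        using h(1) by (intro mult_right_mono) auto
      then show "real (Suc k) * h \<le> t" by (simp only: h(2))
    qed (rule h)
    also have "\<dots> = E h" using t h by (simp add: divide_simps)
    finally show ?thesis by (simp add: h_def)
  qed
  have "filterlim (\<lambda>N. t / real (Suc N)) (at_right 0) sequentially"
    using t by real_asymp
  moreover have "(E \<longlongrightarrow> t * K * M\<^sup>2 * (norm (a - a) * norm v + norm u * norm (b - b))) (at_right 0)"
    unfolding E_def by (intro tendsto_intros genD(3) u v)
  ultimately have "(\<lambda>N. E (t / real (Suc N))) \<longlonglongrightarrow> t * K * M\<^sup>2 * (norm (a - a) * norm v + norm u * norm (b - b))"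
    by (rule filterlim_compose[rotated])
  then have "(\<lambda>N. E (t / real (Suc N))) \<longlonglongrightarrow> 0" by simp
  then have "\<bar>\<beta> (S t u) v - \<beta> u (S t v)\<bar> \<le> 0"
    by (rule LIMSEQ_le_const) (use bound in auto)
  then show ?thesis by simp
qed

lemma symmetric:
  assumes u: "u \<in> X" and v: "v \<in> X" and t: "0 < t"
  shows "\<beta> (S t u) v = \<beta> u (S t v)"
proof -
  obtain U Au where U: "\<And>h. 0 < h \<Longrightarrow> (U h, Au h) \<in> gen" "(U \<longlongrightarrow> u) (at_right (0::real))"
    using gen_dense[OF u] by metis
  obtain V Av where V: "\<And>h. 0 < h \<Longrightarrow> (V h, Av h) \<in> gen" "(V \<longlongrightarrow> v) (at_right (0::real))"
    using gen_dense[OF v] by metis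
  note lim = bounded_linear.tendsto[OF SP_bounded_linear[OF less_imp_le[OF t]]]
  have l1: "((\<lambda>h. \<beta> (S t (P (U h))) (V h)) \<longlongrightarrow> \<beta> (S t (P u)) v) (at_right 0)"
    by (intro \<beta>.tendsto lim U V)
  have l2: "((\<lambda>h. \<beta> (U h) (S t (P (V h)))) \<longlongrightarrow> \<beta> u (S t (P v))) (at_right 0)"
    by (intro \<beta>.tendsto lim U V)
  have "\<forall>\<^sub>F h in at_right 0. \<beta> (S t (P (U h))) (V h) = \<beta> (U h) (S t (P (V h)))"
    using eventually_at_right_less[of "0::real"]
  proof eventually_elim
    case (elim h)
    then show ?case
      using symmetric_on_domain[OF U(1) V(1) t] genD(1)[OF U(1)] genD(1)[OF V(1)] by (simp add: P_id)
  qed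
  then have "\<beta> (S t (P u)) v = \<beta> u (S t (P v))"
    by (intro tendsto_unique[OF trivial_limit_at_right_real _ l2] Lim_transform_eventually[OF l1])
  then show ?thesis by (simp add: P_id u v)
qed

lemma form_orbit_eq_square:
  assumes v: "v \<in> X" and t: "0 < t"
  shows "\<beta> (S t v) v = \<beta> (S (t / 2) v) (S (t / 2) v)"
  using symmetric[of "S (t / 2) v" v "t / 2"] S_plus[of "t / 2" "t / 2" v] v t by (simp add: in_X)

lemma orbit_injective:
  assumes v: "v \<in> X" and t: "0 < t" and 0: "S t v = 0"
  shows "v = 0"
proof -
  have half: "S (s / 2) v = 0" if "0 < s" "S s v = 0" for s
    using form_orbit_eq_square[OF v that(1)] that v form_definite[of "S (s / 2) v"]
    by (simp add: in_X \<beta>.zero_left)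
  have z: "S (t * (1 / 2) ^ n) v = 0" for n
  proof (induction n)
    case (Suc n)
    then show ?case using half[of "t * (1 / 2) ^ n"] t by (simp add: mult.commute)
  qed (use 0 in simp)
  have "filterlim (\<lambda>n. t * (1 / 2) ^ n) (at_right 0) sequentially"
    using t by real_asymp
  from filterlim_compose[OF S_tendsto[OF v] this] have "(\<lambda>n. 0) \<longlonglongrightarrow> v"
    by (simp add: z)
  then show ?thesis by (simp add: LIMSEQ_const_iff)
qed

text \<open>Paired with \<open>v\<close>, the integrand is \<open>w s\<close> times the square of \<open>S (s \<tau> / 2) v\<close> in the form, hence nonnegative
and continuous. As its integral is zero, it vanishes. Near \<open>0\<close> the weight is positive, so the square vanishes
there, and injectivity of the semigroup gives \<open>v = 0\<close>.\<close>

lemma weighted_average_injective: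
  fixes w :: "real \<Rightarrow> real"
  assumes v: "v \<in> X" and \<tau>: "0 < \<tau>"
    and w_cont: "continuous_on UNIV w" and w_nonneg: "\<And>s. 0 < s \<Longrightarrow> 0 \<le> w s" and w_0: "0 < w 0"
    and int: "((\<lambda>s. w s *\<^sub>R S (s * \<tau>) v) has_integral 0) {0<..}"
  shows "v = 0"
proof -
  define f where "f s = w s * \<beta> (S (s * \<tau>) v) v" for s
  have f_int: "(f has_integral 0) {0<..}"
    using has_integral_linear[OF int \<beta>.bounded_linear_left[of v]]
    by (simp add: o_def f_def[abs_def] \<beta>.scaleR_left \<beta>.zero_left)
  have f_nonneg: "0 \<le> f s" if "0 < s" for s
    unfolding f_def using form_orbit_eq_square[OF v, of "s * \<tau>"] \<tau> that v w_nonneg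
    by (auto intro!: mult_nonneg_nonneg form_nonneg in_X)
  have "isCont w 0" using w_cont by (simp add: continuous_on_eq_continuous_at)
  then have "\<forall>\<^sub>F s in at 0. 0 < w s"
    using w_0 by (auto simp: isCont_def intro: order_tendstoD)
  then obtain d where d: "0 < d" "\<And>s. s \<noteq> 0 \<Longrightarrow> \<bar>s\<bar> < d \<Longrightarrow> 0 < w s"
    by (auto simp: eventually_at dist_real_def)
  define a where "a = d / 4"
  define b where "b = d / 2"
  have ab: "0 < a" "a < b" "b < d" using d by (auto simp: a_def b_def)
  have cont: "continuous_on {a..b} f"
    unfolding f_def
    by (intro continuous_intros continuous_on_subset[OF w_cont] \<beta>.continuous_on
        continuous_on_compose2[OF orbit_continuous[OF v]]) (use ab \<tau> in auto)
  have "integral {a..b} f \<le> integral {0<..} f"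
    using ab f_int f_nonneg cont
    by (intro integral_subset_le integrable_continuous_real) (auto simp: has_integral_integrable)
  moreover have "0 \<le> integral {a..b} f"
    using ab f_nonneg cont by (intro integral_nonneg integrable_continuous_real) auto
  ultimately have "integral {a..b} f = 0"
    using f_int by (simp add: integral_unique)
  then have "(f has_integral 0) {a..b}"
    using integrable_continuous_real[OF cont] by (simp add: has_integral_integrable_integral)
  then have "f b = 0"
    using has_integral_0_cbox_imp_0[of a b f b] cont f_nonneg ab by (auto simp: box_real)
  then have "\<beta> (S (b * \<tau>) v) v = 0"
    using d(2)[of b] ab by (auto simp: f_def)
  then have "S (b * \<tau> / 2) v = 0"
    using form_orbit_eq_square[OF v, of "b * \<tau>"] ab \<tau> v by (intro form_definite in_X) auto
  then show "v = 0"
    by (rule orbit_injective[OF v, rotated]) (use ab \<tau> in auto)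
qed

end

section \<open>Completeness of the space of square-integrable functions\<close>

lemma abs_rep_l2: "abs_l2 (rep_l2 u) = u"
  using Quotient_abs_rep[OF Quotient_l2] by blast

lemma rep_l2_minus: "AE x in lebesgue. rep_l2 (u - v) x = rep_l2 u x - rep_l2 v x"
proof -
  have "u - v = abs_l2 (\<lambda>x. rep_l2 u x - rep_l2 v x)"
    by (rule minus_l2.abs_eq[of "rep_l2 u" "rep_l2 v", unfolded abs_rep_l2]) (simp_all add: square_integrable_rep_l2)
  then show ?thesis
    using rep_abs_l2_AE[OF square_integrable_diff[OF square_integrable_rep_l2 square_integrable_rep_l2]] by metis
qed

lemma rep_l2_add: "AE x in lebesgue. rep_l2 (u + v) x = rep_l2 u x + rep_l2 v x"
proof -
  have "u + v = abs_l2 (\<lambda>x. rep_l2 u x + rep_l2 v x)"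
    by (rule plus_l2.abs_eq[of "rep_l2 u" "rep_l2 v", unfolded abs_rep_l2]) (simp_all add: square_integrable_rep_l2)
  then show ?thesis
    using rep_abs_l2_AE[OF square_integrable_add[OF square_integrable_rep_l2 square_integrable_rep_l2]] by metis
qed

lemma rep_l2_scaleR: "AE x in lebesgue. rep_l2 (c *\<^sub>R u) x = c *\<^sub>R rep_l2 u x"
proof -
  have "c *\<^sub>R u = abs_l2 (\<lambda>x. c *\<^sub>R rep_l2 u x)"
    by (rule scaleR_l2.abs_eq[of "rep_l2 u" c, unfolded abs_rep_l2]) (simp add: square_integrable_rep_l2)
  then show ?thesis
    using rep_abs_l2_AE[OF square_integrable_scaleR[OF square_integrable_rep_l2]] by metis
qed

lemma rep_l2_zero: "AE x in lebesgue. rep_l2 0 x = 0"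
  using rep_abs_l2_AE[OF square_integrable_zero] by (simp add: zero_l2_def)

lemma inner_l2_eq: "u \<bullet> v = (LINT x|lebesgue. rep_l2 u x \<bullet> rep_l2 v x)"
  by (rule inner_l2.abs_eq[of "rep_l2 u" "rep_l2 v", unfolded abs_rep_l2]) (simp_all add: square_integrable_rep_l2)

lemma abs_l2_eqI:
  assumes "square_integrable lebesgue f" "AE x in lebesgue. f x = rep_l2 u x"
  shows "abs_l2 f = u"
  by (rule Quotient_rel_abs[OF Quotient_l2, of f "rep_l2 u", unfolded abs_rep_l2])
    (use assms in \<open>simp add: square_integrable_rep_l2\<close>)

lemma l2_eqI: "AE x in lebesgue. rep_l2 u x = rep_l2 v x \<Longrightarrow> u = v"
  using abs_l2_eqI[OF square_integrable_rep_l2, of u v] by (simp add: abs_rep_l2)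

lemma rep_l2_measurable [measurable]: "rep_l2 u \<in> borel_measurable lebesgue"
  using square_integrable_rep_l2[of u] by (simp add: square_integrable_def)

lemma square_integrableI_nn:
  assumes "f \<in> borel_measurable M" "(\<integral>\<^sup>+x. ennreal ((norm (f x))\<^sup>2) \<partial>M) < \<infinity>"
  shows "square_integrable M f"
  using assms by (auto simp: square_integrable_def integrable_iff_bounded)

lemma nn_integral_rep_l2: "(\<integral>\<^sup>+x. ennreal ((norm (rep_l2 u x))\<^sup>2) \<partial>lebesgue) = ennreal ((norm u)\<^sup>2)"
proof -
  have "(\<integral>\<^sup>+x. ennreal ((norm (rep_l2 u x))\<^sup>2) \<partial>lebesgue) = ennreal (LINT x|lebesgue. (norm (rep_l2 u x))\<^sup>2)"
    using square_integrable_rep_l2[of u] by (intro nn_integral_eq_integral) (auto simp: square_integrable_def)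
  then show ?thesis by (simp add: power2_norm_eq_inner inner_l2_eq)
qed

lemma nn_integral_rep_l2_diff:
  "(\<integral>\<^sup>+x. ennreal ((norm (rep_l2 u x - rep_l2 v x))\<^sup>2) \<partial>lebesgue) = ennreal ((norm (u - v))\<^sup>2)"
  unfolding nn_integral_rep_l2[symmetric]
  by (rule nn_integral_cong_AE) (use rep_l2_minus[of u v] in \<open>eventually_elim, simp\<close>)

text \<open>By the inequality of arithmetic and geometric means, \<open>d \<le> 2^k d\<^sup>2 + 2^(- k)\<close>. In this form a bound on squared
\<open>L\<^sup>2\<close> norms controls a series pointwise, without Minkowski's inequality.\<close>

lemma summable_norm_of_weighted_squares:
  fixes d :: "nat \<Rightarrow> 'b::real_normed_vector"
  assumes "(\<Sum>k. ennreal (2 ^ k * (norm (d k))\<^sup>2)) \<noteq> \<infinity>"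
  shows "summable (\<lambda>k. norm (d k))"
proof -
  have s: "summable (\<lambda>k. 2 ^ k * (norm (d k))\<^sup>2)"
    by (rule summable_suminf_not_top) (use assms in auto)
  show ?thesis
  proof (rule summable_comparison_test')
    show "summable (\<lambda>k. 2 ^ k * (norm (d k))\<^sup>2 + (1 / 2) ^ k)"
      by (intro summable_add s summable_geometric) auto
    show "norm (norm (d k)) \<le> 2 ^ k * (norm (d k))\<^sup>2 + (1 / 2) ^ k" for k
    proof -
      define q :: real where "q = sqrt (2 ^ k)"
      have q: "0 < q" "q\<^sup>2 = 2 ^ k" by (auto simp: q_def)
      have "2 * (q * norm (d k)) * (1 / q) \<le> (q * norm (d k))\<^sup>2 + (1 / q)\<^sup>2"
        by (rule sum_squares_bound)
      then have "2 * norm (d k) \<le> 2 ^ k * (norm (d k))\<^sup>2 + (1 / 2) ^ k"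
        using q by (simp add: power_mult_distrib power_divide power_one_over)
      then have "norm (d k) \<le> 2 ^ k * (norm (d k))\<^sup>2 + (1 / 2) ^ k"
        using norm_ge_zero[of "d k"] by linarith
      then show ?thesis by simp
    qed
  qed
qed

text \<open>The Riesz-Fischer theorem. For a subsequence \<open>f\<close> with \<open>\<parallel>f (Suc k) - f k\<parallel> \<le> 2^(- k)\<close>, the function
\<open>\<Sum>k. 2^k |f (Suc k) - f k|\<^sup>2\<close> has finite integral, so the subsequence converges almost everywhere, and Fatou's
lemma shows that the pointwise limit is also the limit in norm.\<close>

lemma l2_complete:
  fixes X :: "nat \<Rightarrow> ('a::euclidean_space, 'b::euclidean_space) l2"
  assumes "Cauchy X"
  shows "convergent X"
proof -
  have ex: "\<exists>N. \<forall>m\<ge>N. \<forall>n\<ge>N. dist (X m) (X n) < (1/2) ^ k" for k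
    using assms by (auto simp: Cauchy_def)
  obtain N where N: "\<And>k m n. N k \<le> m \<Longrightarrow> N k \<le> n \<Longrightarrow> dist (X m) (X n) < (1/2) ^ k"
    using ex by metis
  define s where "s = rec_nat (N 0) (\<lambda>k r. max (Suc r) (N (Suc k)))"
  have s_Suc: "s (Suc k) = max (Suc (s k)) (N (Suc k))" for k by (simp add: s_def)
  have s_N: "N k \<le> s k" for k by (cases k) (auto simp: s_def)
  have s_mono: "strict_mono s" by (auto simp: strict_mono_Suc_iff s_Suc)
  have s_close: "norm (X (s (Suc k)) - X (s k)) \<le> (1/2) ^ k" for k
    using N[of k "s (Suc k)" "s k"] s_N[of k] strict_mono_leD[OF s_mono, of k "Suc k"]
    by (simp add: dist_norm)
  define f where "f k = rep_l2 (X (s k))" for k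
  have f_meas [measurable]: "f k \<in> borel_measurable lebesgue" for k by (simp add: f_def)
  have "(\<integral>\<^sup>+x. (\<Sum>k. ennreal (2 ^ k * (norm (f (Suc k) x - f k x))\<^sup>2)) \<partial>lebesgue) =
      (\<Sum>k. \<integral>\<^sup>+x. ennreal (2 ^ k * (norm (f (Suc k) x - f k x))\<^sup>2) \<partial>lebesgue)"
    by (rule nn_integral_suminf) measurable
  also have "\<dots> = (\<Sum>k. ennreal (2 ^ k * (norm (X (s (Suc k)) - X (s k)))\<^sup>2))"
    by (simp add: ennreal_mult nn_integral_cmult f_def nn_integral_rep_l2_diff)
  also have "\<dots> \<le> (\<Sum>k. ennreal ((1/2) ^ k))"
  proof (intro suminf_le ennreal_leI)
    fix k :: nat
    have "2 ^ k * (norm (X (s (Suc k)) - X (s k)))\<^sup>2 \<le> 2 ^ k * ((1/2) ^ k)\<^sup>2"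
      by (intro mult_left_mono power_mono s_close) auto
    then show "2 ^ k * (norm (X (s (Suc k)) - X (s k)))\<^sup>2 \<le> (1/2) ^ k"
      by (simp add: power2_eq_square power_divide)
  qed auto
  also have "\<dots> < \<infinity>"
    by (subst suminf_ennreal2) (auto intro: summable_geometric)
  finally have fin: "(\<integral>\<^sup>+x. (\<Sum>k. ennreal (2 ^ k * (norm (f (Suc k) x - f k x))\<^sup>2)) \<partial>lebesgue) \<noteq> \<infinity>"
    by simp
  have "AE x in lebesgue. (\<Sum>k. ennreal (2 ^ k * (norm (f (Suc k) x - f k x))\<^sup>2)) \<noteq> \<infinity>"
    by (rule nn_integral_PInf_AE[OF _ fin]) measurable
  then have conv: "AE x in lebesgue. convergent (\<lambda>k. f k x)"
  proof eventually_elim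
    case (elim x)
    have "summable (\<lambda>k. f (Suc k) x - f k x)"
      by (rule summable_norm_cancel[OF summable_norm_of_weighted_squares[OF elim]])
    then have "convergent (\<lambda>n. (\<Sum>k<n. f (Suc k) x - f k x))"
      by (simp add: summable_iff_convergent)
    then have "convergent (\<lambda>n. (f n x - f 0 x) + f 0 x)"
      unfolding sum_lessThan_telescope[of "\<lambda>k. f k x"] by (intro convergent_add convergent_const)
    then show ?case by simp
  qed
  define g where "g x = lim (\<lambda>k. f k x)" for x
  have g_meas [measurable]: "g \<in> borel_measurable lebesgue"
    unfolding g_def by (rule borel_measurable_lim_metric) (rule f_meas)
  have g_bound: "(\<integral>\<^sup>+x. ennreal ((norm (g x - f k x))\<^sup>2) \<partial>lebesgue) \<le> ennreal (((1/2) ^ k)\<^sup>2)" for k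
  proof -
    have "AE x in lebesgue. ennreal ((norm (g x - f k x))\<^sup>2) = liminf (\<lambda>m. ennreal ((norm (f m x - f k x))\<^sup>2))"
      using conv
    proof eventually_elim
      case (elim x)
      then have "(\<lambda>m. f m x) \<longlonglongrightarrow> g x" by (simp add: g_def convergent_LIMSEQ_iff)
      then have "(\<lambda>m. ennreal ((norm (f m x - f k x))\<^sup>2)) \<longlonglongrightarrow> ennreal ((norm (g x - f k x))\<^sup>2)"
        by (intro tendsto_intros)
      then show ?case by (rule lim_imp_Liminf[OF trivial_limit_sequentially, symmetric])
    qed
    then have "(\<integral>\<^sup>+x. ennreal ((norm (g x - f k x))\<^sup>2) \<partial>lebesgue) =
        (\<integral>\<^sup>+x. liminf (\<lambda>m. ennreal ((norm (f m x - f k x))\<^sup>2)) \<partial>lebesgue)"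
      by (rule nn_integral_cong_AE)
    also have "\<dots> \<le> liminf (\<lambda>m. \<integral>\<^sup>+x. ennreal ((norm (f m x - f k x))\<^sup>2) \<partial>lebesgue)"
      by (rule nn_integral_liminf) measurable
    also have "\<dots> = liminf (\<lambda>m. ennreal ((norm (X (s m) - X (s k)))\<^sup>2))"
      by (simp add: f_def nn_integral_rep_l2_diff)
    also have "\<dots> \<le> liminf (\<lambda>m. ennreal (((1/2) ^ k)\<^sup>2))"
    proof (rule Liminf_mono, rule eventually_mono[OF eventually_ge_at_top[of k]], rule ennreal_leI, rule power_mono)
      fix m assume "k \<le> m"
      then show "norm (X (s m) - X (s k)) \<le> (1/2) ^ k"
        using N[of k "s m" "s k"] s_N[of k] strict_mono_leD[OF s_mono, of k m] by (simp add: dist_norm)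
    qed auto
    also have "\<dots> = ennreal (((1/2) ^ k)\<^sup>2)" by (simp add: Liminf_const)
    finally show ?thesis .
  qed
  have "square_integrable lebesgue (\<lambda>x. g x - f 0 x)"
    by (rule square_integrableI_nn) (use g_bound[of 0] in \<open>auto intro: le_less_trans\<close>)
  moreover have "square_integrable lebesgue (f 0)"
    unfolding f_def by (rule square_integrable_rep_l2)
  ultimately have "square_integrable lebesgue (\<lambda>x. g x - f 0 x + f 0 x)"
    by (rule square_integrable_add)
  then have g_sq: "square_integrable lebesgue g" by simp
  define Y where "Y = abs_l2 g"
  have Y: "AE x in lebesgue. rep_l2 Y x = g x" unfolding Y_def by (rule rep_abs_l2_AE[OF g_sq])
  have dist_Y: "norm (Y - X (s k)) \<le> (1/2) ^ k" for k
  proof -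
    have "ennreal ((norm (Y - X (s k)))\<^sup>2) = (\<integral>\<^sup>+x. ennreal ((norm (rep_l2 Y x - f k x))\<^sup>2) \<partial>lebesgue)"
      by (simp add: f_def nn_integral_rep_l2_diff)
    also have "\<dots> = (\<integral>\<^sup>+x. ennreal ((norm (g x - f k x))\<^sup>2) \<partial>lebesgue)"
      by (rule nn_integral_cong_AE) (use Y in \<open>eventually_elim, simp\<close>)
    also note g_bound[of k]
    finally have "(norm (Y - X (s k)))\<^sup>2 \<le> ((1/2) ^ k)\<^sup>2"
      by (subst (asm) ennreal_le_iff) auto
    then show ?thesis by (rule power2_le_imp_le) simp
  qed
  have "(\<lambda>k. X (s k)) \<longlonglongrightarrow> Y"
  proof (rule LIM_zero_cancel)
    show "(\<lambda>k. X (s k) - Y) \<longlonglongrightarrow> 0"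
      by (rule Lim_null_comparison[of _ "\<lambda>k. (1/2) ^ k"])
        (use dist_Y in \<open>auto simp: norm_minus_commute intro!: LIMSEQ_realpow_zero\<close>)
  qed
  then have "X \<longlonglongrightarrow> Y"
    using Cauchy_converges_subseq[OF assms s_mono] by (simp add: o_def)
  then show ?thesis by (auto simp: convergent_def)
qed

instance l2 :: (euclidean_space, euclidean_space) banach
  by standard (rule l2_complete)

definition l2_mult :: "('a \<Rightarrow> real) \<Rightarrow> ('a::euclidean_space, 'b::euclidean_space) l2 \<Rightarrow> ('a, 'b) l2" where
  "l2_mult m u = abs_l2 (\<lambda>x. m x *\<^sub>R rep_l2 u x)"

lemma square_integrable_bounded_mult:
  fixes m :: "'a \<Rightarrow> real"
  assumes f: "square_integrable M f" and m: "m \<in> borel_measurable M" "AE x in M. \<bar>m x\<bar> \<le> C"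
  shows "square_integrable M (\<lambda>x. m x *\<^sub>R f x)"
  unfolding square_integrable_def
proof
  show "(\<lambda>x. m x *\<^sub>R f x) \<in> borel_measurable M"
    using f m by (auto simp: square_integrable_def)
  show "integrable M (\<lambda>x. (norm (m x *\<^sub>R f x))\<^sup>2)"
  proof (rule Bochner_Integration.integrable_bound)
    show "integrable M (\<lambda>x. C\<^sup>2 * (norm (f x))\<^sup>2)" using f by (simp add: square_integrable_def)
    show "(\<lambda>x. (norm (m x *\<^sub>R f x))\<^sup>2) \<in> borel_measurable M" using f m by (auto simp: square_integrable_def)
    show "AE x in M. norm ((norm (m x *\<^sub>R f x))\<^sup>2) \<le> norm (C\<^sup>2 * (norm (f x))\<^sup>2)"
      using m(2)
    proof eventually_elim
      case (elim x)
      then have "\<bar>m x\<bar>\<^sup>2 \<le> C\<^sup>2" by (intro power_mono) auto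
      then show ?case by (simp add: power_mult_distrib mult_right_mono)
    qed
  qed
qed

lemma
  fixes u :: "('a::euclidean_space, 'b::euclidean_space) l2"
  assumes m: "m \<in> borel_measurable lebesgue" "\<And>x. \<bar>m x\<bar> \<le> C"
  shows rep_l2_mult: "AE x in lebesgue. rep_l2 (l2_mult m u) x = m x *\<^sub>R rep_l2 u x"
    and bounded_linear_l2_mult: "bounded_linear (l2_mult m :: ('a, 'b) l2 \<Rightarrow> _)"
proof -
  have rep: "AE x in lebesgue. rep_l2 (l2_mult m u) x = m x *\<^sub>R rep_l2 u x" for u :: "('a, 'b) l2"
    unfolding l2_mult_def
    by (intro rep_abs_l2_AE square_integrable_bounded_mult[where C = C] square_integrable_rep_l2 m AE_I2)
  then show "AE x in lebesgue. rep_l2 (l2_mult m u) x = m x *\<^sub>R rep_l2 u x" .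
  have "0 \<le> C" using m(2)[of undefined] abs_ge_zero order_trans by blast
  show "bounded_linear (l2_mult m :: ('a, 'b) l2 \<Rightarrow> _)"
  proof (rule bounded_linear_intro[where K = C])
    fix u v :: "('a, 'b) l2" and c :: real
    show "l2_mult m (u + v) = l2_mult m u + l2_mult m v"
      by (rule l2_eqI)
        (use rep[of "u + v"] rep[of u] rep[of v] rep_l2_add[of u v] rep_l2_add[of "l2_mult m u" "l2_mult m v"] in
          \<open>eventually_elim, simp add: scaleR_add_right\<close>)
    show "l2_mult m (c *\<^sub>R u) = c *\<^sub>R l2_mult m u"
      by (rule l2_eqI)
        (use rep[of "c *\<^sub>R u"] rep[of u] rep_l2_scaleR[of c u] rep_l2_scaleR[of c "l2_mult m u"] in
          \<open>eventually_elim, simp\<close>)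
    have "ennreal ((norm (l2_mult m u))\<^sup>2) = (\<integral>\<^sup>+x. ennreal ((norm (m x *\<^sub>R rep_l2 u x))\<^sup>2) \<partial>lebesgue)"
      unfolding nn_integral_rep_l2[symmetric]
      by (rule nn_integral_cong_AE) (use rep[of u] in \<open>eventually_elim, simp\<close>)
    also have "\<dots> \<le> (\<integral>\<^sup>+x. ennreal (C\<^sup>2) * ennreal ((norm (rep_l2 u x))\<^sup>2) \<partial>lebesgue)"
    proof (rule nn_integral_mono)
      fix x
      have "\<bar>m x\<bar>\<^sup>2 \<le> C\<^sup>2" by (rule power_mono[OF m(2)]) simp
      then show "ennreal ((norm (m x *\<^sub>R rep_l2 u x))\<^sup>2) \<le> ennreal (C\<^sup>2) * ennreal ((norm (rep_l2 u x))\<^sup>2)"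
        by (simp add: power_mult_distrib mult_right_mono flip: ennreal_mult)
    qed
    also have "\<dots> = ennreal ((norm u * C)\<^sup>2)"
      by (simp add: nn_integral_cmult nn_integral_rep_l2 power_mult_distrib ennreal_mult mult.commute)
    finally have "(norm (l2_mult m u))\<^sup>2 \<le> (norm u * C)\<^sup>2"
      by (subst (asm) ennreal_le_iff) auto
    then show "norm (l2_mult m u) \<le> norm u * C"
      by (rule power2_le_imp_le) (use \<open>0 \<le> C\<close> in simp)
  qed
qed

section \<open>Smooth functions of several variables\<close>

definition smooth :: "(real^'n \<Rightarrow> 'b::real_normed_vector) \<Rightarrow> bool" where
  "smooth f \<longleftrightarrow> (\<forall>k. Ck_on k UNIV f)"

lemma Ck_on_SucD: "Ck_on (Suc k) UNIV f \<Longrightarrow> Ck_on k UNIV f"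
proof (induction k arbitrary: f)
  case 0
  then show ?case
    by (auto intro!: continuous_at_imp_continuous_on differentiable_imp_continuous_within)
qed (auto simp del: Ck_on.simps(1))

lemma smooth_iff: "smooth f \<longleftrightarrow> (\<forall>x. f differentiable (at x)) \<and> (\<forall>i. smooth (partial_deriv i f))"
proof
  assume "smooth f"
  then have "Ck_on (Suc k) UNIV f" for k by (simp only: smooth_def)
  then show "(\<forall>x. f differentiable (at x)) \<and> (\<forall>i. smooth (partial_deriv i f))"
    by (auto simp: smooth_def)
next
  assume *: "(\<forall>x. f differentiable (at x)) \<and> (\<forall>i. smooth (partial_deriv i f))"
  then have "Ck_on (Suc k) UNIV f" for k by (auto simp: smooth_def)
  then show "smooth f" unfolding smooth_def using Ck_on_SucD by blast
qed

lemma smooth_differentiable: "smooth f \<Longrightarrow> f differentiable (at x)"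
  and smooth_partial_deriv: "smooth f \<Longrightarrow> smooth (partial_deriv i f)"
  using smooth_iff by blast+

lemma smooth_continuous_on: "smooth f \<Longrightarrow> continuous_on A f"
  by (meson continuous_at_imp_continuous_on differentiable_imp_continuous_within smooth_differentiable)

lemma partial_deriv_eq: "(f has_derivative f') (at x) \<Longrightarrow> partial_deriv i f x = f' (axis i 1)"
  by (simp add: partial_deriv_def flip: frechet_derivative_at)

lemma has_derivative_partial_derivs:
  fixes f :: "real^'n \<Rightarrow> 'b::real_normed_vector"
  assumes "f differentiable (at x)"
  shows "(f has_derivative (\<lambda>h. \<Sum>i\<in>UNIV. h $ i *\<^sub>R partial_deriv i f x)) (at x)"
proof -
  let ?D = "frechet_derivative f (at x)"
  have D: "(f has_derivative ?D) (at x)" using assms by (simp add: frechet_derivative_works)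
  then interpret bounded_linear ?D by (rule has_derivative_bounded_linear)
  have "?D h = (\<Sum>i\<in>UNIV. h $ i *\<^sub>R partial_deriv i f x)" for h
  proof -
    have "?D h = ?D (\<Sum>i\<in>UNIV. h $ i *\<^sub>R axis i 1)"
      using basis_expansion[of h] by (simp add: scalar_mult_eq_scaleR)
    then show ?thesis by (simp add: sum scaleR partial_deriv_def)
  qed
  then have "?D = (\<lambda>h. \<Sum>i\<in>UNIV. h $ i *\<^sub>R partial_deriv i f x)" by blast
  then show ?thesis using D by simp
qed

lemma partial_deriv_const [simp]: "partial_deriv i (\<lambda>x. c) = (\<lambda>x. 0)"
  by (rule ext, rule partial_deriv_eq[THEN trans]) (auto intro: derivative_eq_intros)

lemma smooth_const [simp]: "smooth (\<lambda>x::real^'n. c :: 'b::real_normed_vector)"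
proof -
  have "Ck_on k UNIV (\<lambda>x::real^'n. c)" for k and c :: 'b by (induction k arbitrary: c) auto
  then show ?thesis by (simp add: smooth_def)
qed

lemma partial_deriv_add:
  assumes "f differentiable (at x)" "g differentiable (at x)"
  shows "partial_deriv i (\<lambda>x. f x + g x) x = partial_deriv i f x + partial_deriv i g x"
  using assms by (subst partial_deriv_eq[OF has_derivative_add])
    (auto simp: partial_deriv_def frechet_derivative_works[symmetric])

lemma partial_deriv_scaleR:
  assumes "f differentiable (at x)" "g differentiable (at x)"
  shows "partial_deriv i (\<lambda>x. f x *\<^sub>R g x) x = f x *\<^sub>R partial_deriv i g x + partial_deriv i f x *\<^sub>R g x"
  using assms by (subst partial_deriv_eq[OF has_derivative_scaleR])
    (auto simp: partial_deriv_def frechet_derivative_works[symmetric])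

lemma partial_deriv_linear:
  assumes "f differentiable (at x)" "bounded_linear L"
  shows "partial_deriv i (\<lambda>x. L (f x)) x = L (partial_deriv i f x)"
  using assms by (subst partial_deriv_eq[OF bounded_linear.has_derivative])
    (auto simp: partial_deriv_def frechet_derivative_works[symmetric])

lemma partial_deriv_compose:
  fixes F :: "real \<Rightarrow> real"
  assumes "(F has_real_derivative F') (at (g x))" "g differentiable (at x)"
  shows "partial_deriv i (\<lambda>x. F (g x)) x = F' * partial_deriv i g x"
proof -
  have "((\<lambda>x. F (g x)) has_derivative (\<lambda>h. F' * frechet_derivative g (at x) h)) (at x)"
    using has_derivative_compose[of g _ x UNIV F "(*) F'"] assms
    by (simp add: has_field_derivative_def frechet_derivative_works)
  then have "partial_deriv i (\<lambda>x. F (g x)) x = F' * frechet_derivative g (at x) (axis i 1)"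
    by (rule partial_deriv_eq)
  then show ?thesis by (simp only: partial_deriv_def[of i g])
qed

lemma Ck_on_add:
  "Ck_on k UNIV f \<Longrightarrow> Ck_on k UNIV g \<Longrightarrow> Ck_on k UNIV (\<lambda>x. f x + g x)"
proof (induction k arbitrary: f g)
  case 0
  then show ?case by (auto intro: continuous_intros)
next
  case (Suc k)
  then have "partial_deriv i (\<lambda>x. f x + g x) = (\<lambda>x. partial_deriv i f x + partial_deriv i g x)" for i
    by (intro ext partial_deriv_add) auto
  then show ?case using Suc by auto
qed

lemma Ck_on_scaleR:
  "Ck_on k UNIV f \<Longrightarrow> Ck_on k UNIV g \<Longrightarrow> Ck_on k UNIV (\<lambda>x. f x *\<^sub>R g x)"
proof (induction k arbitrary: f g)
  case 0
  then show ?case by (auto intro: continuous_intros)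
next
  case (Suc k)
  then have "partial_deriv i (\<lambda>x. f x *\<^sub>R g x) = (\<lambda>x. f x *\<^sub>R partial_deriv i g x + partial_deriv i f x *\<^sub>R g x)" for i
    by (intro ext partial_deriv_scaleR) auto
  moreover have "Ck_on k UNIV f" "Ck_on k UNIV g"
    using Suc.prems by (auto intro: Ck_on_SucD simp del: Ck_on.simps)
  ultimately show ?case using Suc by (auto intro!: Ck_on_add)
qed

lemma Ck_on_mult: "Ck_on k UNIV f \<Longrightarrow> Ck_on k UNIV g \<Longrightarrow> Ck_on k UNIV (\<lambda>x. f x * g x :: real)"
  using Ck_on_scaleR[of k f g] by simp

lemma smooth_add: "smooth f \<Longrightarrow> smooth g \<Longrightarrow> smooth (\<lambda>x. f x + g x)"
  by (simp add: smooth_def Ck_on_add)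

lemma smooth_scaleR: "smooth f \<Longrightarrow> smooth g \<Longrightarrow> smooth (\<lambda>x. f x *\<^sub>R g x)"
  by (simp add: smooth_def Ck_on_scaleR)

lemma smooth_mult: "smooth f \<Longrightarrow> smooth g \<Longrightarrow> smooth (\<lambda>x. f x * g x :: real)"
  using smooth_scaleR[of f g] by simp

lemma smooth_sum: "(\<And>i. i \<in> I \<Longrightarrow> smooth (f i)) \<Longrightarrow> smooth (\<lambda>x. \<Sum>i\<in>I. f i x)"
  by (induction I rule: infinite_finite_induct) (auto intro: smooth_add)

lemma smooth_linear:
  fixes f :: "real^'n \<Rightarrow> 'b::real_normed_vector"
  assumes "smooth f" "bounded_linear L"
  shows "smooth (\<lambda>x. L (f x))"
proof -
  have "Ck_on k UNIV f \<Longrightarrow> Ck_on k UNIV (\<lambda>x. L (f x))" for k and f :: "real^'n \<Rightarrow> 'b"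
  proof (induction k arbitrary: f)
    case 0
    then show ?case using assms(2) by (auto intro: bounded_linear.continuous_on)
  next
    case (Suc k)
    then have "partial_deriv i (\<lambda>x. L (f x)) = (\<lambda>x. L (partial_deriv i f x))" for i
      by (intro ext partial_deriv_linear assms(2)) auto
    moreover have "(\<lambda>x. L (f x)) differentiable (at x)" for x
    proof -
      obtain D where "(f has_derivative D) (at x)" using Suc.prems by (auto simp: differentiable_def)
      then have "((\<lambda>x. L (f x)) has_derivative (\<lambda>h. L (D h))) (at x)"
        by (rule bounded_linear.has_derivative[OF assms(2)])
      then show ?thesis by (auto simp: differentiable_def)
    qed
    ultimately show ?case using Suc by auto
  qed
  then show ?thesis using assms by (simp add: smooth_def)
qed

lemma smooth_component: "smooth (\<lambda>x::real^'n. x $ i)"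
proof -
  have "partial_deriv j (\<lambda>x::real^'n. x $ i) = (\<lambda>x. axis j 1 $ i)" for j
    by (rule ext, rule partial_deriv_eq) (intro bounded_linear_imp_has_derivative bounded_linear_vec_nth)
  moreover have "(\<lambda>x::real^'n. x $ i) differentiable (at x)" for x
    by (intro bounded_linear_imp_differentiable bounded_linear_vec_nth)
  ultimately show ?thesis by (subst smooth_iff) simp
qed

lemma smooth_norm_square: "smooth (\<lambda>x::real^'n. (norm x)\<^sup>2)"
proof -
  have "(\<lambda>x::real^'n. (norm x)\<^sup>2) = (\<lambda>x. \<Sum>i\<in>UNIV. x $ i * x $ i)"
    by (simp add: power2_norm_eq_inner inner_vec_def)
  then show ?thesis by (simp add: smooth_sum smooth_mult smooth_component)
qed

text \<open>A set of functions that is closed under differentiation takes the place of formulas for higher derivatives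
of a composition.\<close>

lemma smooth_compose:
  fixes \<F> :: "(real \<Rightarrow> real) set"
  assumes deriv: "\<And>F. F \<in> \<F> \<Longrightarrow> \<exists>F'\<in>\<F>. \<forall>x. (F has_real_derivative F' x) (at x)"
    and g: "smooth g" and F: "F \<in> \<F>"
  shows "smooth (\<lambda>x. F (g x))"
proof -
  have "F \<in> \<F> \<Longrightarrow> Ck_on k UNIV (\<lambda>x. F (g x))" for k F
  proof (induction k arbitrary: F)
    case 0
    then obtain F' where "\<forall>x. (F has_real_derivative F' x) (at x)" using deriv by blast
    then have "continuous_on UNIV F" using DERIV_continuous_on by (metis has_field_derivative_at_within)
    then show ?case
      using continuous_on_compose2[of UNIV F UNIV g] smooth_continuous_on[OF g] by simp
  next
    case (Suc k)
    then obtain F' where F': "F' \<in> \<F>" "\<And>x. (F has_real_derivative F' x) (at x)" using deriv by blast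
    have "partial_deriv i (\<lambda>x. F (g x)) = (\<lambda>x. F' (g x) *\<^sub>R partial_deriv i g x)" for i
      using partial_deriv_compose[OF F'(2) smooth_differentiable[OF g]] by fastforce
    moreover have "Ck_on k UNIV (partial_deriv i g)" for i
      using smooth_partial_deriv[OF g] by (simp add: smooth_def)
    moreover have "(\<lambda>x. F (g x)) differentiable (at x)" for x
      using differentiable_compose[of F g x] F'(2) smooth_differentiable[OF g]
      by (metis real_differentiable_def)
    ultimately show ?case using Suc.IH[OF F'(1)] by (auto intro: Ck_on_mult)
  qed
  then show ?thesis using F by (simp add: smooth_def)
qed

lemma smooth_exp: "smooth g \<Longrightarrow> smooth (\<lambda>x. exp (g x :: real))"
  by (rule smooth_compose[of "{exp}"]) (auto intro: DERIV_exp)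

lemma smooth_reflect_translate:
  fixes \<eta> :: "real^'n \<Rightarrow> 'b::real_normed_vector"
  assumes "smooth \<eta>"
  shows "smooth (\<lambda>y. \<eta> (x - y))"
    and "partial_deriv i (\<lambda>y. \<eta> (x - y)) y = - partial_deriv i \<eta> (x - y)"
proof -
  have hd: "((\<lambda>y. \<eta> (x - y)) has_derivative (\<lambda>h. frechet_derivative \<eta> (at (x - y)) (- h))) (at y)"
    if "smooth \<eta>" for \<eta> :: "real^'n \<Rightarrow> 'b" and y
  proof -
    have "((\<lambda>y. x - y) has_derivative (\<lambda>h. - h)) (at y)"
      by (auto intro!: derivative_eq_intros)
    moreover have "(\<eta> has_derivative frechet_derivative \<eta> (at (x - y))) (at (x - y))"
      using smooth_differentiable[OF that] by (simp add: frechet_derivative_works)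
    ultimately show ?thesis by (rule has_derivative_compose)
  qed
  have pd: "partial_deriv i (\<lambda>y. \<eta> (x - y)) y = - partial_deriv i \<eta> (x - y)"
    if "smooth \<eta>" for \<eta> :: "real^'n \<Rightarrow> 'b" and i y
  proof -
    have "bounded_linear (frechet_derivative \<eta> (at (x - y)))"
      using smooth_differentiable[OF that] frechet_derivative_works has_derivative_bounded_linear by blast
    then show ?thesis
      by (simp add: partial_deriv_eq[OF hd[OF that]] partial_deriv_def linear_neg bounded_linear.linear)
  qed
  then show "partial_deriv i (\<lambda>y. \<eta> (x - y)) y = - partial_deriv i \<eta> (x - y)" using assms by blast
  have "smooth \<eta> \<Longrightarrow> Ck_on k UNIV (\<lambda>y. \<eta> (x - y))" for k and \<eta> :: "real^'n \<Rightarrow> 'b"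
  proof (induction k arbitrary: \<eta>)
    case 0
    have "continuous_on UNIV (\<lambda>y. \<eta> (x - y))"
      by (rule continuous_on_compose2[OF smooth_continuous_on[OF 0, of UNIV]]) (auto intro: continuous_intros)
    then show ?case by simp
  next
    case (Suc k)
    have "smooth (\<lambda>y. - partial_deriv i \<eta> y)" for i
      by (rule smooth_linear[OF smooth_partial_deriv[OF Suc.prems]]) (rule bounded_linear_minus[OF bounded_linear_ident])
    moreover have "partial_deriv i (\<lambda>y. \<eta> (x - y)) = (\<lambda>y. - partial_deriv i \<eta> (x - y))" for i
      using pd[OF Suc.prems] by blast
    moreover have "(\<lambda>y. \<eta> (x - y)) differentiable (at y)" for y
      unfolding differentiable_def using hd[OF Suc.prems] by blast
    ultimately show ?case using Suc.IH by auto
  qed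
  then show "smooth (\<lambda>y. \<eta> (x - y))" using assms by (simp add: smooth_def)
qed

text \<open>Functions \<open>p(1/s) e^(-1/s)\<close> with a polynomial \<open>p\<close>, extended by zero. They are closed under differentiation,
which replaces \<open>p\<close> by \<open>X\<^sup>2 (p - p')\<close>; for \<open>p = 1\<close> this is the standard function that is flat at \<open>0\<close>.\<close>

definition flat_at_zero :: "real poly \<Rightarrow> real \<Rightarrow> real" where
  "flat_at_zero p s = (if 0 < s then poly p (1 / s) * exp (- (1 / s)) else 0)"

lemma poly_mult_exp_minus_tendsto_0: "((\<lambda>t. poly p t * exp (- t)) \<longlongrightarrow> (0::real)) at_top"
proof -
  have "((\<lambda>t. \<Sum>i\<le>degree p. coeff p i * (t ^ i / exp t)) \<longlongrightarrow> (\<Sum>i\<le>degree p. coeff p i * 0)) at_top"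
    by (intro tendsto_intros tendsto_power_div_exp_0)
  then show ?thesis
    by (simp add: poly_altdef sum_distrib_right exp_minus divide_inverse mult.assoc)
qed

lemma flat_at_zero_deriv:
  "(flat_at_zero p has_real_derivative flat_at_zero ([:0, 0, 1:] * (p - pderiv p)) s) (at s)"
proof -
  consider "s < 0" | "s = 0" | "0 < s" by linarith
  then show ?thesis
  proof cases
    case 1
    have "((\<lambda>s. 0) has_real_derivative 0) (at s)" by simp
    then have "(flat_at_zero p has_real_derivative 0) (at s)"
      by (rule has_field_derivative_transform_within_open[of _ _ _ "{..<0}"]) (use 1 in \<open>auto simp: flat_at_zero_def\<close>)
    then show ?thesis using 1 by (simp add: flat_at_zero_def)
  next
    case 3
    have "((\<lambda>s. poly p (1 / s) * exp (- (1 / s))) has_real_derivative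
        poly ([:0, 0, 1:] * (p - pderiv p)) (1 / s) * exp (- (1 / s))) (at s)"
      using 3 by (auto intro!: derivative_eq_intros poly_DERIV[THEN DERIV_chain2] simp: field_simps power2_eq_square)
    then have "(flat_at_zero p has_real_derivative poly ([:0, 0, 1:] * (p - pderiv p)) (1 / s) * exp (- (1 / s))) (at s)"
      by (rule has_field_derivative_transform_within_open[of _ _ _ "{0<..}"]) (use 3 in \<open>auto simp: flat_at_zero_def\<close>)
    then show ?thesis using 3 by (simp add: flat_at_zero_def)
  next
    case 2
    have "((\<lambda>h. flat_at_zero p h / h) \<longlongrightarrow> 0) (at_right 0)"
    proof -
      have "((\<lambda>h. poly ([:0, 1:] * p) (inverse h) * exp (- inverse h)) \<longlongrightarrow> 0) (at_right 0)"
        by (rule filterlim_compose[OF poly_mult_exp_minus_tendsto_0 filterlim_inverse_at_top_right])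
      moreover have "\<forall>\<^sub>F h in at_right 0. poly ([:0, 1:] * p) (inverse h) * exp (- inverse h) = flat_at_zero p h / h"
        using eventually_at_right_less[of "0::real"]
        by eventually_elim (simp add: flat_at_zero_def field_simps)
      ultimately show ?thesis by (rule Lim_transform_eventually)
    qed
    moreover have "((\<lambda>h. flat_at_zero p h / h) \<longlongrightarrow> 0) (at_left 0)"
    proof (rule Lim_transform_eventually[OF tendsto_const])
      show "\<forall>\<^sub>F h in at_left 0. 0 = flat_at_zero p h / h"
        unfolding eventually_at_left_field by (intro exI[of _ "-1"]) (auto simp: flat_at_zero_def)
    qed
    ultimately have "((\<lambda>h. flat_at_zero p h / h) \<longlongrightarrow> 0) (at 0)"
      by (simp add: filterlim_split_at)
    then show ?thesis using 2 by (simp add: DERIV_def flat_at_zero_def)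
  qed
qed

lemma smooth_bump:
  assumes "0 < \<epsilon>"
  obtains \<eta> :: "real^'n \<Rightarrow> real" where "smooth \<eta>" "\<And>x. 0 \<le> \<eta> x" "\<And>x. \<epsilon> \<le> norm x \<Longrightarrow> \<eta> x = 0" "\<And>x. norm x < \<epsilon> \<Longrightarrow> 0 < \<eta> x"
proof
  let ?g = "\<lambda>x::real^'n. \<epsilon>\<^sup>2 + (-1) * (norm x)\<^sup>2"
  let ?\<eta> = "\<lambda>x. flat_at_zero [:1:] (?g x)"
  have g: "smooth ?g" by (intro smooth_add smooth_mult smooth_norm_square smooth_const)
  show "smooth ?\<eta>"
    by (rule smooth_compose[of "range flat_at_zero" ?g "flat_at_zero [:1:]"])
      (use g in \<open>auto intro!: flat_at_zero_deriv\<close>)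
  show "0 \<le> ?\<eta> x" for x by (simp add: flat_at_zero_def)
  show "?\<eta> x = 0" if "\<epsilon> \<le> norm x" for x
    using power_mono[OF that less_imp_le[OF assms], of 2] by (simp add: flat_at_zero_def)
  show "0 < ?\<eta> x" if "norm x < \<epsilon>" for x
    using power_strict_mono[OF that norm_ge_zero, of 2] by (simp add: flat_at_zero_def)
qed

section \<open>Mollification\<close>

lemma uniformly_continuous_of_bounded_support:
  fixes g :: "'a::euclidean_space \<Rightarrow> 'b::real_normed_vector"
  assumes cont: "continuous_on UNIV g" and supp: "\<And>x. R \<le> norm x \<Longrightarrow> g x = 0"
  shows "uniformly_continuous_on UNIV g"
  unfolding uniformly_continuous_on_def
proof (intro allI impI)
  fix e :: real assume e: "0 < e"
  have "uniformly_continuous_on (cball 0 (R + 1)) g"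
    by (intro compact_uniformly_continuous continuous_on_subset[OF cont]) auto
  then obtain d where d: "0 < d" "\<And>x y. norm x \<le> R + 1 \<Longrightarrow> norm y \<le> R + 1 \<Longrightarrow> dist y x < d \<Longrightarrow> dist (g y) (g x) < e"
    unfolding uniformly_continuous_on_def using e by (auto simp: dist_norm)
  show "\<exists>d>0. \<forall>x\<in>UNIV. \<forall>y\<in>UNIV. dist y x < d \<longrightarrow> dist (g y) (g x) < e"
  proof (intro exI[of _ "min d 1"] conjI ballI impI)
    fix x y :: 'a assume xy: "dist y x < min d 1"
    then have n: "norm x \<le> norm y + 1" "norm y \<le> norm x + 1"
      using norm_triangle_ineq2[of x y] norm_triangle_ineq2[of y x] by (auto simp: dist_norm norm_minus_commute)
    show "dist (g y) (g x) < e"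
    proof (cases "norm x \<le> R + 1 \<and> norm y \<le> R + 1")
      case False
      then have "R \<le> norm x" "R \<le> norm y" using n by auto
      then show ?thesis using e supp by simp
    qed (use d xy in auto)
  qed (use d in auto)
qed

lemma bounded_of_bounded_support:
  fixes g :: "'a::euclidean_space \<Rightarrow> 'b::real_normed_vector"
  assumes cont: "continuous_on UNIV g" and supp: "\<And>x. R \<le> norm x \<Longrightarrow> g x = 0"
  obtains C where "0 \<le> C" "\<And>x. norm (g x) \<le> C"
proof -
  have "bounded (g ` cball 0 R)"
    by (intro compact_imp_bounded compact_continuous_image continuous_on_subset[OF cont]) auto
  then obtain C where C: "\<And>x. norm x \<le> R \<Longrightarrow> norm (g x) \<le> C"
    unfolding bounded_iff by (metis image_eqI mem_cball_0)
  show ?thesis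
  proof (rule that[of "max C 0"])
    show "norm (g x) \<le> max C 0" for x
      using C[of x] supp[of x] by (cases "norm x \<le> R") auto
  qed simp
qed

lemma partial_deriv_support:
  fixes \<eta> :: "real^'n \<Rightarrow> 'b::real_normed_vector"
  assumes supp: "\<And>x. R \<le> norm x \<Longrightarrow> \<eta> x = 0" and x: "R + 1 \<le> norm x"
  shows "partial_deriv i \<eta> x = 0"
proof -
  have "open {x::real^'n. R < norm x}"
    by (intro open_Collect_less continuous_intros)
  then have "(\<eta> has_derivative (\<lambda>h. 0)) (at x)"
    by (rule has_derivative_transform_within_open[OF has_derivative_const[of 0]]) (use x supp in auto)
  then show ?thesis by (simp add: partial_deriv_eq)
qed

text \<open>The derivatives of a function of bounded support are uniformly continuous, so the linear approximation is
uniform in the base point. This is what allows differentiation of a convolution with a merely integrable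
function.\<close>

lemma smooth_uniform_linearization:
  fixes \<eta> :: "real^'n \<Rightarrow> real"
  assumes \<eta>: "smooth \<eta>" and supp: "\<And>x. R \<le> norm x \<Longrightarrow> \<eta> x = 0" and e: "0 < e"
  obtains d where "0 < d" "\<And>z h. norm h < d \<Longrightarrow>
    \<bar>\<eta> (z + h) - \<eta> z - (\<Sum>i\<in>UNIV. h $ i * partial_deriv i \<eta> z)\<bar> \<le> e * norm h"
proof -
  define e' where "e' = e / real CARD('n)"
  have e': "0 < e'" using e by (simp add: e'_def)
  have "\<forall>i. \<exists>d>0. \<forall>x y. dist y x < d \<longrightarrow> dist (partial_deriv i \<eta> y) (partial_deriv i \<eta> x) < e'"
  proof
    fix i
    have "uniformly_continuous_on UNIV (partial_deriv i \<eta>)"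
      by (rule uniformly_continuous_of_bounded_support[of _ "R + 1"])
        (use smooth_partial_deriv[OF \<eta>] smooth_continuous_on partial_deriv_support[OF supp] in auto)
    then show "\<exists>d>0. \<forall>x y. dist y x < d \<longrightarrow> dist (partial_deriv i \<eta> y) (partial_deriv i \<eta> x) < e'"
      using e' unfolding uniformly_continuous_on_def by simp
  qed
  then obtain D where D: "\<And>i. 0 < D i" "\<And>i x y. dist y x < D i \<Longrightarrow> dist (partial_deriv i \<eta> y) (partial_deriv i \<eta> x) < e'"
    by metis
  define d where "d = Min (range D)"
  have d: "0 < d" using D(1) by (simp add: d_def)
  have dD: "d \<le> D i" for i by (simp add: d_def)
  show ?thesis
  proof (rule that[OF d])
    fix z h :: "real^'n" assume h: "norm h < d"
    define g where "g k = \<eta> (z + k) - (\<Sum>i\<in>UNIV. k $ i * partial_deriv i \<eta> z)" for k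
    have g_deriv: "(g has_derivative (\<lambda>l. \<Sum>i\<in>UNIV. l $ i * (partial_deriv i \<eta> (z + k) - partial_deriv i \<eta> z))) (at k within ball 0 d)" for k
    proof (rule has_derivative_at_withinI)
      have "((\<lambda>k. z + k) has_derivative (\<lambda>l. l)) (at k)" by (auto intro!: derivative_eq_intros)
      then have 1: "((\<lambda>k. \<eta> (z + k)) has_derivative (\<lambda>l. \<Sum>i\<in>UNIV. l $ i *\<^sub>R partial_deriv i \<eta> (z + k))) (at k)"
        by (rule has_derivative_compose) (rule has_derivative_partial_derivs[OF smooth_differentiable[OF \<eta>]])
      have 2: "((\<lambda>k. \<Sum>i\<in>UNIV. k $ i * partial_deriv i \<eta> z) has_derivative (\<lambda>l. \<Sum>i\<in>UNIV. l $ i * partial_deriv i \<eta> z)) (at k)"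
        by (intro has_derivative_sum has_derivative_mult_left bounded_linear_imp_has_derivative bounded_linear_vec_nth)
      show "(g has_derivative (\<lambda>l. \<Sum>i\<in>UNIV. l $ i * (partial_deriv i \<eta> (z + k) - partial_deriv i \<eta> z))) (at k)"
        unfolding g_def
        by (rule has_derivative_eq_rhs[OF has_derivative_diff[OF 1 2]])
          (simp add: fun_eq_iff right_diff_distrib sum_subtractf)
    qed
    have "norm (g h - g 0) \<le> e * norm (h - 0)"
    proof (rule differentiable_bound[OF convex_ball g_deriv])
      fix k :: "real^'n" assume k: "k \<in> ball 0 d"
      show "onorm (\<lambda>l. \<Sum>i\<in>UNIV. l $ i * (partial_deriv i \<eta> (z + k) - partial_deriv i \<eta> z)) \<le> e"
      proof (rule onorm_bound)
        fix l :: "real^'n"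
        have "norm (\<Sum>i\<in>UNIV. l $ i * (partial_deriv i \<eta> (z + k) - partial_deriv i \<eta> z)) \<le> (\<Sum>i\<in>(UNIV::'n set). norm l * e')"
        proof (rule sum_norm_le)
          fix i :: 'n
          have "dist (z + k) z < D i" using k dD[of i] by (simp add: dist_norm)
          then have "dist (partial_deriv i \<eta> (z + k)) (partial_deriv i \<eta> z) < e'" by (rule D(2))
          then show "norm (l $ i * (partial_deriv i \<eta> (z + k) - partial_deriv i \<eta> z)) \<le> norm l * e'"
            using component_le_norm_cart[of l i] by (simp add: abs_mult dist_real_def mult_mono)
        qed
        also have "\<dots> = e * norm l" by (simp add: e'_def)
        finally show "norm (\<Sum>i\<in>UNIV. l $ i * (partial_deriv i \<eta> (z + k) - partial_deriv i \<eta> z)) \<le> e * norm l" .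
      qed (use e in simp)
    qed (use h d in auto)
    then show "\<bar>\<eta> (z + h) - \<eta> z - (\<Sum>i\<in>UNIV. h $ i * partial_deriv i \<eta> z)\<bar> \<le> e * norm h"
      by (simp add: g_def algebra_simps)
  qed
qed

definition conv :: "(real^'n \<Rightarrow> real) \<Rightarrow> (real^'n \<Rightarrow> real) \<Rightarrow> real^'n \<Rightarrow> real" where
  "conv f \<eta> x = (LINT y|lebesgue. \<eta> (x - y) * f y)"

lemma continuous_imp_lebesgue_measurable:
  "continuous_on UNIV g \<Longrightarrow> g \<in> borel_measurable lebesgue"
  using borel_measurable_continuous_onI[of g] by (intro measurable_completion) simp

lemma continuous_reflect_measurable:
  fixes \<eta> :: "real^'n \<Rightarrow> real"
  assumes "continuous_on UNIV \<eta>"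
  shows "(\<lambda>y. \<eta> (x - y)) \<in> borel_measurable lebesgue"
proof -
  have "continuous_on UNIV (\<lambda>y. \<eta> (x - y))"
    by (rule continuous_on_compose2[OF assms]) (auto intro: continuous_intros)
  then have "(\<lambda>y. \<eta> (x - y)) \<in> borel_measurable borel" by (rule borel_measurable_continuous_onI)
  then show ?thesis by (intro measurable_completion) simp
qed

lemma conv_integrable:
  fixes f \<eta> :: "real^'n \<Rightarrow> real"
  assumes f: "integrable lebesgue f" and \<eta>: "continuous_on UNIV \<eta>" "\<And>x. R \<le> norm x \<Longrightarrow> \<eta> x = 0"
  shows "integrable lebesgue (\<lambda>y. \<eta> (x - y) * f y)"
proof -
  obtain C where C: "0 \<le> C" "\<And>x. norm (\<eta> x) \<le> C" using bounded_of_bounded_support[OF \<eta>] by blast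
  show ?thesis
  proof (rule Bochner_Integration.integrable_bound)
    show "integrable lebesgue (\<lambda>y. C * f y)" using f by simp
    show "(\<lambda>y. \<eta> (x - y) * f y) \<in> borel_measurable lebesgue"
      using continuous_reflect_measurable[OF \<eta>(1)] borel_measurable_integrable[OF f] by (rule borel_measurable_times)
    show "AE y in lebesgue. norm (\<eta> (x - y) * f y) \<le> norm (C * f y)"
      using C by (auto simp: abs_mult intro!: mult_right_mono)
  qed
qed

lemma conv_has_derivative:
  fixes f \<eta> :: "real^'n \<Rightarrow> real"
  assumes f: "integrable lebesgue f" and \<eta>: "smooth \<eta>" and supp: "\<And>x. R \<le> norm x \<Longrightarrow> \<eta> x = 0"
  shows "(conv f \<eta> has_derivative (\<lambda>h. \<Sum>i\<in>UNIV. h $ i * conv f (partial_deriv i \<eta>) x)) (at x)"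
  unfolding has_derivative_at_alt
proof (intro conjI allI impI)
  show "bounded_linear (\<lambda>h. \<Sum>i\<in>UNIV. h $ i * conv f (partial_deriv i \<eta>) x)"
    by (intro bounded_linear_sum bounded_linear_mult_const bounded_linear_vec_nth)
  fix e :: real assume e: "0 < e"
  define I where "I = (LINT y|lebesgue. \<bar>f y\<bar>)"
  have I: "0 \<le> I" by (simp add: I_def)
  obtain d where d: "0 < d" "\<And>z h. norm h < d \<Longrightarrow>
    \<bar>\<eta> (z + h) - \<eta> z - (\<Sum>i\<in>UNIV. h $ i * partial_deriv i \<eta> z)\<bar> \<le> e / (I + 1) * norm h"
    using smooth_uniform_linearization[OF \<eta> supp, of R "e / (I + 1)"] e I by auto
  have int: "integrable lebesgue (\<lambda>y. \<eta> (z - y) * f y)" for z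
    by (rule conv_integrable[OF f smooth_continuous_on[OF \<eta>] supp])
  have int': "integrable lebesgue (\<lambda>y. partial_deriv i \<eta> (x - y) * f y)" for i
    by (rule conv_integrable[OF f smooth_continuous_on[OF smooth_partial_deriv[OF \<eta>]] partial_deriv_support[OF supp]])
  show "\<exists>d>0. \<forall>z. norm (z - x) < d \<longrightarrow>
      norm (conv f \<eta> z - conv f \<eta> x - (\<Sum>i\<in>UNIV. (z - x) $ i * conv f (partial_deriv i \<eta>) x)) \<le> e * norm (z - x)"
  proof (intro exI[of _ d] conjI d allI impI)
    fix z assume z: "norm (z - x) < d"
    define h where "h = z - x"
    let ?r = "\<lambda>y. \<eta> (x - y + h) - \<eta> (x - y) - (\<Sum>i\<in>UNIV. h $ i * partial_deriv i \<eta> (x - y))"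
    have zh: "x - y + h = z - y" for y by (simp add: h_def)
    have int_r: "integrable lebesgue (\<lambda>y. ?r y * f y)"
      using int[of z] int[of x] int'
      by (simp add: zh left_diff_distrib sum_distrib_right mult.assoc)
    have eq: "conv f \<eta> z - conv f \<eta> x - (\<Sum>i\<in>UNIV. h $ i * conv f (partial_deriv i \<eta>) x) = (LINT y|lebesgue. ?r y * f y)"
      using int[of z] int[of x] int'
      by (simp add: conv_def zh left_diff_distrib sum_distrib_right mult.assoc)
    have "norm (LINT y|lebesgue. ?r y * f y) \<le> (LINT y|lebesgue. norm (?r y * f y))"
      by (rule integral_norm_bound)
    also have "\<dots> \<le> (LINT y|lebesgue. (e / (I + 1) * norm h) * \<bar>f y\<bar>)"
    proof (rule integral_mono)
      show "integrable lebesgue (\<lambda>y. norm (?r y * f y))" by (rule integrable_norm[OF int_r])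
      show "integrable lebesgue (\<lambda>y. (e / (I + 1) * norm h) * \<bar>f y\<bar>)"
        by (intro integrable_mult_right integrable_abs f)
      fix y
      have "\<bar>?r y\<bar> \<le> e / (I + 1) * norm h" by (rule d(2)) (use z in \<open>simp add: h_def\<close>)
      then show "norm (?r y * f y) \<le> (e / (I + 1) * norm h) * \<bar>f y\<bar>"
        unfolding real_norm_def abs_mult by (rule mult_right_mono) simp
    qed
    also have "\<dots> = e * norm h * (I / (I + 1))" by (simp add: I_def)
    also have "\<dots> \<le> e * norm h * 1"
      using e I by (intro mult_left_mono) auto
    finally show "norm (conv f \<eta> z - conv f \<eta> x - (\<Sum>i\<in>UNIV. (z - x) $ i * conv f (partial_deriv i \<eta>) x)) \<le> e * norm (z - x)"
      unfolding h_def[symmetric] eq by simp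
  qed
qed

lemma
  fixes f \<eta> :: "real^'n \<Rightarrow> real"
  assumes f: "integrable lebesgue f" and \<eta>: "smooth \<eta>" and supp: "\<And>x. R \<le> norm x \<Longrightarrow> \<eta> x = 0"
  shows partial_deriv_conv: "partial_deriv i (conv f \<eta>) = conv f (partial_deriv i \<eta>)"
    and smooth_conv: "smooth (conv f \<eta>)"
proof -
  have pd: "partial_deriv i (conv f \<eta>) = conv f (partial_deriv i \<eta>)"
    if \<eta>: "smooth \<eta>" and supp: "\<And>x. R \<le> norm x \<Longrightarrow> \<eta> x = 0" for i \<eta> R
  proof
    fix x
    have "partial_deriv i (conv f \<eta>) x = (\<Sum>j\<in>UNIV. axis i 1 $ j * conv f (partial_deriv j \<eta>) x)"
      by (rule partial_deriv_eq[OF conv_has_derivative[OF f that]])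
    also have "\<dots> = conv f (partial_deriv i \<eta>) x"
      by (simp add: axis_def if_distrib[of "\<lambda>x. x * _"] cong: if_cong)
    finally show "partial_deriv i (conv f \<eta>) x = conv f (partial_deriv i \<eta>) x" .
  qed
  then show "partial_deriv i (conv f \<eta>) = conv f (partial_deriv i \<eta>)" using \<eta> supp by blast
  have "Ck_on k UNIV (conv f \<eta>)" if \<eta>: "smooth \<eta>" and supp: "\<And>x. R \<le> norm x \<Longrightarrow> \<eta> x = 0" for k \<eta> R
    using that
  proof (induction k arbitrary: \<eta> R)
    case 0
    then show ?case
      using has_derivative_continuous[OF conv_has_derivative[OF f 0]] by (auto intro: continuous_at_imp_continuous_on)
  next
    case (Suc k)
    have "conv f \<eta> differentiable (at x)" for x
      using conv_has_derivative[OF f Suc.prems] by (auto simp: differentiable_def)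
    moreover have "Ck_on k UNIV (conv f (partial_deriv i \<eta>))" for i
      by (rule Suc.IH[OF smooth_partial_deriv[OF Suc.prems(1)] partial_deriv_support[OF Suc.prems(2)]])
    ultimately show ?case by (simp add: pd[OF Suc.prems])
  qed
  then show "smooth (conv f \<eta>)" using \<eta> supp by (auto simp: smooth_def)
qed

definition mollifier :: "real \<Rightarrow> (real^'n \<Rightarrow> real) \<Rightarrow> bool" where
  "mollifier \<epsilon> \<eta> \<longleftrightarrow> smooth \<eta> \<and> (\<forall>x. 0 \<le> \<eta> x) \<and> (\<forall>x. \<epsilon> \<le> norm x \<longrightarrow> \<eta> x = 0) \<and>
    integrable lborel \<eta> \<and> (LINT x|lborel. \<eta> x) = 1"

lemma integrable_bounded_support:
  fixes g :: "real^'n \<Rightarrow> real"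
  assumes cont: "continuous_on UNIV g" and supp: "\<And>x. R \<le> norm x \<Longrightarrow> g x = 0"
  shows "integrable lborel g"
proof -
  have "integrable lborel (\<lambda>x. indicator (cball 0 R) x *\<^sub>R g x)"
    by (intro borel_integrable_compact continuous_on_subset[OF cont]) auto
  moreover have "(\<lambda>x. indicator (cball 0 R) x *\<^sub>R g x) = g"
    using supp by (fastforce simp: indicator_def)
  ultimately show ?thesis by (simp only:)
qed

lemma mollifier_exists:
  assumes "0 < \<epsilon>"
  obtains \<eta> :: "real^'n \<Rightarrow> real" where "mollifier \<epsilon> \<eta>"
proof -
  obtain \<phi> :: "real^'n \<Rightarrow> real" where \<phi>: "smooth \<phi>" "\<And>x. 0 \<le> \<phi> x" "\<And>x. \<epsilon> \<le> norm x \<Longrightarrow> \<phi> x = 0" "\<And>x. norm x < \<epsilon> \<Longrightarrow> 0 < \<phi> x"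
    using smooth_bump[OF assms] by blast
  have int: "integrable lborel \<phi>"
    by (rule integrable_bounded_support[OF smooth_continuous_on[OF \<phi>(1)] \<phi>(3)])
  define c where "c = (LINT x|lborel. \<phi> x)"
  have "c \<noteq> 0"
  proof
    assume "c = 0"
    then have "AE x in lborel. \<phi> x = 0"
      using integral_nonneg_eq_0_iff_AE[OF int] \<phi>(2) by (simp add: c_def)
    then have "AE x::real^'n in lborel. x \<notin> ball 0 \<epsilon>"
    proof eventually_elim
      case (elim x)
      then show ?case using \<phi>(4)[of x] by auto
    qed
    then have "ball 0 \<epsilon> \<in> null_sets (lebesgue :: (real^'n) measure)"
      by (subst AE_iff_null_sets) (auto intro: AE_completion)
    then have "negligible (ball 0 \<epsilon> :: (real^'n) set)" by (simp add: negligible_iff_null_sets)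
    then show False
      using open_not_negligible[of "ball 0 \<epsilon> :: (real^'n) set"] assms by simp
  qed
  moreover have "0 \<le> c" using \<phi>(2) by (simp add: c_def)
  ultimately have c: "0 < c" by simp
  have "mollifier \<epsilon> (\<lambda>x. inverse c * \<phi> x)"
    using \<phi> c int by (auto simp: mollifier_def c_def[symmetric] intro!: smooth_mult)
  then show ?thesis by (rule that)
qed

lemma
  fixes \<eta> :: "real^'n \<Rightarrow> real"
  assumes [measurable]: "\<eta> \<in> borel_measurable borel"
  shows integral_lborel_reflect: "(LINT y|lborel. \<eta> (x - y)) = (LINT y|lborel. \<eta> y)"
    and integrable_lborel_reflect: "integrable lborel \<eta> \<Longrightarrow> integrable lborel (\<lambda>y. \<eta> (x - y))"
proof -
  have d: "distr lborel borel (\<lambda>y. x - y) = (lborel :: (real^'n) measure)"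
    by (subst (2) lborel_affine[of "-1" x]) (auto simp: density_1)
  have "(LINT y|distr lborel borel (\<lambda>y. x - y). \<eta> y) = (LINT y|lborel. \<eta> (x - y))"
    by (rule integral_distr) simp_all
  then show "(LINT y|lborel. \<eta> (x - y)) = (LINT y|lborel. \<eta> y)" by (simp add: d)
  show "integrable lborel (\<lambda>y. \<eta> (x - y))" if "integrable lborel \<eta>"
    using integrable_distr_eq[of "\<lambda>y. x - y" lborel borel \<eta>] that by (simp add: d)
qed

lemma mollifierD:
  assumes "mollifier \<epsilon> \<eta>"
  shows "smooth \<eta>" "0 \<le> \<eta> x" "\<epsilon> \<le> norm x \<Longrightarrow> \<eta> x = 0" "continuous_on UNIV \<eta>" "\<eta> \<in> borel_measurable borel"
    "integrable lborel \<eta>"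
    "integrable lebesgue (\<lambda>y. \<eta> (x - y))" "(LINT y|lebesgue. \<eta> (x - y)) = 1"
proof -
  show *: "smooth \<eta>" "0 \<le> \<eta> x" "\<epsilon> \<le> norm x \<Longrightarrow> \<eta> x = 0" "integrable lborel \<eta>" using assms by (auto simp: mollifier_def)
  show c: "continuous_on UNIV \<eta>" by (rule smooth_continuous_on[OF *(1)])
  then show m[measurable]: "\<eta> \<in> borel_measurable borel" by (rule borel_measurable_continuous_onI)
  show "integrable lebesgue (\<lambda>y. \<eta> (x - y))"
    by (subst integrable_completion) (auto intro: integrable_lborel_reflect *)
  show "(LINT y|lebesgue. \<eta> (x - y)) = 1"
    by (subst integral_completion) (use assms in \<open>auto simp: integral_lborel_reflect mollifier_def\<close>)
qed

lemma conv_bounded: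
  assumes \<eta>: "mollifier \<epsilon> \<eta>" and f: "integrable lebesgue f" "AE x in lebesgue. \<bar>f x\<bar> \<le> C"
  shows "\<bar>conv f \<eta> x\<bar> \<le> C"
proof -
  note D = mollifierD[OF \<eta>]
  have int: "integrable lebesgue (\<lambda>y. \<eta> (x - y) * f y)"
    by (rule conv_integrable[OF f(1) D(4) D(3)])
  have "\<bar>conv f \<eta> x\<bar> \<le> (LINT y|lebesgue. \<bar>\<eta> (x - y) * f y\<bar>)"
    unfolding conv_def using integral_norm_bound[of lebesgue "\<lambda>y. \<eta> (x - y) * f y"] by simp
  also have "\<dots> \<le> (LINT y|lebesgue. \<eta> (x - y) * C)"
  proof (rule integral_mono_AE)
    show "AE y in lebesgue. \<bar>\<eta> (x - y) * f y\<bar> \<le> \<eta> (x - y) * C"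
      using f(2) by eventually_elim (simp add: abs_mult D(2) mult_left_mono)
  qed (use int D(7) in auto)
  also have "\<dots> = C" using D(8) by simp
  finally show ?thesis .
qed

lemma conv_diff:
  assumes "mollifier \<epsilon> \<eta>" "integrable lebesgue f" "integrable lebesgue g"
  shows "conv (\<lambda>x. f x - g x) \<eta> x = conv f \<eta> x - conv g \<eta> x"
  unfolding conv_def right_diff_distrib
  by (intro Bochner_Integration.integral_diff conv_integrable[OF _ mollifierD(4)[OF assms(1)] mollifierD(3)[OF assms(1)]] assms)

text \<open>Tonelli's theorem, applied to a Borel version of \<open>f\<close> because the integrand has to be measurable on the product
space.\<close>

lemma conv_nn_integral_le:
  assumes \<eta>: "mollifier \<epsilon> \<eta>" and f: "integrable lebesgue f"
  shows "(\<integral>\<^sup>+x. ennreal \<bar>conv f \<eta> x\<bar> \<partial>lebesgue) \<le> (\<integral>\<^sup>+x. ennreal \<bar>f x\<bar> \<partial>lebesgue)"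
proof -
  note D = mollifierD[OF \<eta>]
  note [measurable] = D(5)
  obtain f' where f'[measurable]: "f' \<in> borel_measurable lborel" and ae: "AE x in lborel. f x = f' x"
    using completion_ex_borel_measurable_real[OF borel_measurable_integrable[OF f]] by blast
  have "conv f \<eta> x = (LINT y|lborel. \<eta> (x - y) * f' y)" for x
  proof -
    have "conv f \<eta> x = (LINT y|lebesgue. \<eta> (x - y) * f' y)"
      unfolding conv_def
    proof (rule integral_cong_AE)
      show "(\<lambda>y. \<eta> (x - y) * f y) \<in> borel_measurable lebesgue"
        using conv_integrable[OF f D(4) D(3)] by (rule borel_measurable_integrable)
      show "(\<lambda>y. \<eta> (x - y) * f' y) \<in> borel_measurable lebesgue"
        by (rule measurable_completion) measurable
      show "AE y in lebesgue. \<eta> (x - y) * f y = \<eta> (x - y) * f' y"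
        using AE_completion[OF ae] by eventually_elim simp
    qed
    then show ?thesis by (subst (asm) integral_completion) auto
  qed
  then have "(\<integral>\<^sup>+x. ennreal \<bar>conv f \<eta> x\<bar> \<partial>lebesgue) = (\<integral>\<^sup>+x. ennreal \<bar>LINT y|lborel. \<eta> (x - y) * f' y\<bar> \<partial>lborel)"
    by (simp add: nn_integral_completion)
  also have "\<dots> \<le> (\<integral>\<^sup>+x. (\<integral>\<^sup>+y. ennreal (\<eta> (x - y) * \<bar>f' y\<bar>) \<partial>lborel) \<partial>lborel)"
  proof (rule nn_integral_mono)
    fix x
    show "ennreal \<bar>LINT y|lborel. \<eta> (x - y) * f' y\<bar> \<le> (\<integral>\<^sup>+y. ennreal (\<eta> (x - y) * \<bar>f' y\<bar>) \<partial>lborel)"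
    proof (cases "integrable lborel (\<lambda>y. \<eta> (x - y) * f' y)")
      case True
      then show ?thesis
        using integral_norm_bound_ennreal[OF True] D(2) by (simp add: abs_mult)
    qed (simp add: not_integrable_integral_eq)
  qed
  also have "\<dots> = (\<integral>\<^sup>+y. (\<integral>\<^sup>+x. ennreal (\<eta> (x - y) * \<bar>f' y\<bar>) \<partial>lborel) \<partial>lborel)"
    by (rule lborel_pair.Fubini'[symmetric]) measurable
  also have "\<dots> = (\<integral>\<^sup>+y. ennreal \<bar>f' y\<bar> \<partial>lborel)"
  proof (rule nn_integral_cong)
    fix y
    have "(\<integral>\<^sup>+x. ennreal (\<eta> (x - y)) \<partial>lborel) = (\<integral>\<^sup>+x. ennreal (\<eta> (- y + x)) \<partial>lborel)"
      by simp
    also have "\<dots> = (\<integral>\<^sup>+x. ennreal (\<eta> x) \<partial>distr lborel borel ((+) (- y)))"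
      by (rule nn_integral_distr[symmetric]) measurable
    also have "\<dots> = (\<integral>\<^sup>+x. ennreal (\<eta> x) \<partial>lborel)"
      by (simp only: lborel_distr_plus)
    also have "\<dots> = ennreal (LINT x|lborel. \<eta> x)"
      by (rule nn_integral_eq_integral[OF D(6)]) (simp add: D(2))
    also have "\<dots> = 1" using \<eta> by (simp add: mollifier_def)
    finally show "(\<integral>\<^sup>+x. ennreal (\<eta> (x - y) * \<bar>f' y\<bar>) \<partial>lborel) = ennreal \<bar>f' y\<bar>"
      by (simp add: ennreal_mult' D(2) nn_integral_multc)
  qed
  also have "\<dots> = (\<integral>\<^sup>+y. ennreal \<bar>f y\<bar> \<partial>lebesgue)"
    unfolding nn_integral_completion by (rule nn_integral_cong_AE) (use ae in \<open>eventually_elim, simp\<close>)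
  finally show ?thesis .
qed

lemma
  assumes \<eta>: "mollifier \<epsilon> \<eta>" and f: "integrable lebesgue f"
  shows integrable_conv: "integrable lebesgue (conv f \<eta>)"
    and integral_abs_conv_le: "(LINT x|lebesgue. \<bar>conv f \<eta> x\<bar>) \<le> (LINT x|lebesgue. \<bar>f x\<bar>)"
proof -
  have m: "conv f \<eta> \<in> borel_measurable lebesgue"
    by (intro continuous_imp_lebesgue_measurable smooth_continuous_on
        smooth_conv[OF f mollifierD(1)[OF \<eta>] mollifierD(3)[OF \<eta>]])
  have eq: "(\<integral>\<^sup>+x. ennreal \<bar>f x\<bar> \<partial>lebesgue) = ennreal (LINT x|lebesgue. \<bar>f x\<bar>)"
    using f by (intro nn_integral_eq_integral) auto
  then show int: "integrable lebesgue (conv f \<eta>)"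
    using conv_nn_integral_le[OF assms] m by (auto simp: integrable_iff_bounded intro: le_less_trans)
  have "(\<integral>\<^sup>+x. ennreal \<bar>conv f \<eta> x\<bar> \<partial>lebesgue) = ennreal (LINT x|lebesgue. \<bar>conv f \<eta> x\<bar>)"
    using int by (intro nn_integral_eq_integral) auto
  then show "(LINT x|lebesgue. \<bar>conv f \<eta> x\<bar>) \<le> (LINT x|lebesgue. \<bar>f x\<bar>)"
    using conv_nn_integral_le[OF assms] eq by (simp add: ennreal_le_iff)
qed

text \<open>Truncating the values of \<open>f\<close> and cutting off far away changes \<open>f\<close> little in \<open>L\<^sup>1\<close>. A measurable function is
almost everywhere a limit of continuous functions; after the same truncation and cutoff these converge by
domination.\<close>

lemma integrable_approx_continuous:
  fixes f :: "real^'n \<Rightarrow> real"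
  assumes f: "integrable lebesgue f" and e: "0 < e"
  obtains g R where "continuous_on UNIV g" "\<And>x. R \<le> norm x \<Longrightarrow> g x = 0" "(LINT x|lebesgue. \<bar>f x - g x\<bar>) < e"
proof -
  note fm[measurable] = borel_measurable_integrable[OF f]
  define clamp where "clamp n t = max (- real n) (min (real n) t)" for n :: nat and t
  define cut where "cut n x = max 0 (min 1 (real (Suc n) - norm x))" for n :: nat and x :: "real^'n"
  define F where "F n x = cut n x * clamp n (f x)" for n x
  have clamp_le: "\<bar>clamp n t\<bar> \<le> \<bar>t\<bar>" "\<bar>clamp n t\<bar> \<le> real n" for n t by (auto simp: clamp_def)
  have cut_bound: "0 \<le> cut n x" "cut n x \<le> 1" for n x by (auto simp: cut_def)
  have cut_cont: "continuous_on UNIV (cut n)" for n unfolding cut_def by (intro continuous_intros)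
  have [measurable]: "cut n \<in> borel_measurable lebesgue" for n
    by (rule continuous_imp_lebesgue_measurable[OF cut_cont])
  have F_m[measurable]: "F n \<in> borel_measurable lebesgue" for n
    unfolding F_def clamp_def by measurable
  have F_le: "\<bar>F n x\<bar> \<le> \<bar>f x\<bar>" for n x
  proof -
    have "\<bar>cut n x\<bar> * \<bar>clamp n (f x)\<bar> \<le> 1 * \<bar>f x\<bar>"
      using cut_bound[of n x] by (intro mult_mono clamp_le) auto
    then show ?thesis by (simp add: F_def abs_mult)
  qed
  have F_lim: "(\<lambda>n. F n x) \<longlonglongrightarrow> f x" for x
  proof (rule tendsto_eventually)
    obtain N where N: "norm x + \<bar>f x\<bar> \<le> real N" using real_arch_simple by blast
    show "\<forall>\<^sub>F n in sequentially. F n x = f x"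
      using eventually_ge_at_top[of N]
    proof eventually_elim
      case (elim n)
      then have "norm x + \<bar>f x\<bar> \<le> real n" using N by linarith
      then have "norm x \<le> real n" "\<bar>f x\<bar> \<le> real n" using norm_ge_zero[of x] by linarith+
      then show ?case by (simp add: F_def cut_def clamp_def)
    qed
  qed
  have "(\<lambda>n. LINT x|lebesgue. \<bar>f x - F n x\<bar>) \<longlonglongrightarrow> (LINT x|lebesgue. \<bar>f x - f x\<bar>)"
  proof (rule integral_dominated_convergence[where w = "\<lambda>x. 2 * \<bar>f x\<bar>"])
    show "AE x in lebesgue. (\<lambda>n. \<bar>f x - F n x\<bar>) \<longlonglongrightarrow> \<bar>f x - f x\<bar>"
      by (intro AE_I2 tendsto_intros F_lim)
    show "AE x in lebesgue. norm \<bar>f x - F n x\<bar> \<le> 2 * \<bar>f x\<bar>" for n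
    proof (rule AE_I2)
      fix x show "norm \<bar>f x - F n x\<bar> \<le> 2 * \<bar>f x\<bar>" using F_le[of n x] by simp
    qed
  qed (use f in auto)
  then have "(\<lambda>n. LINT x|lebesgue. \<bar>f x - F n x\<bar>) \<longlonglongrightarrow> 0" by simp
  then have "\<forall>\<^sub>F n in sequentially. (LINT x|lebesgue. \<bar>f x - F n x\<bar>) < e / 2"
    by (rule order_tendstoD) (use e in simp)
  then obtain n where n: "(LINT x|lebesgue. \<bar>f x - F n x\<bar>) < e / 2"
    using eventually_happens trivial_limit_sequentially by blast
  have "f measurable_on UNIV"
    by (rule lebesgue_measurable_imp_measurable_on) auto
  then obtain N h where N: "negligible N" and h_cont: "\<And>k. continuous_on UNIV (h k)"
    and h_lim: "\<And>x. x \<notin> N \<Longrightarrow> (\<lambda>k. h k x) \<longlonglongrightarrow> f x"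
    unfolding measurable_on_def by auto
  define G where "G k x = cut n x * clamp n (h k x)" for k :: nat and x
  have G_cont: "continuous_on UNIV (G k)" for k
    unfolding G_def clamp_def by (intro continuous_intros cut_cont h_cont)
  have [measurable]: "G k \<in> borel_measurable lebesgue" for k
    by (rule continuous_imp_lebesgue_measurable[OF G_cont])
  have cut_int: "integrable lebesgue (\<lambda>x. 2 * real n * cut n x)"
  proof -
    have "integrable lborel (cut n)"
      by (rule integrable_bounded_support[OF cut_cont, of "real (Suc n)"]) (auto simp: cut_def)
    then have "integrable lebesgue (cut n)"
      by (subst integrable_completion) auto
    then show ?thesis by simp
  qed
  have "(\<lambda>k. LINT x|lebesgue. \<bar>F n x - G k x\<bar>) \<longlonglongrightarrow> (LINT x|lebesgue. \<bar>F n x - F n x\<bar>)"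
  proof (rule integral_dominated_convergence[where w = "\<lambda>x. 2 * real n * cut n x"])
    have "AE x in lebesgue. x \<notin> N"
      using N by (simp add: negligible_iff_null_sets AE_not_in)
    then show "AE x in lebesgue. (\<lambda>k. \<bar>F n x - G k x\<bar>) \<longlonglongrightarrow> \<bar>F n x - F n x\<bar>"
    proof eventually_elim
      case (elim x)
      then show ?case
        unfolding F_def G_def clamp_def by (intro tendsto_intros h_lim)
    qed
    show "AE x in lebesgue. norm \<bar>F n x - G k x\<bar> \<le> 2 * real n * cut n x" for k
    proof (rule AE_I2)
      fix x
      have "\<bar>clamp n (f x) - clamp n (h k x)\<bar> \<le> 2 * real n"
        using clamp_le(2)[of n "f x"] clamp_le(2)[of n "h k x"] by linarith
      from mult_left_mono[OF this cut_bound(1)[of n x]]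
      show "norm \<bar>F n x - G k x\<bar> \<le> 2 * real n * cut n x"
        using cut_bound(1)[of n x] by (simp add: F_def G_def abs_mult mult_ac flip: right_diff_distrib)
    qed
  qed (use cut_int in auto)
  then have "(\<lambda>k. LINT x|lebesgue. \<bar>F n x - G k x\<bar>) \<longlonglongrightarrow> 0" by simp
  then have "\<forall>\<^sub>F k in sequentially. (LINT x|lebesgue. \<bar>F n x - G k x\<bar>) < e / 2"
    by (rule order_tendstoD) (use e in simp)
  then obtain k where k: "(LINT x|lebesgue. \<bar>F n x - G k x\<bar>) < e / 2"
    using eventually_happens trivial_limit_sequentially by blast
  have G_supp: "G k x = 0" if "real (Suc n) \<le> norm x" for x
    using that by (simp add: G_def cut_def)
  have Gint: "integrable lebesgue (G k)"
    by (subst integrable_completion) (use G_cont integrable_bounded_support[OF G_cont G_supp] in \<open>auto intro: borel_measurable_continuous_onI\<close>)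
  have Fint: "integrable lebesgue (F n)"
    by (rule Bochner_Integration.integrable_bound[OF f]) (use F_le in auto)
  show ?thesis
  proof (rule that[OF G_cont G_supp])
    have "(LINT x|lebesgue. \<bar>f x - G k x\<bar>) \<le> (LINT x|lebesgue. \<bar>f x - F n x\<bar> + \<bar>F n x - G k x\<bar>)"
      using f Fint Gint by (intro integral_mono) auto
    also have "\<dots> = (LINT x|lebesgue. \<bar>f x - F n x\<bar>) + (LINT x|lebesgue. \<bar>F n x - G k x\<bar>)"
      using f Fint Gint by (intro Bochner_Integration.integral_add) auto
    finally show "(LINT x|lebesgue. \<bar>f x - G k x\<bar>) < e" using n k by simp
  qed
qed

text \<open>For continuous \<open>g\<close> of bounded support the convolutions converge uniformly and stay in one ball. For general
\<open>f\<close>, approximate by such a \<open>g\<close>, using that convolution with a mollifier does not increase the \<open>L\<^sup>1\<close> norm.\<close>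

lemma conv_tendsto_L1:
  fixes f :: "real^'n \<Rightarrow> real"
  assumes \<eta>: "\<And>m. mollifier (1 / real (Suc m)) (\<eta> m)" and f: "integrable lebesgue f"
  shows "(\<lambda>m. LINT x|lebesgue. \<bar>conv f (\<eta> m) x - f x\<bar>) \<longlonglongrightarrow> 0"
proof (rule LIMSEQ_I)
  fix e :: real assume e: "0 < e"
  obtain g R where g: "continuous_on UNIV g" "\<And>x. R \<le> norm x \<Longrightarrow> g x = 0" "(LINT x|lebesgue. \<bar>f x - g x\<bar>) < e / 3"
    using integrable_approx_continuous[OF f, of "e / 3"] e by auto
  have gint: "integrable lebesgue g"
    by (subst integrable_completion)
      (use g integrable_bounded_support[OF g(1,2)] in \<open>auto intro: borel_measurable_continuous_onI\<close>)
  define V where "V = measure lebesgue (cball 0 (R + 1) :: (real^'n) set)"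
  have V: "0 \<le> V" by (simp add: V_def)
  define \<delta> where "\<delta> = e / (3 * (V + 1))"
  have \<delta>: "0 < \<delta>" using e V by (simp add: \<delta>_def)
  have "uniformly_continuous_on UNIV g"
    by (rule uniformly_continuous_of_bounded_support[OF g(1,2)])
  then obtain r where r: "0 < r" "\<And>x y. dist y x < r \<Longrightarrow> dist (g y) (g x) < \<delta>"
    unfolding uniformly_continuous_on_def using \<delta> by (metis UNIV_I)
  obtain M where M: "1 / real (Suc M) < r" using r(1) reals_Archimedean by (auto simp: inverse_eq_divide)
  show "\<exists>M. \<forall>m\<ge>M. norm ((LINT x|lebesgue. \<bar>conv f (\<eta> m) x - f x\<bar>) - 0) < e"
  proof (intro exI[of _ M] allI impI)
    fix m assume "M \<le> m"
    then have m: "1 / real (Suc m) < r"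
      using M by (smt (verit) Suc_le_mono divide_left_mono of_nat_0_less_iff of_nat_le_iff mult_pos_pos zero_less_Suc)
    note D = mollifierD[OF \<eta>[of m]]
    have pointwise: "\<bar>conv g (\<eta> m) x - g x\<bar> \<le> \<delta> * indicator (cball 0 (R + 1)) x" for x
    proof (cases "norm x \<le> R + 1")
      case True
      have int: "integrable lebesgue (\<lambda>y. \<eta> m (x - y) * g y)"
        by (rule conv_integrable[OF gint D(4) D(3)])
      have "conv g (\<eta> m) x - g x = (LINT y|lebesgue. \<eta> m (x - y) * g y) - (LINT y|lebesgue. \<eta> m (x - y) * g x)"
        using D(8)[of x] by (simp add: conv_def)
      also have "\<dots> = (LINT y|lebesgue. \<eta> m (x - y) * g y - \<eta> m (x - y) * g x)"
        using int D(7)[of x] by (intro Bochner_Integration.integral_diff[symmetric]) auto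
      also have "\<bar>\<dots>\<bar> \<le> (LINT y|lebesgue. \<bar>\<eta> m (x - y) * g y - \<eta> m (x - y) * g x\<bar>)"
        using integral_norm_bound[of lebesgue "\<lambda>y. \<eta> m (x - y) * g y - \<eta> m (x - y) * g x"] by simp
      also have "\<dots> \<le> (LINT y|lebesgue. \<eta> m (x - y) * \<delta>)"
      proof (rule integral_mono)
        fix y
        show "\<bar>\<eta> m (x - y) * g y - \<eta> m (x - y) * g x\<bar> \<le> \<eta> m (x - y) * \<delta>"
        proof (cases "1 / real (Suc m) \<le> norm (x - y)")
          case True
          then show ?thesis using D(3) by simp
        next
          case False
          then have "dist y x < r" using m by (simp add: dist_norm norm_minus_commute)
          then have "\<bar>g y - g x\<bar> \<le> \<delta>" using r(2)[of y x] by (simp add: dist_real_def)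
          then show ?thesis
            using D(2)[of "x - y"] by (simp add: abs_mult mult_left_mono flip: right_diff_distrib)
        qed
      qed (use int D(7)[of x] in auto)
      also have "\<dots> = \<delta>" using D(8)[of x] by simp
      finally show ?thesis using True by simp
    next
      case False
      have "\<eta> m (x - y) * g y = 0" for y
      proof (cases "R \<le> norm y")
        case False
        have "1 / real (Suc m) \<le> 1" by simp
        also have "1 \<le> norm (x - y)" using False \<open>\<not> norm x \<le> R + 1\<close> norm_triangle_ineq2[of x y] by linarith
        finally show ?thesis using D(3) by simp
      qed (use g in simp)
      then have "conv g (\<eta> m) x = (LINT y|(lebesgue :: (real^'n) measure). 0)"
        unfolding conv_def by (intro Bochner_Integration.integral_cong refl)
      moreover have "g x = 0" using False norm_ge_zero[of x] by (intro g(2)) linarith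
      ultimately show ?thesis using \<delta> by simp
    qed
    have cf: "integrable lebesgue (conv f (\<eta> m))" "integrable lebesgue (conv g (\<eta> m))"
      by (rule integrable_conv[OF \<eta> f] integrable_conv[OF \<eta> gint])+
    have cfg: "integrable lebesgue (conv (\<lambda>x. f x - g x) (\<eta> m))"
      using f gint by (intro integrable_conv[OF \<eta>]) auto
    have ind: "integrable lebesgue (\<lambda>x::real^'n. \<delta> * indicator (cball 0 (R + 1)) x :: real)"
      using emeasure_lborel_cball_finite[of "0 :: real^'n" "R + 1"]
      by (intro integrable_mult_right integrable_real_indicator) (auto simp: less_top)
    have "(LINT x|lebesgue. \<bar>conv f (\<eta> m) x - f x\<bar>) \<le>
        (LINT x|lebesgue. \<bar>conv (\<lambda>x. f x - g x) (\<eta> m) x\<bar> + \<bar>conv g (\<eta> m) x - g x\<bar> + \<bar>f x - g x\<bar>)"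
      using cf cfg f gint by (intro integral_mono) (auto simp: conv_diff[OF \<eta> f gint])
    also have "\<dots> = (LINT x|lebesgue. \<bar>conv (\<lambda>x. f x - g x) (\<eta> m) x\<bar>) + (LINT x|lebesgue. \<bar>conv g (\<eta> m) x - g x\<bar>)
        + (LINT x|lebesgue. \<bar>f x - g x\<bar>)"
      using cf cfg f gint by simp
    also have "(LINT x|lebesgue. \<bar>conv (\<lambda>x. f x - g x) (\<eta> m) x\<bar>) \<le> (LINT x|lebesgue. \<bar>f x - g x\<bar>)"
      using f gint by (intro integral_abs_conv_le[OF \<eta>]) auto
    also have "(LINT x|lebesgue. \<bar>conv g (\<eta> m) x - g x\<bar>) \<le> (LINT x|lebesgue. \<delta> * indicator (cball 0 (R + 1) :: (real^'n) set) x)"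
      using cf gint ind by (intro integral_mono pointwise) auto
    also have "(LINT x|lebesgue. \<delta> * indicator (cball 0 (R + 1) :: (real^'n) set) x) = \<delta> * V"
      by (simp add: V_def)
    also have "\<delta> * V \<le> e / 3"
      using e V by (simp add: \<delta>_def field_simps)
    finally have "(LINT x|lebesgue. \<bar>conv f (\<eta> m) x - f x\<bar>) < e" using g(3) by linarith
    then show "norm ((LINT x|lebesgue. \<bar>conv f (\<eta> m) x - f x\<bar>) - 0) < e" by simp
  qed
qed

text \<open>Convergence in \<open>L\<^sup>1\<close> yields convergence almost everywhere along a subsequence; applied to the sum of the
errors, it yields one subsequence for the whole family.\<close>

lemma mollifier_sequence_AE:
  fixes f :: "'j \<Rightarrow> real^'n \<Rightarrow> real"
  assumes J: "finite J" and f: "\<And>j. j \<in> J \<Longrightarrow> integrable lebesgue (f j)" and \<epsilon>: "0 < \<epsilon>"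
  obtains \<eta> where "\<And>m::nat. mollifier \<epsilon> (\<eta> m)" "AE x in lebesgue. \<forall>j\<in>J. (\<lambda>m. conv (f j) (\<eta> m) x) \<longlonglongrightarrow> f j x"
proof -
  have "\<exists>\<eta> :: real^'n \<Rightarrow> real. mollifier (1 / real (Suc m)) \<eta>" for m
    by (rule mollifier_exists[of "1 / real (Suc m)"]) auto
  then obtain \<eta> :: "nat \<Rightarrow> real^'n \<Rightarrow> real" where \<eta>: "\<And>m. mollifier (1 / real (Suc m)) (\<eta> m)" by metis
  have int: "integrable lebesgue (\<lambda>x. \<Sum>j\<in>J. \<bar>conv (f j) (\<eta> m) x - f j x\<bar>)" for m
    using f integrable_conv[OF \<eta>] by (intro Bochner_Integration.integrable_sum integrable_abs Bochner_Integration.integrable_diff) auto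
  have "(\<lambda>m. \<Sum>j\<in>J. LINT x|lebesgue. \<bar>conv (f j) (\<eta> m) x - f j x\<bar>) \<longlonglongrightarrow> (\<Sum>j\<in>J. 0)"
    by (intro tendsto_sum conv_tendsto_L1[OF \<eta>] f)
  moreover have "(LINT x|lebesgue. norm (\<Sum>j\<in>J. \<bar>conv (f j) (\<eta> m) x - f j x\<bar>)) =
      (\<Sum>j\<in>J. LINT x|lebesgue. \<bar>conv (f j) (\<eta> m) x - f j x\<bar>)" for m
    using f integrable_conv[OF \<eta>]
    by (subst Bochner_Integration.integral_sum[symmetric]) (auto intro!: Bochner_Integration.integral_cong sum_nonneg)
  ultimately have "(\<lambda>m. LINT x|lebesgue. norm (\<Sum>j\<in>J. \<bar>conv (f j) (\<eta> m) x - f j x\<bar>)) \<longlonglongrightarrow> 0" by simp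
  from tendsto_L1_AE_subseq[OF int this]
  obtain r where r: "strict_mono r" "AE x in lebesgue. (\<lambda>m. \<Sum>j\<in>J. \<bar>conv (f j) (\<eta> (r m)) x - f j x\<bar>) \<longlonglongrightarrow> 0"
    by blast
  obtain M where M: "1 / real (Suc M) < \<epsilon>" using \<epsilon> reals_Archimedean by (auto simp: inverse_eq_divide)
  show ?thesis
  proof (rule that[of "\<lambda>m. \<eta> (r (m + M))"])
    fix m
    have "M \<le> r (m + M)" using seq_suble[OF r(1), of "m + M"] by simp
    then have "1 / real (Suc (r (m + M))) \<le> 1 / real (Suc M)" by (intro divide_left_mono) auto
    then have "1 / real (Suc (r (m + M))) \<le> \<epsilon>" using M by linarith
    then show "mollifier \<epsilon> (\<eta> (r (m + M)))"
      using \<eta>[of "r (m + M)"] unfolding mollifier_def by (meson order_trans)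
  next
    show "AE x in lebesgue. \<forall>j\<in>J. (\<lambda>m. conv (f j) (\<eta> (r (m + M))) x) \<longlonglongrightarrow> f j x"
      using r(2)
    proof eventually_elim
      case (elim x)
      show ?case
      proof
        fix j assume j: "j \<in> J"
        have "(\<lambda>m. conv (f j) (\<eta> (r m)) x - f j x) \<longlonglongrightarrow> 0"
        proof (rule Lim_null_comparison[OF _ elim], rule always_eventually, rule allI)
          fix m
          show "norm (conv (f j) (\<eta> (r m)) x - f j x) \<le> (\<Sum>j\<in>J. \<bar>conv (f j) (\<eta> (r m)) x - f j x\<bar>)"
            using member_le_sum[OF j, of "\<lambda>j. \<bar>conv (f j) (\<eta> (r m)) x - f j x\<bar>"] J by simp
        qed
        then have "(\<lambda>m. conv (f j) (\<eta> (r m)) x) \<longlonglongrightarrow> f j x" by (rule LIM_zero_cancel)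
        then show "(\<lambda>m. conv (f j) (\<eta> (r (m + M))) x) \<longlonglongrightarrow> f j x"
          by (rule LIMSEQ_ignore_initial_segment)
      qed
    qed
  qed
qed

section \<open>Weak derivatives\<close>

lemma locally_integrable_imp_measurable:
  fixes f :: "real^'n \<Rightarrow> 'b::euclidean_space"
  assumes "open \<Omega>" and f: "locally_integrable \<Omega> f"
  shows "f \<in> borel_measurable (lebesgue_on \<Omega>)"
proof -
  obtain C where C: "\<And>n. compact (C n)" "\<And>n. C n \<subseteq> \<Omega>" "\<And>n. C n \<subseteq> interior (C (Suc n))" "\<Union>(range C) = \<Omega>"
    "\<And>K. compact K \<Longrightarrow> K \<subseteq> \<Omega> \<Longrightarrow> \<exists>N. \<forall>n\<ge>N. K \<subseteq> C n"
    by (rule open_Union_compact_subsets[OF assms(1)]) (rule that)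
  show ?thesis
  proof (rule measurable_piecewise_restrict[of "range C"])
    fix K assume "K \<in> range C"
    then obtain n where K: "K = C n" by blast
    have "integrable (lebesgue_on K) f" using f C K by (auto simp: locally_integrable_def)
    moreover have "restrict_space (lebesgue_on \<Omega>) K = lebesgue_on K"
      using C(2)[of n] K assms(1) by (subst restrict_restrict_space) (auto simp: Int_absorb1 compact_imp_closed[OF C(1)])
    ultimately show "f \<in> borel_measurable (restrict_space (lebesgue_on \<Omega>) K)" by auto
    show "K \<inter> space (lebesgue_on \<Omega>) \<in> sets (lebesgue_on \<Omega>)"
      using C(2)[of n] K assms(1) compact_imp_closed[OF C(1)[of n]]
      by (subst sets_restrict_space_iff) (auto simp: Int_absorb2)
  qed (use C in auto)
qed

lemma integrable_dominated_on_compact: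
  fixes f :: "real^'n \<Rightarrow> 'b::euclidean_space" and q :: "real^'n \<Rightarrow> 'c::euclidean_space"
  assumes \<Omega>: "open \<Omega>" and f: "locally_integrable \<Omega> f" and K: "compact K" "K \<subseteq> \<Omega>"
    and q: "q \<in> borel_measurable (lebesgue_on \<Omega>)" "\<And>x. x \<in> K \<Longrightarrow> norm (q x) \<le> C * norm (f x)" "\<And>x. x \<notin> K \<Longrightarrow> q x = 0"
  shows "integrable (lebesgue_on \<Omega>) q"
proof (rule Bochner_Integration.integrable_bound)
  have [measurable]: "K \<in> sets lebesgue" "\<Omega> \<in> sets lebesgue" using K \<Omega> by (auto simp: compact_imp_closed)
  have "integrable (lebesgue_on K) f" using f K by (auto simp: locally_integrable_def)
  then have "integrable lebesgue (\<lambda>x. indicator K x *\<^sub>R f x)"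
    by (subst (asm) integrable_restrict_space) auto
  moreover have "(\<lambda>x. indicator K x *\<^sub>R f x) = (\<lambda>x. indicator \<Omega> x *\<^sub>R (indicator K x *\<^sub>R f x))"
    using K(2) by (auto simp: indicator_def fun_eq_iff)
  ultimately have "integrable (lebesgue_on \<Omega>) (\<lambda>x. indicator K x *\<^sub>R f x)"
    by (subst integrable_restrict_space) auto
  then show "integrable (lebesgue_on \<Omega>) (\<lambda>x. C *\<^sub>R (indicator K x *\<^sub>R f x))"
    by (rule integrable_scaleR_right)
  show "AE x in lebesgue_on \<Omega>. norm (q x) \<le> norm (C *\<^sub>R (indicator K x *\<^sub>R f x))"
  proof (rule AE_I2)
    fix x
    have "C * norm (f x) \<le> \<bar>C\<bar> * norm (f x)" by (rule mult_right_mono) auto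
    then show "norm (q x) \<le> norm (C *\<^sub>R (indicator K x *\<^sub>R f x))"
      using q(2,3)[of x] by (cases "x \<in> K") auto
  qed
qed (rule q(1))

lemma test_functionsE:
  fixes \<phi> :: "real^'n \<Rightarrow> 'b::real_normed_vector"
  assumes "\<phi> \<in> test_functions \<Omega>"
  obtains K C where "smooth \<phi>" "compact K" "K \<subseteq> \<Omega>" "\<And>x. x \<notin> K \<Longrightarrow> \<phi> x = 0" "\<And>i x. x \<notin> K \<Longrightarrow> partial_deriv i \<phi> x = 0"
    "\<And>x. norm (\<phi> x) \<le> C" "\<And>i x. norm (partial_deriv i \<phi> x) \<le> C"
proof -
  obtain K where K: "smooth \<phi>" "compact K" "K \<subseteq> \<Omega>" "\<And>x. x \<notin> K \<Longrightarrow> \<phi> x = 0"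
    using assms by (auto simp: test_functions_def smooth_def)
  have pd: "partial_deriv i \<phi> x = 0" if "x \<notin> K" for i x
  proof -
    have "open (- K)" using K(2) by (intro open_Compl compact_imp_closed)
    then have "(\<phi> has_derivative (\<lambda>h. 0)) (at x)"
      by (rule has_derivative_transform_within_open[OF has_derivative_const[of 0]]) (use that K in auto)
    then show ?thesis by (simp add: partial_deriv_eq)
  qed
  obtain R where R: "\<And>x. x \<in> K \<Longrightarrow> norm x \<le> R" using K(2) compact_imp_bounded bounded_iff by metis
  have out: "x \<notin> K" if "R + 1 \<le> norm x" for x using R[of x] that by linarith
  obtain C0 where C0: "0 \<le> C0" "\<And>x. norm (\<phi> x) \<le> C0"
    using bounded_of_bounded_support[OF smooth_continuous_on[OF K(1)], of "R + 1"] K(4) out by blast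
  have "\<exists>C. \<forall>x. norm (partial_deriv i \<phi> x) \<le> C" for i
    using bounded_of_bounded_support[OF smooth_continuous_on[OF smooth_partial_deriv[OF K(1)]], of "R + 1" i] pd out by metis
  then obtain D where D: "\<And>i x. norm (partial_deriv i \<phi> x) \<le> D i" by metis
  show ?thesis
  proof (rule that[OF K pd])
    show "norm (\<phi> x) \<le> max C0 (Max (range D))" for x using C0(2)[of x] by simp
    show "norm (partial_deriv i \<phi> x) \<le> max C0 (Max (range D))" for i x
    proof -
      have "D i \<le> Max (range D)" by (intro Max_ge) auto
      then show ?thesis using D[of i x] by linarith
    qed
  qed
qed

lemma test_functionsI:
  "smooth \<phi> \<Longrightarrow> compact K \<Longrightarrow> K \<subseteq> \<Omega> \<Longrightarrow> (\<And>x. x \<notin> K \<Longrightarrow> \<phi> x = 0) \<Longrightarrow> \<phi> \<in> test_functions \<Omega>"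
  unfolding test_functions_def smooth_def by blast

lemma mollifier_test_function:
  assumes \<eta>: "mollifier \<epsilon> \<eta>" and sub: "cball x \<epsilon> \<subseteq> \<Omega>"
  shows "(\<lambda>y. \<eta> (x - y)) \<in> test_functions \<Omega>"
  by (rule test_functionsI[OF smooth_reflect_translate(1)[OF mollifierD(1)[OF \<eta>]] compact_cball sub])
    (use mollifierD(3)[OF \<eta>] in \<open>auto simp: dist_norm\<close>)

lemma smooth_lebesgue_on_measurable:
  fixes \<phi> :: "real^'n \<Rightarrow> 'b::real_normed_vector"
  assumes "smooth \<phi>"
  shows "\<phi> \<in> borel_measurable (lebesgue_on \<Omega>)"
  by (intro measurable_restrict_space1 continuous_imp_lebesgue_measurable smooth_continuous_on assms)

lemma conv_restrict:
  assumes "open \<Omega>"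
  shows "conv (\<lambda>y. indicator \<Omega> y * f y) \<eta> x = (LINT y|lebesgue_on \<Omega>. \<eta> (x - y) * f y)"
  using assms by (subst integral_restrict_space) (auto simp: conv_def mult_ac)

text \<open>The functions \<open>y \<mapsto> \<eta> (x - y)\<close> with a mollifier \<open>\<eta>\<close> of small radius are test functions, so the mollifications of
\<open>f\<close> vanish near every point of \<open>\<Omega>\<close>; on the other hand they converge to \<open>f\<close> almost everywhere. Countably many
balls suffice to cover \<open>\<Omega>\<close>.\<close>

lemma fundamental_lemma_real:
  fixes f :: "real^'n \<Rightarrow> real"
  assumes \<Omega>: "open \<Omega>" and f: "locally_integrable \<Omega> f"
    and zero: "\<And>\<phi>. \<phi> \<in> test_functions \<Omega> \<Longrightarrow> (LINT x|lebesgue_on \<Omega>. \<phi> x * f x) = 0"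
  shows "AE x in lebesgue_on \<Omega>. f x = 0"
proof -
  have small_ball: "\<exists>r>0. cball a (2 * r) \<subseteq> \<Omega>" if a: "a \<in> \<Omega>" for a
  proof -
    obtain e where "0 < e" "cball a e \<subseteq> \<Omega>" using open_contains_cball[THEN iffD1, OF \<Omega>] a by fast
    then show ?thesis by (intro exI[of _ "e / 2"]) auto
  qed
  then obtain r where r: "\<And>a. a \<in> \<Omega> \<Longrightarrow> 0 < r a" "\<And>a. a \<in> \<Omega> \<Longrightarrow> cball a (2 * r a) \<subseteq> \<Omega>" by metis
  have AE_ball: "AE x in lebesgue. x \<in> ball a (r a) \<longrightarrow> f x = 0" if a: "a \<in> \<Omega>" for a
  proof -
    define K where "K = cball a (2 * r a)"
    have K: "compact K" "K \<subseteq> \<Omega>" "K \<in> sets lebesgue" using r(2)[OF a] by (auto simp: K_def)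
    define g where "g x = indicator K x * f x" for x
    have "integrable (lebesgue_on K) f" using f K by (auto simp: locally_integrable_def)
    then have g: "integrable lebesgue g"
      unfolding g_def using K(3) by (subst (asm) integrable_restrict_space) auto
    obtain \<eta> where \<eta>: "\<And>m::nat. mollifier (r a) (\<eta> m)"
      and lim: "AE x in lebesgue. \<forall>j\<in>{()}. (\<lambda>m. conv g (\<eta> m) x) \<longlonglongrightarrow> g x"
      using mollifier_sequence_AE[of "{()}" "\<lambda>_. g", OF _ g r(1)[OF a]] by auto
    from lim show ?thesis
    proof eventually_elim
      case (elim x)
      show ?case
      proof
        assume x: "x \<in> ball a (r a)"
        then have sub: "cball x (r a) \<subseteq> K"
          unfolding K_def using r(1)[OF a] by (subst cball_subset_cball_iff) (auto simp: dist_commute)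
        have "conv g (\<eta> m) x = 0" for m
        proof -
          note D = mollifierD[OF \<eta>[of m]]
          have "conv g (\<eta> m) x = conv (\<lambda>y. indicator \<Omega> y * f y) (\<eta> m) x"
            unfolding conv_def
          proof (rule Bochner_Integration.integral_cong[OF refl])
            fix y
            show "\<eta> m (x - y) * g y = \<eta> m (x - y) * (indicator \<Omega> y * f y)"
            proof (cases "y \<in> K")
              case False
              then have "y \<notin> cball x (r a)" using sub by blast
              then have "\<eta> m (x - y) = 0" using D(3)[of "x - y"] by (auto simp: dist_norm)
              then show ?thesis by simp
            qed (use K in \<open>auto simp: g_def\<close>)
          qed
          also have "\<dots> = (LINT y|lebesgue_on \<Omega>. \<eta> m (x - y) * f y)" by (rule conv_restrict[OF \<Omega>])
          also have "\<dots> = 0"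
            using mollifier_test_function[OF \<eta>, of x \<Omega> m] sub K(2) by (intro zero) auto
          finally show ?thesis .
        qed
        then have "g x = 0" using elim by (simp add: LIMSEQ_const_iff)
        moreover have "x \<in> K" using x r(1)[OF a] by (auto simp: K_def)
        ultimately show "f x = 0" by (simp add: g_def)
      qed
    qed
  qed
  obtain \<F> where \<F>: "\<F> \<subseteq> (\<lambda>a. ball a (r a)) ` \<Omega>" "countable \<F>" "\<Union>\<F> = \<Union>((\<lambda>a. ball a (r a)) ` \<Omega>)"
    by (rule Lindelof[of "(\<lambda>a. ball a (r a)) ` \<Omega>"]) auto
  have "AE x in lebesgue. \<forall>B\<in>\<F>. x \<in> B \<longrightarrow> f x = 0"
    using \<F>(1,2) AE_ball by (subst AE_ball_countable) auto
  then have "AE x in lebesgue. x \<in> \<Omega> \<longrightarrow> f x = 0"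
  proof eventually_elim
    case (elim x)
    show ?case
    proof
      assume "x \<in> \<Omega>"
      then have "x \<in> ball x (r x)" using r(1) by simp
      then have "x \<in> \<Union>\<F>" unfolding \<F>(3) using \<open>x \<in> \<Omega>\<close> by blast
      then show "f x = 0" using elim by blast
    qed
  qed
  then show ?thesis using \<Omega> by (subst AE_restrict_space_iff) auto
qed

lemma locally_integrable_diff:
  "locally_integrable \<Omega> f \<Longrightarrow> locally_integrable \<Omega> g \<Longrightarrow> locally_integrable \<Omega> (\<lambda>x. f x - g x)"
  unfolding locally_integrable_def by auto

lemma test_function_times_integrable:
  fixes f :: "real^'n \<Rightarrow> 'b::euclidean_space" and \<phi> :: "real^'n \<Rightarrow> real"
  assumes \<Omega>: "open \<Omega>" and f: "locally_integrable \<Omega> f" and \<phi>: "\<phi> \<in> test_functions \<Omega>"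
  shows "integrable (lebesgue_on \<Omega>) (\<lambda>x. \<phi> x *\<^sub>R f x)"
    and "integrable (lebesgue_on \<Omega>) (\<lambda>x. partial_deriv i \<phi> x *\<^sub>R f x)"
proof -
  obtain K C where K: "smooth \<phi>" "compact K" "K \<subseteq> \<Omega>" "\<And>x. x \<notin> K \<Longrightarrow> \<phi> x = 0" "\<And>i x. x \<notin> K \<Longrightarrow> partial_deriv i \<phi> x = 0"
    "\<And>x. norm (\<phi> x) \<le> C" "\<And>i x. norm (partial_deriv i \<phi> x) \<le> C"
    using test_functionsE[OF \<phi>] by metis
  note [measurable] = locally_integrable_imp_measurable[OF \<Omega> f]
    smooth_lebesgue_on_measurable[OF K(1)] smooth_lebesgue_on_measurable[OF smooth_partial_deriv[OF K(1)]]
  show "integrable (lebesgue_on \<Omega>) (\<lambda>x. \<phi> x *\<^sub>R f x)"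
    by (rule integrable_dominated_on_compact[OF \<Omega> f K(2,3), where C = C])
      (use K in \<open>auto intro!: mult_right_mono\<close>)
  show "integrable (lebesgue_on \<Omega>) (\<lambda>x. partial_deriv i \<phi> x *\<^sub>R f x)"
    by (rule integrable_dominated_on_compact[OF \<Omega> f K(2,3), where C = C])
      (use K in \<open>auto intro!: mult_right_mono\<close>)
qed

lemma weak_partial_unique:
  fixes f g g' :: "real^'n \<Rightarrow> 'b::euclidean_space"
  assumes \<Omega>: "open \<Omega>" and g: "weak_partial \<Omega> i f g" and g': "weak_partial \<Omega> i f g'"
  shows "AE x in lebesgue_on \<Omega>. g x = g' x"
proof -
  have loc: "locally_integrable \<Omega> g" "locally_integrable \<Omega> g'"
    using g g' by (auto simp: weak_partial_def)
  have comp: "AE x in lebesgue_on \<Omega>. (g x - g' x) \<bullet> c = 0" for c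
  proof (rule fundamental_lemma_real[OF \<Omega>])
    show "locally_integrable \<Omega> (\<lambda>x. (g x - g' x) \<bullet> c)"
      using locally_integrable_diff[OF loc] unfolding locally_integrable_def by auto
    fix \<phi> :: "real^'n \<Rightarrow> real" assume \<phi>: "\<phi> \<in> test_functions \<Omega>"
    have "(LINT x|lebesgue_on \<Omega>. \<phi> x * ((g x - g' x) \<bullet> c)) = (LINT x|lebesgue_on \<Omega>. (\<phi> x *\<^sub>R g x - \<phi> x *\<^sub>R g' x) \<bullet> c)"
      by (simp add: inner_diff_left right_diff_distrib)
    also have "\<dots> = (LINT x|lebesgue_on \<Omega>. \<phi> x *\<^sub>R g x - \<phi> x *\<^sub>R g' x) \<bullet> c"
      by (intro integral_inner_left Bochner_Integration.integrable_diff test_function_times_integrable(1)[OF \<Omega> _ \<phi>] loc)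
    also have "(LINT x|lebesgue_on \<Omega>. \<phi> x *\<^sub>R g x - \<phi> x *\<^sub>R g' x) = (LINT x|lebesgue_on \<Omega>. \<phi> x *\<^sub>R g x) - (LINT x|lebesgue_on \<Omega>. \<phi> x *\<^sub>R g' x)"
      by (intro Bochner_Integration.integral_diff test_function_times_integrable(1)[OF \<Omega> _ \<phi>] loc)
    also have "(LINT x|lebesgue_on \<Omega>. \<phi> x *\<^sub>R g x) = (LINT x|lebesgue_on \<Omega>. \<phi> x *\<^sub>R g' x)"
    proof -
      have "- (LINT x|lebesgue_on \<Omega>. \<phi> x *\<^sub>R g x) = (LINT x|lebesgue_on \<Omega>. partial_deriv i \<phi> x *\<^sub>R f x)"
        using g \<phi> unfolding weak_partial_def by simp
      also have "\<dots> = - (LINT x|lebesgue_on \<Omega>. \<phi> x *\<^sub>R g' x)"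
        using g' \<phi> unfolding weak_partial_def by blast
      finally show ?thesis by (simp only: neg_equal_iff_equal)
    qed
    finally show "(LINT x|lebesgue_on \<Omega>. \<phi> x * ((g x - g' x) \<bullet> c)) = 0" by simp
  qed
  have "AE x in lebesgue_on \<Omega>. \<forall>c\<in>Basis. (g x - g' x) \<bullet> c = 0"
    using comp by (subst AE_ball_countable) (auto simp: countable_finite)
  then show ?thesis
  proof eventually_elim
    case (elim x)
    then have "g x - g' x = 0" by (metis euclidean_all_zero_iff)
    then show ?case by simp
  qed
qed

lemma weak_partial_vector_test:
  fixes F h \<psi> :: "real^'n \<Rightarrow> 'b::euclidean_space"
  assumes \<Omega>: "open \<Omega>" and F: "weak_partial \<Omega> i F h" and \<psi>: "\<psi> \<in> test_functions \<Omega>"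
  shows "(LINT x|lebesgue_on \<Omega>. partial_deriv i \<psi> x \<bullet> F x) = - (LINT x|lebesgue_on \<Omega>. \<psi> x \<bullet> h x)"
proof -
  have loc: "locally_integrable \<Omega> F" "locally_integrable \<Omega> h" using F by (auto simp: weak_partial_def)
  obtain K where K: "smooth \<psi>" "compact K" "K \<subseteq> \<Omega>" "\<And>x. x \<notin> K \<Longrightarrow> \<psi> x = 0"
    using test_functionsE[OF \<psi>] by metis
  define \<phi> where "\<phi> c x = \<psi> x \<bullet> c" for c x
  have \<phi>: "\<phi> c \<in> test_functions \<Omega>" for c
    unfolding \<phi>_def
    by (rule test_functionsI[OF smooth_linear[OF K(1) bounded_linear_inner_left] K(2,3)]) (simp add: K(4))
  have pd: "partial_deriv i (\<phi> c) x = partial_deriv i \<psi> x \<bullet> c" for c x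
    unfolding \<phi>_def by (rule partial_deriv_linear[OF smooth_differentiable[OF K(1)] bounded_linear_inner_left])
  note int = test_function_times_integrable[OF \<Omega> _ \<phi>]
  have "(LINT x|lebesgue_on \<Omega>. partial_deriv i \<psi> x \<bullet> F x) = (LINT x|lebesgue_on \<Omega>. (\<Sum>c\<in>Basis. (partial_deriv i (\<phi> c) x *\<^sub>R F x) \<bullet> c))"
    by (subst euclidean_inner) (simp add: pd)
  also have "\<dots> = (\<Sum>c\<in>Basis. (LINT x|lebesgue_on \<Omega>. partial_deriv i (\<phi> c) x *\<^sub>R F x) \<bullet> c)"
    by (subst Bochner_Integration.integral_sum, intro integrable_inner_left int(2) loc)
      (intro sum.cong refl integral_inner_left int(2) loc)
  also have "\<dots> = (\<Sum>c\<in>Basis. - (LINT x|lebesgue_on \<Omega>. \<phi> c x *\<^sub>R h x) \<bullet> c)"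
    using F \<phi> unfolding weak_partial_def by (intro sum.cong refl) (simp only:)
  also have "\<dots> = - (\<Sum>c\<in>Basis. (LINT x|lebesgue_on \<Omega>. \<phi> c x *\<^sub>R h x) \<bullet> c)"
    by (simp add: sum_negf)
  also have "(\<Sum>c\<in>Basis. (LINT x|lebesgue_on \<Omega>. \<phi> c x *\<^sub>R h x) \<bullet> c) = (LINT x|lebesgue_on \<Omega>. (\<Sum>c\<in>Basis. (\<phi> c x *\<^sub>R h x) \<bullet> c))"
    by (subst Bochner_Integration.integral_sum, intro integrable_inner_left int(1) loc)
      (intro sum.cong refl integral_inner_left[symmetric] int(1) loc)
  also have "\<dots> = (LINT x|lebesgue_on \<Omega>. \<psi> x \<bullet> h x)"
    by (subst (2) euclidean_inner) (simp add: \<phi>_def)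
  finally show ?thesis .
qed

lemma Linf_indicator_integrable:
  fixes f :: "real^'n \<Rightarrow> real"
  assumes \<Omega>: "open \<Omega>" "bounded \<Omega>" and f: "f \<in> Linf_functions \<Omega>"
  obtains C where "0 \<le> C" "AE x in lebesgue_on \<Omega>. \<bar>f x\<bar> \<le> C" "integrable lebesgue (\<lambda>x. indicator \<Omega> x * f x)"
    "AE x in lebesgue. \<bar>indicator \<Omega> x * f x\<bar> \<le> C"
proof -
  obtain C where m: "f \<in> borel_measurable (lebesgue_on \<Omega>)" and C: "AE x in lebesgue_on \<Omega>. norm (f x) \<le> C"
    using f by (auto simp: Linf_functions_def)
  have C': "AE x in lebesgue_on \<Omega>. \<bar>f x\<bar> \<le> \<bar>C\<bar>" using C by eventually_elim auto
  interpret finite_measure "lebesgue_on \<Omega>"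
    by (rule finite_measure_lebesgue_on[OF lmeasurable_open[OF \<Omega>(2,1)]])
  have "integrable (lebesgue_on \<Omega>) f"
    by (rule integrable_const_bound[OF _ m]) (use C in auto)
  then have int: "integrable lebesgue (\<lambda>x. indicator \<Omega> x * f x)"
    using \<Omega>(1) by (subst (asm) integrable_restrict_space) auto
  have "AE x in lebesgue. x \<in> \<Omega> \<longrightarrow> \<bar>f x\<bar> \<le> \<bar>C\<bar>"
    using C' \<Omega>(1) by (subst (asm) AE_restrict_space_iff) auto
  then have "AE x in lebesgue. \<bar>indicator \<Omega> x * f x\<bar> \<le> \<bar>C\<bar>"
    by eventually_elim (auto simp: indicator_def)
  then show ?thesis using that[of "\<bar>C\<bar>"] C' int by simp
qed

lemma
  assumes \<eta>: "mollifier \<epsilon> \<eta>" and f: "integrable lebesgue f"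
  shows mollification_smooth: "smooth (conv f \<eta>)"
    and partial_deriv_mollification: "partial_deriv i (conv f \<eta>) = conv f (partial_deriv i \<eta>)"
  by (rule smooth_conv[OF f, of _ \<epsilon>] partial_deriv_conv[OF f, of _ \<epsilon>];
      use mollifierD[OF \<eta>] in blast)+

text \<open>Formally, this is the definition of the weak derivative \<open>h\<close> of \<open>F\<close> with \<open>e^b \<phi>\<close> as test function. Since \<open>b\<close> is
only weakly differentiable, replace it by mollifications \<open>b\<^sub>m\<close>: then \<open>exp b\<^sub>m \<cdot> \<phi>\<close> is a test function, and on the
support of \<open>\<phi>\<close> the derivative of \<open>b\<^sub>m\<close> is the mollification of \<open>b'\<close>, because the derivative can be moved from
the kernel to \<open>b\<close>. The essential bounds of \<open>b\<close> and \<open>b'\<close> pass to their mollifications, so dominated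
convergence gives the claim.\<close>

lemma weak_partial_exp_weight:
  fixes F h \<phi> :: "real^'n \<Rightarrow> 'b::euclidean_space" and b b' :: "real^'n \<Rightarrow> real"
  assumes \<Omega>: "open \<Omega>" "bounded \<Omega>" and F: "weak_partial \<Omega> i F h" and \<phi>: "\<phi> \<in> test_functions \<Omega>"
    and b: "b \<in> Linf_functions \<Omega>" "b' \<in> Linf_functions \<Omega>" "weak_partial \<Omega> i b b'"
  shows "(LINT x|lebesgue_on \<Omega>. exp (b x) * ((partial_deriv i \<phi> x + b' x *\<^sub>R \<phi> x) \<bullet> F x)) =
    - (LINT x|lebesgue_on \<Omega>. exp (b x) * (\<phi> x \<bullet> h x))"
proof -
  \<comment> \<open>One family for \<open>b\<close> and \<open>b'\<close>, extended by zero, so that both are mollified by the same kernels.\<close>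
  define f where "f j x = indicator \<Omega> x * (if j then b' x else b x)" for j x
  obtain B where B: "0 \<le> B" "AE x in lebesgue_on \<Omega>. \<bar>b x\<bar> \<le> B" "integrable lebesgue (f False)" "AE x in lebesgue. \<bar>f False x\<bar> \<le> B"
    using Linf_indicator_integrable[OF \<Omega> b(1)] unfolding f_def by auto
  obtain B' where B': "0 \<le> B'" "AE x in lebesgue_on \<Omega>. \<bar>b' x\<bar> \<le> B'" "integrable lebesgue (f True)" "AE x in lebesgue. \<bar>f True x\<bar> \<le> B'"
    using Linf_indicator_integrable[OF \<Omega> b(2)] unfolding f_def by auto
  obtain K C where K: "smooth \<phi>" "compact K" "K \<subseteq> \<Omega>" "\<And>x. x \<notin> K \<Longrightarrow> \<phi> x = 0" "\<And>i x. x \<notin> K \<Longrightarrow> partial_deriv i \<phi> x = 0"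
    "\<And>x. norm (\<phi> x) \<le> C" "\<And>i x. norm (partial_deriv i \<phi> x) \<le> C"
    using test_functionsE[OF \<phi>] by metis
  have C: "0 \<le> C" using K(6)[of undefined] norm_ge_zero order_trans by blast
  have loc: "locally_integrable \<Omega> F" "locally_integrable \<Omega> h" using F by (auto simp: weak_partial_def)
  obtain \<epsilon> where \<epsilon>: "0 < \<epsilon>" "(\<Union>x\<in>K. cball x \<epsilon>) \<subseteq> \<Omega>"
    using compact_subset_open_imp_cball_epsilon_subset[OF K(2) \<Omega>(1) K(3)] by blast
  have f_int: "integrable lebesgue (f j)" for j using B(3) B'(3) by (cases j) auto
  obtain \<eta> where \<eta>: "\<And>m::nat. mollifier \<epsilon> (\<eta> m)"
    and lim: "AE x in lebesgue. \<forall>j\<in>UNIV. (\<lambda>m. conv (f j) (\<eta> m) x) \<longlonglongrightarrow> f j x"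
    using mollifier_sequence_AE[of UNIV f, OF _ f_int \<epsilon>(1)] by auto
  define bm where "bm m = conv (f False) (\<eta> m)" for m
  define cm where "cm m = conv (f True) (\<eta> m)" for m
  have sm: "smooth (bm m)" "smooth (cm m)" for m
    unfolding bm_def cm_def by (rule mollification_smooth[OF \<eta> f_int])+
  have bd: "\<bar>bm m x\<bar> \<le> B" "\<bar>cm m x\<bar> \<le> B'" for m x
    unfolding bm_def cm_def by (rule conv_bounded[OF \<eta> B(3,4)] conv_bounded[OF \<eta> B'(3,4)])+
  have pd_bm: "partial_deriv i (bm m) x = cm m x" if x: "x \<in> K" for m x
  proof -
    note D = mollifierD[OF \<eta>[of m]]
    have "partial_deriv i (bm m) x = conv (f False) (partial_deriv i (\<eta> m)) x"
      unfolding bm_def by (simp add: partial_deriv_mollification[OF \<eta> f_int])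
    also have "\<dots> = (LINT y|lebesgue_on \<Omega>. partial_deriv i (\<eta> m) (x - y) * b y)"
      unfolding f_def if_False by (rule conv_restrict[OF \<Omega>(1)])
    also have "\<dots> = - (LINT y|lebesgue_on \<Omega>. partial_deriv i (\<lambda>y. \<eta> m (x - y)) y *\<^sub>R b y)"
      by (simp add: smooth_reflect_translate(2)[OF D(1)])
    also have "\<dots> = (LINT y|lebesgue_on \<Omega>. \<eta> m (x - y) *\<^sub>R b' y)"
    proof -
      have "(\<lambda>y. \<eta> m (x - y)) \<in> test_functions \<Omega>"
        by (rule mollifier_test_function[OF \<eta>]) (use \<epsilon>(2) x in blast)
      then show ?thesis using b(3) unfolding weak_partial_def by simp
    qed
    also have "\<dots> = cm m x"
      unfolding cm_def f_def if_True by (simp add: conv_restrict[OF \<Omega>(1)])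
    finally show ?thesis .
  qed
  have meas: "F \<in> borel_measurable (lebesgue_on \<Omega>)" "h \<in> borel_measurable (lebesgue_on \<Omega>)"
    "\<phi> \<in> borel_measurable (lebesgue_on \<Omega>)" "partial_deriv i \<phi> \<in> borel_measurable (lebesgue_on \<Omega>)"
    "b \<in> borel_measurable (lebesgue_on \<Omega>)" "b' \<in> borel_measurable (lebesgue_on \<Omega>)"
    "\<And>m. bm m \<in> borel_measurable (lebesgue_on \<Omega>)" "\<And>m. cm m \<in> borel_measurable (lebesgue_on \<Omega>)"
    using b(1,2) by (simp_all add: Linf_functions_def locally_integrable_imp_measurable[OF \<Omega>(1) loc(1)]
        locally_integrable_imp_measurable[OF \<Omega>(1) loc(2)] smooth_lebesgue_on_measurable smooth_partial_deriv K(1) sm)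
  note [measurable] = meas
  define L where "L m x = exp (bm m x) * ((partial_deriv i \<phi> x + cm m x *\<^sub>R \<phi> x) \<bullet> F x)" for m x
  define R where "R m x = exp (bm m x) * (\<phi> x \<bullet> h x)" for m x
  have eq: "(LINT x|lebesgue_on \<Omega>. L m x) = - (LINT x|lebesgue_on \<Omega>. R m x)" for m
  proof -
    define \<psi> where "\<psi> x = exp (bm m x) *\<^sub>R \<phi> x" for x
    have \<psi>: "\<psi> \<in> test_functions \<Omega>"
      unfolding \<psi>_def
      by (rule test_functionsI[OF smooth_scaleR[OF smooth_exp[OF sm(1)] K(1)] K(2,3)]) (simp add: K(4))
    have "partial_deriv i \<psi> x \<bullet> F x = L m x" for x
    proof -
      have "partial_deriv i \<psi> x = exp (bm m x) *\<^sub>R partial_deriv i \<phi> x + partial_deriv i (\<lambda>x. exp (bm m x)) x *\<^sub>R \<phi> x"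
        unfolding \<psi>_def
        by (rule partial_deriv_scaleR[OF smooth_differentiable[OF smooth_exp[OF sm(1)]] smooth_differentiable[OF K(1)]])
      also have "partial_deriv i (\<lambda>x. exp (bm m x)) x = exp (bm m x) * partial_deriv i (bm m) x"
        by (rule partial_deriv_compose[OF DERIV_exp smooth_differentiable[OF sm(1)]])
      finally show ?thesis
        using pd_bm[of x m] K(4,5)[of x] by (cases "x \<in> K") (auto simp: L_def algebra_simps)
    qed
    moreover have "\<psi> x \<bullet> h x = R m x" for x by (simp add: \<psi>_def R_def)
    ultimately show ?thesis using weak_partial_vector_test[OF \<Omega>(1) F \<psi>] by simp
  qed
  have lim': "AE x in lebesgue_on \<Omega>. (\<lambda>m. bm m x) \<longlonglongrightarrow> b x \<and> (\<lambda>m. cm m x) \<longlonglongrightarrow> b' x"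
  proof (subst AE_restrict_space_iff)
    show "AE x in lebesgue. x \<in> \<Omega> \<longrightarrow> (\<lambda>m. bm m x) \<longlonglongrightarrow> b x \<and> (\<lambda>m. cm m x) \<longlonglongrightarrow> b' x"
      using lim
    proof eventually_elim
      case (elim x)
      have "x \<in> \<Omega> \<Longrightarrow> f False x = b x" "x \<in> \<Omega> \<Longrightarrow> f True x = b' x" by (simp_all add: f_def)
      then show ?case using elim by (auto simp: bm_def cm_def UNIV_bool)
    qed
  qed (use \<Omega> in simp)
  have expB: "exp (bm m x) \<le> exp B" for m x using bd(1)[of m x] by (simp add: abs_le_iff)
  define w where "w q x = indicator K x * (exp B * (C + B' * C) * norm (q x))" for q :: "real^'n \<Rightarrow> 'b" and x
  have w_int: "integrable (lebesgue_on \<Omega>) (w q)" if "locally_integrable \<Omega> q" for q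
  proof (rule integrable_dominated_on_compact[OF \<Omega>(1) that K(2,3), where C = "exp B * (C + B' * C)"])
    have "K \<in> sets lebesgue" using K(2) by (simp add: compact_imp_closed)
    then have "indicat_real K \<in> borel_measurable (lebesgue_on \<Omega>)"
      by (intro measurable_restrict_space1 borel_measurable_indicator)
    moreover have "q \<in> borel_measurable (lebesgue_on \<Omega>)" by (rule locally_integrable_imp_measurable[OF \<Omega>(1) that])
    ultimately show "w q \<in> borel_measurable (lebesgue_on \<Omega>)" unfolding w_def by measurable
  qed (use B'(1) C in \<open>auto simp: w_def\<close>)
  have L_bound: "norm (L m x) \<le> w F x" for m x
  proof (cases "x \<in> K")
    case True
    have "norm (partial_deriv i \<phi> x + cm m x *\<^sub>R \<phi> x) \<le> norm (partial_deriv i \<phi> x) + \<bar>cm m x\<bar> * norm (\<phi> x)"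
      using norm_triangle_ineq[of "partial_deriv i \<phi> x" "cm m x *\<^sub>R \<phi> x"] by simp
    also have "\<dots> \<le> C + B' * C" using B'(1) C by (intro add_mono mult_mono K bd) auto
    finally have n: "norm (partial_deriv i \<phi> x + cm m x *\<^sub>R \<phi> x) \<le> C + B' * C" .
    have "norm (L m x) \<le> exp (bm m x) * (norm (partial_deriv i \<phi> x + cm m x *\<^sub>R \<phi> x) * norm (F x))"
      unfolding L_def norm_mult using Cauchy_Schwarz_ineq2 by (auto intro!: mult_left_mono)
    also have "\<dots> \<le> exp B * ((C + B' * C) * norm (F x))"
      using B'(1) C by (intro mult_mono expB n) auto
    finally show ?thesis using True by (simp add: w_def mult.assoc)
  qed (simp add: L_def w_def K(4,5))
  have R_bound: "norm (R m x) \<le> w h x" for m x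
  proof (cases "x \<in> K")
    case True
    have "norm (R m x) \<le> exp (bm m x) * (norm (\<phi> x) * norm (h x))"
      unfolding R_def norm_mult using Cauchy_Schwarz_ineq2 by (auto intro!: mult_left_mono)
    also have "\<dots> \<le> exp B * ((C + B' * C) * norm (h x))"
      using B'(1) C K(6)[of x] by (intro mult_mono expB) (auto intro: order_trans)
    finally show ?thesis using True by (simp add: w_def mult.assoc)
  qed (simp add: R_def w_def K(4,5))
  have "(\<lambda>m. LINT x|lebesgue_on \<Omega>. L m x) \<longlonglongrightarrow> (LINT x|lebesgue_on \<Omega>. exp (b x) * ((partial_deriv i \<phi> x + b' x *\<^sub>R \<phi> x) \<bullet> F x))"
  proof (rule integral_dominated_convergence[OF _ _ w_int[OF loc(1)] _ AE_I2[OF L_bound]])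
    show "AE x in lebesgue_on \<Omega>. (\<lambda>m. L m x) \<longlonglongrightarrow> exp (b x) * ((partial_deriv i \<phi> x + b' x *\<^sub>R \<phi> x) \<bullet> F x)"
      using lim' by eventually_elim (auto simp: L_def intro!: tendsto_intros)
  qed (unfold L_def, measurable)
  moreover have "(\<lambda>m. LINT x|lebesgue_on \<Omega>. R m x) \<longlonglongrightarrow> (LINT x|lebesgue_on \<Omega>. exp (b x) * (\<phi> x \<bullet> h x))"
  proof (rule integral_dominated_convergence[OF _ _ w_int[OF loc(2)] _ AE_I2[OF R_bound]])
    show "AE x in lebesgue_on \<Omega>. (\<lambda>m. R m x) \<longlonglongrightarrow> exp (b x) * (\<phi> x \<bullet> h x)"
      using lim' by eventually_elim (auto simp: R_def intro!: tendsto_intros)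
  qed (unfold R_def, measurable)
  ultimately show ?thesis
    unfolding eq using LIMSEQ_unique tendsto_minus by blast
qed

section \<open>The weighted symmetry of the elliptic operator\<close>

lemma square_integrable_sum:
  "(\<And>i. i \<in> I \<Longrightarrow> square_integrable M (f i)) \<Longrightarrow> square_integrable M (\<lambda>x. \<Sum>i\<in>I. f i x)"
  by (induction I rule: infinite_finite_induct) (auto intro: square_integrable_add square_integrable_zero)

lemma square_integrable_cong_AE:
  assumes "square_integrable M f" "g \<in> borel_measurable M" "AE x in M. g x = f x"
  shows "square_integrable M g"
proof -
  have [measurable]: "f \<in> borel_measurable M" and int: "integrable M (\<lambda>x. (norm (f x))\<^sup>2)"
    using assms(1) by (auto simp: square_integrable_def)
  have "integrable M (\<lambda>x. (norm (g x))\<^sup>2)"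
    by (rule integrable_cong_AE_imp[OF int]) (use assms(2,3) in \<open>auto elim: eventually_mono\<close>)
  then show ?thesis using assms(2) by (simp add: square_integrable_def)
qed

lemma L2_inner_tendsto:
  fixes q v :: "'a \<Rightarrow> 'b::euclidean_space"
  assumes q: "square_integrable M q" and f: "\<And>m::nat. square_integrable M (f m)" and v: "square_integrable M v"
    and lim: "(\<lambda>m. LINT x|M. (norm (f m x - v x))\<^sup>2) \<longlonglongrightarrow> 0"
  shows "(\<lambda>m. LINT x|M. f m x \<bullet> q x) \<longlonglongrightarrow> (LINT x|M. v x \<bullet> q x)"
proof (rule LIMSEQ_I)
  fix e :: real assume e: "0 < e"
  define c where "c = (LINT x|M. (norm (q x))\<^sup>2)"
  have c: "0 \<le> c" by (simp add: c_def)
  \<comment> \<open>Weight in Young's inequality \<open>2 |d \<bullet> q| \<le> |d|\<^sup>2 / t + t |q|\<^sup>2\<close>, small enough that the second term integrates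
    to at most \<open>e\<close>.\<close>
  define t where "t = e / (c + 1)"
  have t: "0 < t" "t * c \<le> e" using e c by (auto simp: t_def field_simps)
  obtain N where N: "\<And>m. N \<le> m \<Longrightarrow> (LINT x|M. (norm (f m x - v x))\<^sup>2) < e * t"
    using order_tendstoD(2)[OF lim, of "e * t"] e t by (auto simp: eventually_sequentially)
  show "\<exists>N. \<forall>m\<ge>N. norm ((LINT x|M. f m x \<bullet> q x) - (LINT x|M. v x \<bullet> q x)) < e"
  proof (intro exI[of _ N] allI impI)
    fix m assume m: "N \<le> m"
    let ?d = "\<lambda>x. f m x - v x"
    have d: "square_integrable M ?d" by (rule square_integrable_diff[OF f v])
    have int: "integrable M (\<lambda>x. (norm (?d x))\<^sup>2)" "integrable M (\<lambda>x. (norm (q x))\<^sup>2)" "integrable M (\<lambda>x. ?d x \<bullet> q x)"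
      using d q square_integrable_inner[OF d q] by (auto simp: square_integrable_def)
    have diff: "(LINT x|M. f m x \<bullet> q x) - (LINT x|M. v x \<bullet> q x) = (LINT x|M. ?d x \<bullet> q x)"
      using square_integrable_inner[OF f q] square_integrable_inner[OF v q] by (simp add: inner_diff_left)
    have "norm (LINT x|M. ?d x \<bullet> q x) \<le> (LINT x|M. norm (?d x \<bullet> q x))"
      by (rule integral_norm_bound)
    also have "\<dots> \<le> (LINT x|M. ((norm (?d x))\<^sup>2 / t + t * (norm (q x))\<^sup>2) / 2)"
    proof (rule integral_mono)
      fix x
      define s where "s = sqrt t"
      have s: "0 < s" "s\<^sup>2 = t" using t by (auto simp: s_def)
      have "2 * (norm (?d x) / s) * (s * norm (q x)) \<le> (norm (?d x) / s)\<^sup>2 + (s * norm (q x))\<^sup>2"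
        by (rule sum_squares_bound)
      then have "2 * (norm (?d x) * norm (q x)) \<le> (norm (?d x))\<^sup>2 / t + t * (norm (q x))\<^sup>2"
        using s by (simp add: power_divide power_mult_distrib)
      moreover have "norm (?d x \<bullet> q x) \<le> norm (?d x) * norm (q x)"
        using Cauchy_Schwarz_ineq2[of "?d x" "q x"] by simp
      ultimately have "2 * norm (?d x \<bullet> q x) \<le> (norm (?d x))\<^sup>2 / t + t * (norm (q x))\<^sup>2"
        by (meson mult_left_mono order_trans zero_le_numeral)
      then show "norm (?d x \<bullet> q x) \<le> ((norm (?d x))\<^sup>2 / t + t * (norm (q x))\<^sup>2) / 2" by simp
    qed (use int in auto)
    also have "\<dots> = ((LINT x|M. (norm (?d x))\<^sup>2) / t + t * c) / 2"
      using int by (simp add: c_def)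
    also have "\<dots> < e"
    proof -
      have "(LINT x|M. (norm (?d x))\<^sup>2) / t < e" using N[OF m] t(1) by (simp add: pos_divide_less_eq)
      then show ?thesis using t(2) by simp
    qed
    finally show "norm ((LINT x|M. f m x \<bullet> q x) - (LINT x|M. v x \<bullet> q x)) < e" unfolding diff .
  qed
qed

lemma test_function_square_integrable:
  fixes \<phi> :: "real^'n \<Rightarrow> 'b::euclidean_space"
  assumes \<Omega>: "open \<Omega>" "bounded \<Omega>" and \<phi>: "\<phi> \<in> test_functions \<Omega>"
  shows "square_integrable (lebesgue_on \<Omega>) \<phi>" "square_integrable (lebesgue_on \<Omega>) (partial_deriv i \<phi>)"
proof -
  interpret finite_measure "lebesgue_on \<Omega>"
    by (rule finite_measure_lebesgue_on[OF lmeasurable_open[OF \<Omega>(2,1)]])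
  obtain C where C: "smooth \<phi>" "\<And>x. norm (\<phi> x) \<le> C" "\<And>i x. norm (partial_deriv i \<phi> x) \<le> C"
    using test_functionsE[OF \<phi>] by metis
  have "square_integrable (lebesgue_on \<Omega>) q" if q: "smooth q" "\<And>x. norm (q x) \<le> C" for q :: "real^'n \<Rightarrow> 'b"
    unfolding square_integrable_def
  proof
    show [measurable]: "q \<in> borel_measurable (lebesgue_on \<Omega>)" by (rule smooth_lebesgue_on_measurable[OF q(1)])
    show "integrable (lebesgue_on \<Omega>) (\<lambda>x. (norm (q x))\<^sup>2)"
      by (rule integrable_const_bound[where B = "C\<^sup>2"]) (use q(2) in \<open>auto intro!: AE_I2 power_mono\<close>)
  qed
  then show "square_integrable (lebesgue_on \<Omega>) \<phi>" "square_integrable (lebesgue_on \<Omega>) (partial_deriv i \<phi>)"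
    using C smooth_partial_deriv by blast+
qed

lemma square_integrable_lebesgue_on:
  "square_integrable lebesgue f \<Longrightarrow> open \<Omega> \<Longrightarrow> square_integrable (lebesgue_on \<Omega>) f"
  unfolding square_integrable_def
  by (auto intro!: measurable_restrict_space1 integrable_mult_indicator[of _ lebesgue, where 'b = real, simplified]
      simp: integrable_restrict_space)

text \<open>The gradient that appears in the definition of \<^const>\<open>H1_0\<close> agrees almost everywhere with any other weak gradient,
so the approximating test functions converge to \<open>v\<close> and \<open>g\<close>; only weak convergence is recorded.\<close>

lemma H1_0_approximation:
  fixes v :: "real^'n \<Rightarrow> 'b::euclidean_space"
  assumes \<Omega>: "open \<Omega>" "bounded \<Omega>" and v: "v \<in> H1_0 \<Omega>"
    and g: "\<And>i. weak_partial \<Omega> i v (g i)" "\<And>i. square_integrable (lebesgue_on \<Omega>) (g i)"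
  obtains \<phi> where "\<And>m::nat. \<phi> m \<in> test_functions \<Omega>"
    "\<And>q. square_integrable (lebesgue_on \<Omega>) q \<Longrightarrow> (\<lambda>m. LINT x|lebesgue_on \<Omega>. \<phi> m x \<bullet> q x) \<longlonglongrightarrow> (LINT x|lebesgue_on \<Omega>. v x \<bullet> q x)"
    "\<And>q i. square_integrable (lebesgue_on \<Omega>) q \<Longrightarrow> (\<lambda>m. LINT x|lebesgue_on \<Omega>. partial_deriv i (\<phi> m) x \<bullet> q x) \<longlonglongrightarrow> (LINT x|lebesgue_on \<Omega>. g i x \<bullet> q x)"
proof -
  obtain G \<phi> where G: "\<And>i. weak_partial \<Omega> i v (G i)" and \<phi>: "\<And>m::nat. \<phi> m \<in> test_functions \<Omega>"
    and l0: "(\<lambda>m. LINT x|lebesgue_on \<Omega>. (norm (\<phi> m x - v x))\<^sup>2) \<longlonglongrightarrow> 0"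
    and l1: "\<And>i. (\<lambda>m. LINT x|lebesgue_on \<Omega>. (norm (partial_deriv i (\<phi> m) x - G i x))\<^sup>2) \<longlonglongrightarrow> 0"
    using v by (auto simp: H1_0_def)
  have v2: "square_integrable (lebesgue_on \<Omega>) v" using v by (simp add: H1_0_def H_sob_def L2_functions_def)
  have G2: "square_integrable (lebesgue_on \<Omega>) (G i)" and eq: "AE x in lebesgue_on \<Omega>. G i x = g i x" for i
  proof -
    show eq: "AE x in lebesgue_on \<Omega>. G i x = g i x" by (rule weak_partial_unique[OF \<Omega>(1) G g(1)])
    show "square_integrable (lebesgue_on \<Omega>) (G i)"
      by (rule square_integrable_cong_AE[OF g(2) locally_integrable_imp_measurable[OF \<Omega>(1)] eq])
        (use G in \<open>simp add: weak_partial_def\<close>)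
  qed
  note T = test_function_square_integrable[OF \<Omega> \<phi>]
  show ?thesis
  proof (rule that[OF \<phi>])
    fix q :: "real^'n \<Rightarrow> 'b" and i assume q: "square_integrable (lebesgue_on \<Omega>) q"
    show "(\<lambda>m. LINT x|lebesgue_on \<Omega>. \<phi> m x \<bullet> q x) \<longlonglongrightarrow> (LINT x|lebesgue_on \<Omega>. v x \<bullet> q x)"
      by (rule L2_inner_tendsto[OF q T(1) v2 l0])
    have "(\<lambda>m. LINT x|lebesgue_on \<Omega>. partial_deriv i (\<phi> m) x \<bullet> q x) \<longlonglongrightarrow> (LINT x|lebesgue_on \<Omega>. G i x \<bullet> q x)"
      by (rule L2_inner_tendsto[OF q T(2) G2 l1])
    also have "(LINT x|lebesgue_on \<Omega>. G i x \<bullet> q x) = (LINT x|lebesgue_on \<Omega>. g i x \<bullet> q x)"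
      by (rule integral_cong_AE)
        (use q G2[of i] g(2)[of i] eq[of i] in \<open>auto simp: square_integrable_def elim: eventually_mono\<close>)
    finally show "(\<lambda>m. LINT x|lebesgue_on \<Omega>. partial_deriv i (\<phi> m) x \<bullet> q x) \<longlonglongrightarrow> (LINT x|lebesgue_on \<Omega>. g i x \<bullet> q x)" .
  qed
qed

lemma H2_weak_partial_square_integrable:
  fixes u :: "real^'n \<Rightarrow> 'b::euclidean_space"
  assumes \<Omega>: "open \<Omega>" and u: "u \<in> H_sob 2 \<Omega>" and g: "weak_partial \<Omega> i u g"
  shows "square_integrable (lebesgue_on \<Omega>) g"
proof -
  have "\<exists>G \<in> sobolev (L2_functions \<Omega>) \<Omega> (Suc 0). weak_partial \<Omega> i u G"
    using u by (simp add: H_sob_def numeral_2_eq_2)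
  then obtain G where G: "G \<in> sobolev (L2_functions \<Omega>) \<Omega> (Suc 0)" "weak_partial \<Omega> i u G" by blast
  have "square_integrable (lebesgue_on \<Omega>) G" using G(1) by (simp add: L2_functions_def)
  then show ?thesis
    by (rule square_integrable_cong_AE[OF _ locally_integrable_imp_measurable[OF \<Omega>] weak_partial_unique[OF \<Omega> g G(2)]])
      (use g in \<open>simp add: weak_partial_def\<close>)
qed

locale gradient_drift =
  fixes \<Omega> :: "(real^'n) set" and A :: "real^'n \<Rightarrow> real^'n^'n" and B :: "real^'n \<Rightarrow> real^'n"
    and p b :: "real^'n \<Rightarrow> real" and b' :: "real^'n \<Rightarrow> real^'n"
  assumes \<Omega>: "open \<Omega>" "bounded \<Omega>"
    and A_Linf: "\<And>i j. (\<lambda>x. A x $ i $ j) \<in> Linf_functions \<Omega>"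
    and A_sym: "\<And>x i j. x \<in> \<Omega> \<Longrightarrow> A x $ i $ j = A x $ j $ i"
    and p_Linf: "p \<in> Linf_functions \<Omega>"
    and b_Linf: "b \<in> Linf_functions \<Omega>"
    and b'_Linf: "\<And>i. (\<lambda>x. b' x $ i) \<in> Linf_functions \<Omega>"
    and b': "\<And>i. weak_partial \<Omega> i b (\<lambda>x. b' x $ i)"
    and drift: "AE x in lebesgue_on \<Omega>. B x = A x *v b' x"
begin

abbreviation M where "M \<equiv> lebesgue_on \<Omega>"

definition flux :: "('n \<Rightarrow> real^'n \<Rightarrow> 'b::euclidean_space) \<Rightarrow> 'n \<Rightarrow> real^'n \<Rightarrow> 'b" where
  "flux g i x = (\<Sum>j\<in>UNIV. A x $ i $ j *\<^sub>R g j x)"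

lemma Linf_mult_square_integrable:
  assumes "m \<in> Linf_functions \<Omega>" "square_integrable M f"
  shows "square_integrable M (\<lambda>x. m x *\<^sub>R f x)"
  using assms square_integrable_bounded_mult[OF assms(2), of m] by (auto simp: Linf_functions_def)

lemma Linf_mult_integrable:
  fixes f :: "real^'n \<Rightarrow> real"
  assumes m: "m \<in> Linf_functions \<Omega>" and f: "integrable M f"
  shows "integrable M (\<lambda>x. m x * f x)"
proof -
  obtain C where C: "AE x in M. norm (m x) \<le> C" and m_meas[measurable]: "m \<in> borel_measurable M"
    using m by (auto simp: Linf_functions_def)
  have [measurable]: "f \<in> borel_measurable M" using f by auto
  show ?thesis
  proof (rule Bochner_Integration.integrable_bound)
    show "integrable M (\<lambda>x. \<bar>C\<bar> * f x)" using f by simp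
    show "AE x in M. norm (m x * f x) \<le> norm (\<bar>C\<bar> * f x)"
      using C by eventually_elim (auto simp: abs_mult intro!: mult_right_mono)
  qed measurable
qed

lemma exp_b_Linf: "(\<lambda>x. exp (b x)) \<in> Linf_functions \<Omega>"
proof -
  obtain C where C: "AE x in M. norm (b x) \<le> C" and [measurable]: "b \<in> borel_measurable M"
    using b_Linf by (auto simp: Linf_functions_def)
  have "AE x in M. norm (exp (b x)) \<le> exp C" using C by eventually_elim auto
  moreover have "(\<lambda>x. exp (b x)) \<in> borel_measurable M" by measurable
  ultimately show ?thesis unfolding Linf_functions_def by blast
qed

lemma flux_square_integrable:
  "(\<And>i. square_integrable M (g i)) \<Longrightarrow> square_integrable M (flux g i)"
  unfolding flux_def by (intro square_integrable_sum Linf_mult_square_integrable A_Linf)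

text \<open>Differentiating the weight in the integration by parts produces \<open>\<Sum>\<^sub>i \<partial>\<^sub>i b (A \<nabla>u)\<^sub>i\<close>, which equals \<open>B \<cdot> \<nabla>u\<close> by the
symmetry of \<open>A\<close> and cancels the drift. The identity is stated for test functions since the single derivatives
\<open>h i\<close> are known to be locally integrable only, whereas all functions paired with \<open>\<phi>\<close> and its derivatives in the
conclusion are square integrable, so that \<open>\<phi>\<close> may afterwards tend to an element of \<^const>\<open>H1_0\<close>.\<close>

lemma weighted_test_identity:
  fixes u w \<phi> :: "real^'n \<Rightarrow> 'b::euclidean_space"
  assumes u: "square_integrable M u" and w: "square_integrable M w" and g: "\<And>i. square_integrable M (g i)"
    and h: "\<And>i. weak_partial \<Omega> i (flux g i) (h i)"
    and eq: "AE x in M. w x = (\<Sum>i\<in>UNIV. h i x) + (\<Sum>j\<in>UNIV. B x $ j *\<^sub>R g j x) + p x *\<^sub>R u x"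
    and \<phi>: "\<phi> \<in> test_functions \<Omega>"
  shows "(LINT x|M. \<phi> x \<bullet> (exp (b x) *\<^sub>R w x)) =
    (LINT x|M. \<phi> x \<bullet> (exp (b x) *\<^sub>R p x *\<^sub>R u x)) - (\<Sum>i\<in>UNIV. LINT x|M. partial_deriv i \<phi> x \<bullet> (exp (b x) *\<^sub>R flux g i x))"
proof -
  note T = test_function_square_integrable[OF \<Omega> \<phi>]
  note E = Linf_mult_square_integrable[OF exp_b_Linf]
  have F: "square_integrable M (flux g i)" for i by (rule flux_square_integrable[OF g])
  have i1: "integrable M (\<lambda>x. partial_deriv i \<phi> x \<bullet> (exp (b x) *\<^sub>R flux g i x))" for i
    by (intro square_integrable_inner T E F)
  have i2: "integrable M (\<lambda>x. \<phi> x \<bullet> (exp (b x) *\<^sub>R b' x $ i *\<^sub>R flux g i x))" for i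
    by (intro square_integrable_inner T E Linf_mult_square_integrable b'_Linf F)
  have i3: "integrable M (\<lambda>x. \<phi> x \<bullet> (exp (b x) *\<^sub>R p x *\<^sub>R u x))"
    by (intro square_integrable_inner T E Linf_mult_square_integrable p_Linf u)
  have i4: "integrable M (\<lambda>x. \<phi> x \<bullet> (exp (b x) *\<^sub>R w x))"
    by (intro square_integrable_inner T E w)
  have i5: "integrable M (\<lambda>x. \<phi> x \<bullet> (exp (b x) *\<^sub>R h i x))" for i
  proof -
    obtain K C where K: "smooth \<phi>" "compact K" "K \<subseteq> \<Omega>" "\<And>x. x \<notin> K \<Longrightarrow> \<phi> x = 0" "\<And>x. norm (\<phi> x) \<le> C"
      using test_functionsE[OF \<phi>] by metis
    have loc: "locally_integrable \<Omega> (h i)" using h[of i] by (simp add: weak_partial_def)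
    have "integrable M (\<lambda>x. \<phi> x \<bullet> h i x)"
    proof (rule integrable_dominated_on_compact[OF \<Omega>(1) loc K(2,3)])
      show "(\<lambda>x. \<phi> x \<bullet> h i x) \<in> borel_measurable M"
        using smooth_lebesgue_on_measurable[OF K(1)] locally_integrable_imp_measurable[OF \<Omega>(1) loc]
        by (rule borel_measurable_inner)
      show "norm (\<phi> x \<bullet> h i x) \<le> C * norm (h i x)" for x
        using Cauchy_Schwarz_ineq2[of "\<phi> x" "h i x"] mult_right_mono[OF K(5)[of x], of "norm (h i x)"] by simp
    qed (simp add: K(4))
    from Linf_mult_integrable[OF exp_b_Linf this] show ?thesis by simp
  qed
  have parts: "(LINT x|M. \<phi> x \<bullet> (exp (b x) *\<^sub>R h i x)) = - (LINT x|M. partial_deriv i \<phi> x \<bullet> (exp (b x) *\<^sub>R flux g i x))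
      - (LINT x|M. \<phi> x \<bullet> (exp (b x) *\<^sub>R b' x $ i *\<^sub>R flux g i x))" for i
  proof -
    have "(LINT x|M. partial_deriv i \<phi> x \<bullet> (exp (b x) *\<^sub>R flux g i x)) + (LINT x|M. \<phi> x \<bullet> (exp (b x) *\<^sub>R b' x $ i *\<^sub>R flux g i x))
      = (LINT x|M. partial_deriv i \<phi> x \<bullet> (exp (b x) *\<^sub>R flux g i x) + \<phi> x \<bullet> (exp (b x) *\<^sub>R b' x $ i *\<^sub>R flux g i x))"
      by (rule Bochner_Integration.integral_add[OF i1 i2, symmetric])
    also have "\<dots> = (LINT x|M. exp (b x) * ((partial_deriv i \<phi> x + b' x $ i *\<^sub>R \<phi> x) \<bullet> flux g i x))"
      by (intro Bochner_Integration.integral_cong refl) (simp add: inner_add_left algebra_simps)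
    also have "\<dots> = - (LINT x|M. exp (b x) * (\<phi> x \<bullet> h i x))"
      by (rule weak_partial_exp_weight[OF \<Omega> h \<phi> b_Linf b'_Linf b'])
    finally show ?thesis by simp
  qed
  have "AE x in M. \<phi> x \<bullet> (exp (b x) *\<^sub>R w x) = (\<Sum>i\<in>UNIV. \<phi> x \<bullet> (exp (b x) *\<^sub>R h i x)) +
      (\<Sum>i\<in>UNIV. \<phi> x \<bullet> (exp (b x) *\<^sub>R b' x $ i *\<^sub>R flux g i x)) + \<phi> x \<bullet> (exp (b x) *\<^sub>R p x *\<^sub>R u x)"
    using eq drift AE_space
  proof eventually_elim
    case (elim x)
    then have x: "x \<in> \<Omega>" by simp
    have "(\<Sum>j\<in>UNIV. B x $ j *\<^sub>R g j x) = (\<Sum>j\<in>UNIV. \<Sum>i\<in>UNIV. (A x $ j $ i * b' x $ i) *\<^sub>R g j x)"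
      using elim(2) by (simp add: matrix_vector_mult_def scaleR_sum_left)
    also have "\<dots> = (\<Sum>i\<in>UNIV. \<Sum>j\<in>UNIV. (A x $ i $ j * b' x $ i) *\<^sub>R g j x)"
      using A_sym[OF x] by (subst sum.swap) (simp cong: sum.cong)
    also have "\<dots> = (\<Sum>i\<in>UNIV. b' x $ i *\<^sub>R flux g i x)"
      by (simp add: flux_def scaleR_sum_right mult.commute)
    finally show ?case
      unfolding elim(1) by (simp add: scaleR_add_right inner_add_right scaleR_sum_right inner_sum_right del: inner_scaleR_right)
  qed
  then have "(LINT x|M. \<phi> x \<bullet> (exp (b x) *\<^sub>R w x)) = (LINT x|M. (\<Sum>i\<in>UNIV. \<phi> x \<bullet> (exp (b x) *\<^sub>R h i x)) +
      (\<Sum>i\<in>UNIV. \<phi> x \<bullet> (exp (b x) *\<^sub>R b' x $ i *\<^sub>R flux g i x)) + \<phi> x \<bullet> (exp (b x) *\<^sub>R p x *\<^sub>R u x))"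
    by (intro integral_cong_AE borel_measurable_integrable Bochner_Integration.integrable_add
        Bochner_Integration.integrable_sum i2 i3 i4 i5)
  also have "\<dots> = (\<Sum>i\<in>UNIV. LINT x|M. \<phi> x \<bullet> (exp (b x) *\<^sub>R h i x)) +
      (\<Sum>i\<in>UNIV. LINT x|M. \<phi> x \<bullet> (exp (b x) *\<^sub>R b' x $ i *\<^sub>R flux g i x)) + (LINT x|M. \<phi> x \<bullet> (exp (b x) *\<^sub>R p x *\<^sub>R u x))"
    using i2 i3 i5 by (simp only: Bochner_Integration.integral_add Bochner_Integration.integral_sum
        Bochner_Integration.integrable_add Bochner_Integration.integrable_sum)
  also have "\<dots> = (LINT x|M. \<phi> x \<bullet> (exp (b x) *\<^sub>R p x *\<^sub>R u x)) - (\<Sum>i\<in>UNIV. LINT x|M. partial_deriv i \<phi> x \<bullet> (exp (b x) *\<^sub>R flux g i x))"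
    unfolding parts by (simp add: sum_subtractf sum_negf)
  finally show ?thesis .
qed

text \<open>With \<open>\<phi> \<rightarrow> v\<close> in the previous identity, its right-hand side becomes a form in \<open>u\<close> and \<open>v\<close> that is symmetric
because \<open>A\<close> is.\<close>

lemma graph_symmetric:
  fixes u v :: "(real^'n, 'b::euclidean_space) l2"
  assumes uw: "(u, w) \<in> elliptic_graph \<Omega> A B p" and vz: "(v, z) \<in> elliptic_graph \<Omega> A B p"
  shows "(LINT x|M. exp (b x) * (rep_l2 w x \<bullet> rep_l2 v x)) = (LINT x|M. exp (b x) * (rep_l2 u x \<bullet> rep_l2 z x))"
proof -
  have rep: "square_integrable M (rep_l2 f)" for f :: "(real^'n, 'b) l2"
    by (rule square_integrable_lebesgue_on[OF square_integrable_rep_l2 \<Omega>(1)])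
  note E = Linf_mult_square_integrable[OF exp_b_Linf]
  have data: "\<exists>g h. (\<forall>i. weak_partial \<Omega> i (rep_l2 u) (g i)) \<and> (\<forall>i. square_integrable M (g i)) \<and>
      (\<forall>i. weak_partial \<Omega> i (flux g i) (h i)) \<and>
      (AE x in M. rep_l2 w x = (\<Sum>i\<in>UNIV. h i x) + (\<Sum>j\<in>UNIV. B x $ j *\<^sub>R g j x) + p x *\<^sub>R rep_l2 u x)"
    if "(u, w) \<in> elliptic_graph \<Omega> A B p" for u w :: "(real^'n, 'b) l2"
  proof -
    have u: "rep_l2 u \<in> H_sob 2 \<Omega>" and "elliptic_eq \<Omega> A B p (rep_l2 u) (rep_l2 w)"
      using that by (auto simp: elliptic_graph_def)
    then show ?thesis
      unfolding elliptic_eq_def flux_def[abs_def] using H2_weak_partial_square_integrable[OF \<Omega>(1) u] by blast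
  qed
  have green: "(LINT x|M. rep_l2 v x \<bullet> (exp (b x) *\<^sub>R rep_l2 w x)) =
      (LINT x|M. rep_l2 v x \<bullet> (exp (b x) *\<^sub>R p x *\<^sub>R rep_l2 u x)) - (\<Sum>i\<in>UNIV. LINT x|M. k i x \<bullet> (exp (b x) *\<^sub>R flux g i x))"
    if v: "rep_l2 v \<in> H1_0 \<Omega>" and k: "\<And>i. weak_partial \<Omega> i (rep_l2 v) (k i)" "\<And>i. square_integrable M (k i)"
      and g: "\<And>i. square_integrable M (g i)" and h: "\<And>i. weak_partial \<Omega> i (flux g i) (h i)"
      and eq: "AE x in M. rep_l2 w x = (\<Sum>i\<in>UNIV. h i x) + (\<Sum>j\<in>UNIV. B x $ j *\<^sub>R g j x) + p x *\<^sub>R rep_l2 u x"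
    for u w v :: "(real^'n, 'b) l2" and g h k
  proof -
    obtain \<phi> where \<phi>: "\<And>m::nat. \<phi> m \<in> test_functions \<Omega>"
      and l0: "\<And>q. square_integrable M q \<Longrightarrow> (\<lambda>m. LINT x|M. \<phi> m x \<bullet> q x) \<longlonglongrightarrow> (LINT x|M. rep_l2 v x \<bullet> q x)"
      and l1: "\<And>q i. square_integrable M q \<Longrightarrow> (\<lambda>m. LINT x|M. partial_deriv i (\<phi> m) x \<bullet> q x) \<longlonglongrightarrow> (LINT x|M. k i x \<bullet> q x)"
      by (rule H1_0_approximation[OF \<Omega> v k]) (rule that)
    have "(\<lambda>m. LINT x|M. \<phi> m x \<bullet> (exp (b x) *\<^sub>R rep_l2 w x)) \<longlonglongrightarrow> (LINT x|M. rep_l2 v x \<bullet> (exp (b x) *\<^sub>R rep_l2 w x))"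
      by (intro l0 E rep)
    moreover have "(\<lambda>m. LINT x|M. \<phi> m x \<bullet> (exp (b x) *\<^sub>R rep_l2 w x)) \<longlonglongrightarrow>
        (LINT x|M. rep_l2 v x \<bullet> (exp (b x) *\<^sub>R p x *\<^sub>R rep_l2 u x)) - (\<Sum>i\<in>UNIV. LINT x|M. k i x \<bullet> (exp (b x) *\<^sub>R flux g i x))"
      unfolding weighted_test_identity[OF rep rep g h eq \<phi>]
      by (intro tendsto_diff tendsto_sum l0 l1 E Linf_mult_square_integrable[OF p_Linf] rep flux_square_integrable g)
    ultimately show ?thesis by (rule LIMSEQ_unique)
  qed
  obtain gu hu where gu: "\<And>i. weak_partial \<Omega> i (rep_l2 u) (gu i)" "\<And>i. square_integrable M (gu i)" "\<And>i. weak_partial \<Omega> i (flux gu i) (hu i)"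
      "AE x in M. rep_l2 w x = (\<Sum>i\<in>UNIV. hu i x) + (\<Sum>j\<in>UNIV. B x $ j *\<^sub>R gu j x) + p x *\<^sub>R rep_l2 u x"
    using data[OF uw] by blast
  obtain gv hv where gv: "\<And>i. weak_partial \<Omega> i (rep_l2 v) (gv i)" "\<And>i. square_integrable M (gv i)" "\<And>i. weak_partial \<Omega> i (flux gv i) (hv i)"
      "AE x in M. rep_l2 z x = (\<Sum>i\<in>UNIV. hv i x) + (\<Sum>j\<in>UNIV. B x $ j *\<^sub>R gv j x) + p x *\<^sub>R rep_l2 v x"
    using data[OF vz] by blast
  have H: "rep_l2 u \<in> H1_0 \<Omega>" "rep_l2 v \<in> H1_0 \<Omega>" using uw vz by (auto simp: elliptic_graph_def)
  note G1 = green[OF H(2) gv(1,2) gu(2,3,4)]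
  note G2 = green[OF H(1) gu(1,2) gv(2,3,4)]
  have int: "integrable M (\<lambda>x. k i x \<bullet> (exp (b x) *\<^sub>R flux g i x))"
    if "\<And>i. square_integrable M (k i)" "\<And>i. square_integrable M (g i)" for k g :: "'n \<Rightarrow> real^'n \<Rightarrow> 'b" and i
    by (intro square_integrable_inner E flux_square_integrable that)
  have "(\<Sum>i\<in>UNIV. LINT x|M. gv i x \<bullet> (exp (b x) *\<^sub>R flux gu i x)) = (LINT x|M. (\<Sum>i\<in>UNIV. gv i x \<bullet> (exp (b x) *\<^sub>R flux gu i x)))"
    by (rule Bochner_Integration.integral_sum[symmetric]) (rule int[OF gv(2) gu(2)])
  also have "\<dots> = (LINT x|M. (\<Sum>i\<in>UNIV. gu i x \<bullet> (exp (b x) *\<^sub>R flux gv i x)))"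
  proof (rule Bochner_Integration.integral_cong[OF refl])
    fix x assume "x \<in> space M"
    then have x: "x \<in> \<Omega>" by simp
    have "(\<Sum>i\<in>UNIV. gv i x \<bullet> (exp (b x) *\<^sub>R flux gu i x)) = (\<Sum>i\<in>UNIV. \<Sum>j\<in>UNIV. exp (b x) * (A x $ i $ j * (gv i x \<bullet> gu j x)))"
      by (simp add: flux_def inner_sum_right sum_distrib_left)
    also have "\<dots> = (\<Sum>i\<in>UNIV. \<Sum>j\<in>UNIV. exp (b x) * (A x $ i $ j * (gu i x \<bullet> gv j x)))"
      using A_sym[OF x] by (subst sum.swap) (simp add: inner_commute cong: sum.cong)
    also have "\<dots> = (\<Sum>i\<in>UNIV. gu i x \<bullet> (exp (b x) *\<^sub>R flux gv i x))"
      by (simp add: flux_def inner_sum_right sum_distrib_left)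
    finally show "(\<Sum>i\<in>UNIV. gv i x \<bullet> (exp (b x) *\<^sub>R flux gu i x)) = (\<Sum>i\<in>UNIV. gu i x \<bullet> (exp (b x) *\<^sub>R flux gv i x))" .
  qed
  also have "\<dots> = (\<Sum>i\<in>UNIV. LINT x|M. gu i x \<bullet> (exp (b x) *\<^sub>R flux gv i x))"
    by (rule Bochner_Integration.integral_sum) (rule int[OF gu(2) gv(2)])
  finally have "(LINT x|M. rep_l2 v x \<bullet> (exp (b x) *\<^sub>R rep_l2 w x)) = (LINT x|M. rep_l2 u x \<bullet> (exp (b x) *\<^sub>R rep_l2 z x))"
    using G1 G2 by (simp add: inner_commute)
  then show ?thesis by (simp add: inner_commute)
qed

lemma weighted_form:
  obtains \<beta> :: "(real^'n, 'b::euclidean_space) l2 \<Rightarrow> (real^'n, 'b) l2 \<Rightarrow> real"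
  where "bounded_bilinear \<beta>" "\<And>f g. \<beta> f g = (LINT x|M. exp (b x) * (rep_l2 f x \<bullet> rep_l2 g x))"
    "\<And>f. 0 \<le> \<beta> f f" "\<And>f. f \<in> L2_on \<Omega> \<Longrightarrow> \<beta> f f = 0 \<Longrightarrow> f = 0"
proof -
  obtain C where C: "AE x in M. norm (b x) \<le> C" and b_meas[measurable]: "b \<in> borel_measurable M"
    using b_Linf by (auto simp: Linf_functions_def)
  \<comment> \<open>The weight \<open>e^b\<close>, changed on a null set so that it is bounded everywhere.\<close>
  define c where "c x = (if \<bar>b x\<bar> \<le> C then exp (b x) else 0)" for x
  define m where "m x = indicator \<Omega> x * c x" for x
  have [measurable]: "\<Omega> \<in> sets lebesgue" using \<Omega>(1) by simp
  have "c \<in> borel_measurable M" unfolding c_def by measurable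
  then have m_meas[measurable]: "m \<in> borel_measurable lebesgue"
    unfolding m_def by (subst (asm) borel_measurable_restrict_space_iff) auto
  have m_bound: "\<bar>m x\<bar> \<le> exp C" for x by (auto simp: m_def c_def indicator_def abs_le_iff)
  define \<beta> where "\<beta> f g = l2_mult m f \<bullet> g" for f g :: "(real^'n, 'b) l2"
  have \<beta>_m: "\<beta> f g = (LINT x|lebesgue. m x * (rep_l2 f x \<bullet> rep_l2 g x))" for f g
    unfolding \<beta>_def inner_l2_eq
  proof (rule integral_cong_AE)
    show "AE x in lebesgue. rep_l2 (l2_mult m f) x \<bullet> rep_l2 g x = m x * (rep_l2 f x \<bullet> rep_l2 g x)"
      using rep_l2_mult[OF m_meas m_bound, of f] by eventually_elim simp
  qed measurable
  have bil: "bounded_bilinear \<beta>"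
    unfolding \<beta>_def by (rule bounded_bilinear.comp1[OF bounded_bilinear_inner bounded_linear_l2_mult[OF m_meas m_bound]])
  have \<beta>: "\<beta> f g = (LINT x|M. exp (b x) * (rep_l2 f x \<bullet> rep_l2 g x))" for f g
  proof -
    have "\<beta> f g = (LINT x|M. c x * (rep_l2 f x \<bullet> rep_l2 g x))"
      unfolding \<beta>_m by (subst integral_restrict_space) (auto simp: m_def mult.assoc)
    also have "\<dots> = (LINT x|M. exp (b x) * (rep_l2 f x \<bullet> rep_l2 g x))"
    proof (rule integral_cong_AE)
      show "AE x in M. c x * (rep_l2 f x \<bullet> rep_l2 g x) = exp (b x) * (rep_l2 f x \<bullet> rep_l2 g x)"
        using C by eventually_elim (simp add: c_def)
      have [measurable]: "rep_l2 h \<in> borel_measurable M" for h :: "(real^'n, 'b) l2"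
        by (intro measurable_restrict_space1 rep_l2_measurable)
      show "(\<lambda>x. c x * (rep_l2 f x \<bullet> rep_l2 g x)) \<in> borel_measurable M" unfolding c_def by measurable
      show "(\<lambda>x. exp (b x) * (rep_l2 f x \<bullet> rep_l2 g x)) \<in> borel_measurable M" by measurable
    qed
    finally show ?thesis .
  qed
  show ?thesis
  proof (rule that[OF bil \<beta>])
    show "0 \<le> \<beta> f f" for f unfolding \<beta> by simp
    fix f :: "(real^'n, 'b) l2" assume f: "f \<in> L2_on \<Omega>" and zero: "\<beta> f f = 0"
    have sq: "square_integrable M (rep_l2 f)"
      by (rule square_integrable_lebesgue_on[OF square_integrable_rep_l2 \<Omega>(1)])
    have "integrable M (\<lambda>x. exp (b x) * (rep_l2 f x \<bullet> rep_l2 f x))"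
      by (rule Linf_mult_integrable[OF exp_b_Linf square_integrable_inner[OF sq sq]])
    then have "AE x in M. exp (b x) * (rep_l2 f x \<bullet> rep_l2 f x) = 0"
      using zero unfolding \<beta> by (subst (asm) integral_nonneg_eq_0_iff_AE) auto
    then have "AE x in lebesgue. x \<in> \<Omega> \<longrightarrow> rep_l2 f x = 0"
      using \<Omega>(1) by (subst (asm) AE_restrict_space_iff) auto
    moreover have "AE x in lebesgue. x \<notin> \<Omega> \<longrightarrow> rep_l2 f x = 0" using f by (simp add: L2_on_def)
    ultimately have "AE x in lebesgue. rep_l2 f x = rep_l2 0 x"
      using rep_l2_zero by eventually_elim auto
    then show "f = 0" by (rule l2_eqI)
  qed
qed

end

lemma
  fixes \<Omega> :: "'a::euclidean_space set" and f :: "('a, 'b::euclidean_space) l2"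
  assumes \<Omega>: "\<Omega> \<in> sets lebesgue"
  shows L2_on_projection_bounded_linear: "bounded_linear (l2_mult (indicator \<Omega>) :: ('a, 'b) l2 \<Rightarrow> _)"
    and L2_on_projection_in: "l2_mult (indicator \<Omega>) f \<in> L2_on \<Omega>"
    and L2_on_projection_id: "f \<in> L2_on \<Omega> \<Longrightarrow> l2_mult (indicator \<Omega>) f = f"
proof -
  have ind: "(indicator \<Omega> :: 'a \<Rightarrow> real) \<in> borel_measurable lebesgue" "\<bar>indicator \<Omega> x :: real\<bar> \<le> 1" for x
    using \<Omega> by (auto simp: indicator_def)
  note rep = rep_l2_mult[OF ind, of f]
  show "bounded_linear (l2_mult (indicator \<Omega>) :: ('a, 'b) l2 \<Rightarrow> _)" by (rule bounded_linear_l2_mult[OF ind])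
  show "l2_mult (indicator \<Omega>) f \<in> L2_on \<Omega>"
    unfolding L2_on_def using rep by (auto elim: eventually_mono)
  show "l2_mult (indicator \<Omega>) f = f" if "f \<in> L2_on \<Omega>"
  proof (rule l2_eqI)
    have "AE x in lebesgue. x \<notin> \<Omega> \<longrightarrow> rep_l2 f x = 0" using that by (simp add: L2_on_def)
    then show "AE x in lebesgue. rep_l2 (l2_mult (indicator \<Omega>) f) x = rep_l2 f x"
      using rep
    proof eventually_elim
      case (elim x)
      then show ?case by (cases "x \<in> \<Omega>") auto
    qed
  qed
qed

section \<open>Backward uniqueness\<close>

lemma C1_closure_imp_Linf:
  assumes "open \<Omega>" "bounded \<Omega>" "C1_closure \<Omega> f"
  shows "f \<in> Linf_functions \<Omega>"
proof -
  have c: "continuous_on (closure \<Omega>) f" using assms(3) by (simp add: C1_closure_def)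
  have "bounded (f ` closure \<Omega>)"
    using assms(2) by (intro compact_imp_bounded compact_continuous_image c) (simp add: compact_closure)
  then obtain C where C: "\<And>x. x \<in> closure \<Omega> \<Longrightarrow> norm (f x) \<le> C" by (auto simp: bounded_iff)
  have "f \<in> borel_measurable (lebesgue_on \<Omega>)"
    using assms(1) by (intro continuous_imp_measurable_on_sets_lebesgue continuous_on_subset[OF c] closure_subset) simp
  moreover have "AE x in lebesgue_on \<Omega>. norm (f x) \<le> C"
    by (rule AE_I2, rule C) (use closure_subset in auto)
  ultimately show ?thesis unfolding Linf_functions_def by blast
qed

lemma W_inf_weak_partial_Linf:
  assumes "open \<Omega>" "b \<in> W_inf (Suc k) \<Omega>" "weak_partial \<Omega> i b g"
  shows "g \<in> Linf_functions \<Omega>"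
proof -
  have sub: "sobolev (Linf_functions \<Omega>) \<Omega> k \<subseteq> Linf_functions \<Omega>" by (cases k) auto
  obtain G where G: "G \<in> Linf_functions \<Omega>" "weak_partial \<Omega> i b G"
  proof -
    have "\<exists>G\<in>sobolev (Linf_functions \<Omega>) \<Omega> k. weak_partial \<Omega> i b G"
      using assms(2) by (simp add: W_inf_def)
    then show thesis using sub that by blast
  qed
  obtain C where C: "AE x in lebesgue_on \<Omega>. norm (G x) \<le> C" using G(1) by (auto simp: Linf_functions_def)
  have "g \<in> borel_measurable (lebesgue_on \<Omega>)"
    using assms(3) by (intro locally_integrable_imp_measurable[OF assms(1)]) (simp add: weak_partial_def)
  moreover have "AE x in lebesgue_on \<Omega>. norm (g x) \<le> C"
    using C weak_partial_unique[OF assms(1,3) G(2)] by eventually_elim simp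
  ultimately show ?thesis unfolding Linf_functions_def by blast
qed

theorem corollary1p2:
  fixes \<Omega> :: "(real^'n) set"
    and \<alpha> T :: real
    and A :: "real^'n \<Rightarrow> real^'n^'n"
    and B :: "real^'n \<Rightarrow> real^'n"
    and p :: "real^'n \<Rightarrow> real"
    and u_T :: "(real^'n, 'k::{real_normed_field, euclidean_space}) l2"
    and u :: "real \<Rightarrow> (real^'n, 'k) l2"
  assumes "open \<Omega>" and "connected \<Omega>" and "\<Omega> \<noteq> {}" and "bounded \<Omega>" and "C2_boundary \<Omega>"
    and "0 < \<alpha>" and "\<alpha> \<le> 1" and "T > 0"
    and "symmetric_on (closure \<Omega>) A"
    and "\<And>i j. C1_closure \<Omega> (\<lambda>x. A x $ i $ j)"
    and "uniformly_elliptic_on (closure \<Omega>) A"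
    and "\<And>j. (\<lambda>x. B x $ j) \<in> W_inf 1 \<Omega>"
    and "p \<in> Linf_functions \<Omega>"
    and "\<exists>b \<in> W_inf 2 \<Omega>. \<exists>grad_b :: real^'n \<Rightarrow> real^'n.
           (\<forall>i. weak_partial \<Omega> i b (\<lambda>x. grad_b x $ i)) \<and>
           (AE x in lebesgue_on \<Omega>. B x = A x *v grad_b x)"
    and "u_T \<in> L2_on \<Omega>"
    and "continuous_on {0..T} u" and "u ` {0..T} \<subseteq> L2_on \<Omega>"
    and "backward_solution \<Omega> \<alpha> A B p T u_T u"
    and "u T = 0"
  shows "\<forall>t\<in>{0..T}. u t = 0"
proof -
  note \<Omega> = \<open>open \<Omega>\<close> \<open>bounded \<Omega>\<close>
  obtain b grad_b where b: "b \<in> W_inf 2 \<Omega>" "\<And>i. weak_partial \<Omega> i b (\<lambda>x. grad_b x $ i)"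
    and drift: "AE x in lebesgue_on \<Omega>. B x = A x *v grad_b x"
    using assms(14) by blast
  interpret gradient_drift \<Omega> A B p b grad_b
  proof
    show "A x $ i $ j = A x $ j $ i" if "x \<in> \<Omega>" for x i j
      using assms(9) that closure_subset[of \<Omega>] unfolding symmetric_on_def by blast
    show "(\<lambda>x. A x $ i $ j) \<in> Linf_functions \<Omega>" for i j
      by (rule C1_closure_imp_Linf[OF \<Omega> assms(10)])
    show "b \<in> Linf_functions \<Omega>" using b(1) by (simp add: W_inf_def numeral_2_eq_2)
    show "(\<lambda>x. grad_b x $ i) \<in> Linf_functions \<Omega>" for i
      by (rule W_inf_weak_partial_Linf[OF \<Omega>(1) b(1)[unfolded numeral_2_eq_2] b(2)])
  qed (use \<Omega> assms(13) b(2) drift in auto)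
  obtain S where S: "C0_semigroup_on (L2_on \<Omega>) S" "generator_graph (L2_on \<Omega>) S = elliptic_graph \<Omega> A B p"
    and u0: "u 0 \<in> L2_on \<Omega>" and evol: "\<And>t. t \<in> {0..T} \<Longrightarrow> frac_evolution \<alpha> S t (u 0) (u t)"
    using assms(18) unfolding backward_solution_def solution_def by blast
  obtain \<beta> :: "(real^'n, 'k) l2 \<Rightarrow> (real^'n, 'k) l2 \<Rightarrow> real" where \<beta>: "bounded_bilinear \<beta>"
      "\<And>f g. \<beta> f g = (LINT x|lebesgue_on \<Omega>. exp (b x) * (rep_l2 f x \<bullet> rep_l2 g x))"
      "\<And>f. 0 \<le> \<beta> f f" "\<And>f. f \<in> L2_on \<Omega> \<Longrightarrow> \<beta> f f = 0 \<Longrightarrow> f = 0"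
    by (rule weighted_form) (rule that)
  have \<Omega>_meas: "\<Omega> \<in> sets lebesgue" using \<Omega>(1) by simp
  interpret symmetric_semigroup "l2_mult (indicator \<Omega>)" "L2_on \<Omega>" S \<beta>
  proof (intro symmetric_semigroup.intro projected_semigroup.intro projected_semigroup_axioms.intro symmetric_semigroup_axioms.intro)
    fix f a g c assume "(f, a) \<in> generator_graph (L2_on \<Omega>) S" "(g, c) \<in> generator_graph (L2_on \<Omega>) S"
    then show "\<beta> a g = \<beta> f c" unfolding \<beta>(2) S(2) by (rule graph_symmetric)
  qed (use \<beta> S(1) L2_on_projection_bounded_linear[OF \<Omega>_meas] L2_on_projection_in[OF \<Omega>_meas]
      L2_on_projection_id[OF \<Omega>_meas] in auto)
  have T: "frac_evolution \<alpha> S T (u 0) 0" using evol[of T] assms(8,19) by simp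
  have u0_zero: "u 0 = 0"
  proof (cases "\<alpha> = 1")
    case True
    then have "S T (u 0) = 0" using T by (simp add: frac_evolution_def)
    then show ?thesis by (rule orbit_injective[OF u0 assms(8)])
  next
    case False
    then have \<alpha>: "0 < \<alpha>" "\<alpha> < 1" using assms(6,7) by auto
    have "((\<lambda>s. wright \<alpha> s *\<^sub>R S (s * T powr \<alpha>) (u 0)) has_integral 0) {0<..}"
      using T False by (simp add: frac_evolution_def)
    then show ?thesis
      by (rule weighted_average_injective[OF u0, rotated -1])
        (use \<alpha> assms(8) wright_nonneg wright_continuous wright_0_pos in \<open>auto intro: continuous_at_imp_continuous_on\<close>)
  qed
  show ?thesis
  proof
    fix t assume t: "t \<in> {0..T}"
    have S0: "S r (u 0) = 0" if "0 \<le> r" for r using S_zero[OF that] u0_zero by simp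
    show "u t = 0"
    proof (cases "\<alpha> = 1")
      case True
      then show ?thesis using evol[OF t] S0 t by (simp add: frac_evolution_def)
    next
      case False
      then have "((\<lambda>s. wright \<alpha> s *\<^sub>R S (s * t powr \<alpha>) (u 0)) has_integral u t) {0<..}"
        using evol[OF t] by (simp add: frac_evolution_def)
      then have "((\<lambda>s::real. 0) has_integral u t) {0<..}"
        by (rule has_integral_eq[rotated]) (simp add: S0)
      then show ?thesis by (rule has_integral_unique[OF _ has_integral_0])
    qed
  qed
qed

end
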